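(* Let $\mathcal{X}_{+},\mathcal{X}_{-}$ be real normed spaces and $\theta_{\pm}:\mathcal{M}(S)\to\mathcal{X}_{\pm}$ two linear $\sigma$-normal maps such that the pair $(\theta_{-},\theta_{+})$ is Hölder-type. Let $g_{-}:\mathcal{X}_{-}\to\mathbb{R}$ be lower semicontinuous and convex, such that there is $R_{0}\in\mathbb{R}^{+}$ for which $\{x\in\mathcal{X}_{-}^{\ast}:\Vert x\Vert_{\mathrm{op}}\le R,\ g_{-}^{\ast}(x)<\infty\}$ is nonempty and weak$^{\ast}$-closed for all $R\in[R_{0},\infty)$, and such that $g_{-}^{\ast}$ has minimal linear growth $\Vert\theta_{-}\Vert_{\mathrm{op}}$. Let $g_{+}:\mathcal{X}_{+}\to\mathbb{R}$ be lower semicontinuous, convex and bounded on bounded sets, such that $g_{+}^{\ast}(\mathcal{X}_{+}^{\ast})\subseteq\mathbb{R}$ and $g_{+}^{\ast}$ has minimal linear growth $\Vert\theta_{+}\Vert_{\mathrm{op}}$. Let $\tau_{\pm}(\mu):=\theta_{\pm}(\mu_{S})$ and $P(\mu)=h(\mu)-g_{-}(\tau_{-}(\mu))+g_{+}(\tau_{+}(\mu))$ for $\mu\in\mathcal{P}(T)$. Then: (i) For any $x_{+}\in\mathrm{M}^{\flat}$ there is an ergodic measure $\mu_{x_{+}}\in\mathcal{P}_{\mathrm{erg}}(T)$ such that, for any $x_{-}\in M^{\flat}(x_{+})$, $$E_{\mathrm{L}}^{\mathrm{sc}}(x_{+})=E_{\mathrm{L}}^{\mathrm{sc}}(x_{+},x_{-})=E_{\mathrm{L}}(x_{+},x_{-})=\{\mu_{x_{+}}\}\subseteq\mathcal{P}_{\mathrm{erg}}(T),$$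 and $E_{P}=M_{P}$ is a nonempty weak$^{\ast}$-compact set of ergodic probability measures: $$E_{P}=M_{P}=\{\mu_{x_{+}}:x_{+}\in\mathrm{M}^{\flat}\}\subseteq\mathcal{P}_{\mathrm{erg}}(T).$$ (ii) If $g_{+}:\mathcal{X}_{+}\to\mathbb{R}$ is Gateaux-differentiable, then the mapping $x_{+}\mapsto\mu_{x_{+}}$ from the weak$^{\ast}$-compact set $\mathrm{M}^{\flat}\subseteq\mathcal{X}_{+}^{\ast}$ to $E_{P}\subseteq\mathcal{P}_{\mathrm{erg}}(T)$ is a homeomorphism with respect to the weak$^{\ast}$ topologies of $\mathrm{M}^{\flat}$ and $E_{P}$.
   Context: Symbolic setting: $(\Omega,d)$ is a compact metric space with $\max d(\Omega\times\Omega)=1$; $\mathrm{m}$ is a fixed Borel probability measure on $\Omega$ with support $\Omega$; $\Sigma=\Omega^{\mathbb{N}}$ with the product topology, metrized by $d_{\eta}(\sigma,\sigma')=(1-\eta)\sum_{n\ge1}\eta^{n-1}d(\omega_{n},\omega_{n}')$ for a fixed $\eta\in(0,1)$; $C(\Sigma)$ is the Banach space of real continuous functions with the sup norm, and $C^{\alpha}(\Sigma)$ the $\alpha$-Hölder functions with respect to $d_{\eta}$; $T$ is the shift $T(\omega_{1},\omega_{2},\dots)=(\omega_{2},\omega_{3},\dots)$. $\mathcal{P}\subseteq C(\Sigma)^{\ast}$ is the set of Borel probability measures on $\Sigma$, $\mathcal{P}(T)$ the $T$-invariant ones, $\mathcal{P}_{\mathrm{erg}}(T)$ the ergodic ones (the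 extreme points of $\mathcal{P}(T)$); $\mu(\varphi)=\int\varphi\,\mathrm{d}\mu$. $S=\{\varphi\in C(\Sigma):\Vert\varphi\Vert_{\infty}\le1\}$ with the sup-norm metric; $\mathcal{M}(S)$ is the Banach space of bounded real Borel-measurable functions on $S$ with the sup norm; for $\mu\in C(\Sigma)^{\ast}$, $\mu_{S}\in\mathcal{M}(S)$ is $\mu_{S}(\varphi)=\mu(\varphi)$. A map $\theta$ from $\mathcal{M}(S)$ into a normed space is $\sigma$-normal if $\theta(f_{n})\to\theta(f)$ in norm for every bounded sequence $(f_{n})\subseteq\mathcal{M}(S)$ converging point-wise to $f\in\mathcal{M}(S)$. Hölder-type: for each $y_{\pm}\in\mathcal{X}_{\pm}^{\ast}$ there is a unique $\Theta_{y_{-},y_{+}}\in C(\Sigma)$ with $y_{+}(\theta_{+}(\mu_{S}))-y_{-}(\theta_{-}(\mu_{S}))=\mu(\Theta_{y_{-},y_{+}})$ for all $\mu\in\mathcal{P}$. The pair $(\theta_{-},\theta_{+})$ is Hölder-type if for all $y_{\pm}\in\mathcal{X}_{\pm}^{\ast}$ there is $\alpha=\alpha_{y_{-},y_{+}}\in(0,1]$ with $\Theta_{y_{-},y_{+}}\in C^{\alpha}(\Sigma)$. Entropy: for $\varphi\in C(\Sigma)$, $\mathcal{L}_{0}^{\mathrm{m}}\varphi(\sigma)=\int_{\Omega}\varphi(\omega_{0}\sigma)\,\mathrm{m}(\mathrm{d}\omega_{0})$, where $\omega_{0}\sigma=(\omega_{0},\omega_{1},\dots)$ for $\sigma=(\omega_{1},\omega_{2},\dots)$;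 for $\mu\in\mathcal{P}(T)$, $h(\mu)=\inf_{\varphi}\int_{\Sigma}\ln(\mathcal{L}_{0}^{\mathrm{m}}\varphi(\sigma)/\varphi(\sigma))\,\mu(\mathrm{d}\sigma)\in[-\infty,0]$, infimum over strictly positive $\varphi\in C(\Sigma)$. Convex analysis: $\mathbb{R}^{+}=(0,\infty)$. Duals $\mathcal{X}^{\ast}$ carry the weak$^{\ast}$ topology; $\Vert\cdot\Vert_{\mathrm{op}}$ is the operator norm; $B(0,R)=\{y\in\mathcal{X}^{\ast}:\Vert y\Vert_{\mathrm{op}}\le R\}$. $g^{\ast}(x)=\sup_{y\in\mathcal{X}}\{x(y)-g(y)\}$ for $x\in\mathcal{X}^{\ast}$; $g^{\ast}$ has minimal linear growth $\lambda$ if $\lim_{R\to\infty}\sup_{y\in\mathcal{X}^{\ast}\setminus B(0,R)}\{\lambda\Vert y\Vert_{\mathrm{op}}-g^{\ast}(y)\}=-\infty$; $\partial g(z)=\{x\in\mathcal{X}^{\ast}:x(y-z)\le g(y)-g(z)\ \forall y\in\mathcal{X}\}$. Variational objects, for $y_{\pm}\in\mathcal{X}_{\pm}^{\ast}$ and $\mu\in\mathcal{P}(T)$: $\mathrm{P}(y_{+},y_{-},\mu)=h(\mu)-y_{-}(\theta_{-}(\mu_{S}))+y_{+}(\theta_{+}(\mu_{S}))$; $P_{\mathrm{L}}(y_{+},y_{-})=\sup_{\mu\in\mathcal{P}(T)}\mathrm{P}(y_{+},y_{-},\mu)$; $E_{\mathrm{L}}(y_{+},y_{-})=\{\nu\in\mathcal{P}(T):\mathrm{P}(y_{+},y_{-},\nu)=P_{\mathrm{L}}(y_{+},y_{-})\}$;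 $P_{\mathrm{NL}}(y_{+},y_{-})=P_{\mathrm{L}}(y_{+},y_{-})+g_{-}^{\ast}(y_{-})-g_{+}^{\ast}(y_{+})$; $P^{\flat}(y_{+})=\inf P_{\mathrm{NL}}(y_{+},\mathcal{X}_{-}^{\ast})$; $\mathrm{P}^{\flat}=\sup P^{\flat}(\mathcal{X}_{+}^{\ast})$; $M^{\flat}(y_{+})=\{x_{-}\in\mathcal{X}_{-}^{\ast}:P_{\mathrm{NL}}(y_{+},x_{-})=P^{\flat}(y_{+})\}$; $\mathrm{M}^{\flat}=\{x_{+}\in\mathcal{X}_{+}^{\ast}:P^{\flat}(x_{+})=\mathrm{P}^{\flat}\}$. For $x_{+}\in\mathrm{M}^{\flat}$, $x_{-}\in M^{\flat}(x_{+})$: $E_{\mathrm{L}}^{\mathrm{sc}}(x_{+},x_{-})=\{\mu\in E_{\mathrm{L}}(x_{+},x_{-}):x_{-}\in\partial g_{-}(\tau_{-}(\mu))\}$, which does not depend on $x_{-}\in M^{\flat}(x_{+})$ and is also denoted $E_{\mathrm{L}}^{\mathrm{sc}}(x_{+})$. $M_{P}=\{\mu\in\mathcal{P}(T):P(\mu)=\sup P(\mathcal{P}(T))\}$; $E_{P}=\{\mu\in\mathcal{P}(T):\exists(\mu_{n})_{n\in\mathbb{N}}\subseteq\mathcal{P}(T)$ with $\mu_{n}\to\mu$ weak$^{\ast}$ and $P(\mu_{n})\to\sup P(\mathcal{P}(T))\}$. *)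

theory Defs
  imports "HOL-Probability.Probability"
begin

section \<open>Compact metric spaces and the symbolic space\<close>

class compact_metric_space = metric_space +
  assumes compact_UNIV: "compact (UNIV :: 'a set)"

instance compact_metric_space \<subseteq> polish_space
proof
  fix X :: "nat \<Rightarrow> 'a" assume "Cauchy X"
  then show "convergent X"
    using compact_imp_complete[OF compact_UNIV] unfolding complete_def convergent_def by auto
next
  have "\<forall>e>0. \<exists>k. finite k \<and> (UNIV::'a set) \<subseteq> (\<Union>x\<in>k. ball x e)"
    using compact_UNIV[where 'a='a] by (simp add: compact_eq_totally_bounded)
  then have "\<exists>k. finite k \<and> (UNIV::'a set) \<subseteq> (\<Union>x\<in>k. ball x (inverse (real (Suc n))))" for n
    by (simp del: of_nat_Suc)
  then obtain K where K: "\<And>n. finite (K n)"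
      "\<And>n. (UNIV::'a set) \<subseteq> (\<Union>x\<in>K n. ball x (inverse (real (Suc n))))"
    by metis
  define B where "B = (\<Union>n. (\<lambda>x. ball x (inverse (real (Suc n)))) ` K n)"
  have "topological_basis B"
  proof (rule topological_basisI)
    show "open b" if "b \<in> B" for b using that by (auto simp: B_def)
  next
    fix U :: "'a set" and x assume "open U" "x \<in> U"
    then obtain e where e: "e > 0" "ball x e \<subseteq> U" by (meson openE)
    obtain n where n: "inverse (real (Suc n)) < e / 2"
      using e(1) reals_Archimedean[of "e / 2"] by auto
    obtain y where y: "y \<in> K n" "dist y x < inverse (real (Suc n))"
      using K(2)[of n] by (auto simp: ball_def)
    have "ball y (inverse (real (Suc n))) \<subseteq> ball x e"
    proof
      fix z assume "z \<in> ball y (inverse (real (Suc n)))"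
      then show "z \<in> ball x e"
        using y n dist_triangle[of x z y] by (simp add: dist_commute)
    qed
    with y e show "\<exists>b\<in>B. x \<in> b \<and> b \<subseteq> U"
      by (intro bexI[of _ "ball y (inverse (real (Suc n)))"]) (auto simp: B_def)
  qed
  moreover have "countable B"
    unfolding B_def using K(1) by (intro countable_UN countable_image) (auto intro: countable_finite)
  ultimately show "\<exists>B::'a set set. countable B \<and> open = generate_topology B"
    using topological_basis_imp_subbasis by blast
qed

instance "fun" :: (countable, compact_metric_space) compact_metric_space
proof
  have "compact_space (product_topology (\<lambda>_::'a. euclidean::'b topology) UNIV)"
    unfolding compact_space_product_topology
    using compact_UNIV[where 'a='b] by (simp add: compact_space_def)
  then show "compact (UNIV :: ('a \<Rightarrow> 'b) set)"
    by (simp add: euclidean_product_topology compact_space_def)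
qed

text \<open>
  Sequences in \<open>\<Sigma> = \<Omega>\<^sup>\<nat>\<close> are indexed from 0, so \<open>\<sigma> n\<close> is \<open>\<omega>\<^bsub>n+1\<^esub>\<close>. The instance topology
  on \<^typ>\<open>nat \<Rightarrow> 'a\<close> is the product topology; the instance metric is not \<open>d_eta\<close>, but induces the
  same topology. As \<open>\<Sigma>\<close> is compact, the bounded continuous functions form all of \<open>C(\<Sigma>)\<close>.
\<close>

type_synonym 'a cfun = "(nat \<Rightarrow> 'a) \<Rightarrow>\<^sub>C real"

definition d_eta :: "real \<Rightarrow> (nat \<Rightarrow> 'a::metric_space) \<Rightarrow> (nat \<Rightarrow> 'a) \<Rightarrow> real" where
  "d_eta \<eta> \<sigma> \<sigma>' = (1 - \<eta>) * (\<Sum>n. \<eta> ^ n * dist (\<sigma> n) (\<sigma>' n))"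

definition holder_functions :: "real \<Rightarrow> real \<Rightarrow> 'a::compact_metric_space cfun set" where
  "holder_functions \<eta> \<alpha> =
     {\<phi>. \<exists>C. \<forall>\<sigma> \<sigma>'. \<bar>apply_bcontfun \<phi> \<sigma> - apply_bcontfun \<phi> \<sigma>'\<bar> \<le> C * d_eta \<eta> \<sigma> \<sigma>' powr \<alpha>}"

definition shift :: "(nat \<Rightarrow> 'a) \<Rightarrow> nat \<Rightarrow> 'a" where
  "shift \<sigma> = (\<lambda>n. \<sigma> (Suc n))"

abbreviation weak_star :: "('x::real_normed_vector \<Rightarrow>\<^sub>L real) topology" where
  "weak_star \<equiv> strong_operator_topology"

section \<open>Measures as elements of the dual of \<open>C(\<Sigma>)\<close>\<close>

text \<open>
  A Borel probability measure is identified with the functional \<open>\<phi> \<mapsto> \<integral>\<phi> d\<mu>\<close>, which determines it.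
\<close>

definition represents ::
    "(nat \<Rightarrow> 'a) measure \<Rightarrow> ('a::compact_metric_space cfun \<Rightarrow>\<^sub>L real) \<Rightarrow> bool" where
  "represents M \<mu> \<longleftrightarrow> prob_space M \<and> sets M = sets borel \<and>
     (\<forall>\<phi>. blinfun_apply \<mu> \<phi> = (LINT \<sigma>|M. apply_bcontfun \<phi> \<sigma>))"

definition prob_measures :: "('a::compact_metric_space cfun \<Rightarrow>\<^sub>L real) set" where
  "prob_measures = {\<mu>. \<exists>M. represents M \<mu>}"

definition inv_measures :: "('a::compact_metric_space cfun \<Rightarrow>\<^sub>L real) set" where
  "inv_measures = {\<mu>. \<exists>M. represents M \<mu> \<and> distr M borel shift = M}"

definition erg_measures :: "('a::compact_metric_space cfun \<Rightarrow>\<^sub>L real) set" where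
  "erg_measures = {\<mu>. \<mu> extreme_point_of inv_measures}"

section \<open>The space \<open>\<M>(S)\<close>\<close>

abbreviation unit_ball_C :: "'a::compact_metric_space cfun set" where
  "unit_ball_C \<equiv> cball 0 1"

text \<open>Functions on the unit ball \<open>S\<close> of \<open>C(\<Sigma>)\<close> are encoded as total functions vanishing off \<open>S\<close>.\<close>

typedef (overloaded) 'a bmeas =
  "{f :: 'a::compact_metric_space cfun \<Rightarrow> real.
      f \<in> borel_measurable (restrict_space borel unit_ball_C) \<and>
      bounded (f ` unit_ball_C) \<and> (\<forall>\<phi>. \<phi> \<notin> unit_ball_C \<longrightarrow> f \<phi> = 0)}"
  morphisms apply_bmeas Bmeas
  by (rule exI[of _ "\<lambda>_. 0"]) (auto simp: bounded_def intro!: exI[of _ 0] exI[of _ 1])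

setup_lifting type_definition_bmeas

lemma bmeas_eqI: "(\<And>\<phi>. \<phi> \<in> unit_ball_C \<Longrightarrow> apply_bmeas f \<phi> = apply_bmeas g \<phi>) \<Longrightarrow> f = g"
  using apply_bmeas[of f] apply_bmeas[of g]
  by (intro apply_bmeas_inject[THEN iffD1] ext) (simp del: mem_cball, metis)

lemma bdd_above_bmeas: "bdd_above ((\<lambda>\<phi>. \<bar>apply_bmeas f \<phi>\<bar>) ` unit_ball_C)"
proof -
  obtain c where "\<forall>\<phi>\<in>unit_ball_C. \<bar>apply_bmeas f \<phi>\<bar> \<le> c"
    using apply_bmeas[of f] by (force simp only: bounded_iff mem_Collect_eq real_norm_def)
  then show ?thesis by (intro bdd_aboveI2[of _ _ c]) auto
qed

instantiation bmeas :: (compact_metric_space) real_vector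
begin

lift_definition zero_bmeas :: "'a bmeas" is "\<lambda>_. 0"
  by (auto simp: bounded_def intro!: exI[of _ 0] exI[of _ 1])

lift_definition plus_bmeas :: "'a bmeas \<Rightarrow> 'a bmeas \<Rightarrow> 'a bmeas" is "\<lambda>f g \<phi>. f \<phi> + g \<phi>"
  by (auto intro!: bounded_plus_comp borel_measurable_add)

lift_definition minus_bmeas :: "'a bmeas \<Rightarrow> 'a bmeas \<Rightarrow> 'a bmeas" is "\<lambda>f g \<phi>. f \<phi> - g \<phi>"
  by (auto intro!: bounded_minus_comp borel_measurable_diff)

lift_definition uminus_bmeas :: "'a bmeas \<Rightarrow> 'a bmeas" is "\<lambda>f \<phi>. - f \<phi>"
  by (auto simp: bounded_iff intro!: borel_measurable_uminus)

lift_definition scaleR_bmeas :: "real \<Rightarrow> 'a bmeas \<Rightarrow> 'a bmeas" is "\<lambda>r f \<phi>. r * f \<phi>"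
proof -
  fix r :: real and f :: "'a cfun \<Rightarrow> real"
  assume f: "f \<in> borel_measurable (restrict_space borel unit_ball_C) \<and>
      bounded (f ` unit_ball_C) \<and> (\<forall>\<phi>. \<phi> \<notin> unit_ball_C \<longrightarrow> f \<phi> = 0)"
  then have "bounded ((\<lambda>\<phi>. r *\<^sub>R f \<phi>) ` unit_ball_C)"
    by (intro bounded_scaleR_comp) simp
  with f show "(\<lambda>\<phi>. r * f \<phi>) \<in> borel_measurable (restrict_space borel unit_ball_C) \<and>
      bounded ((\<lambda>\<phi>. r * f \<phi>) ` unit_ball_C) \<and> (\<forall>\<phi>. \<phi> \<notin> unit_ball_C \<longrightarrow> r * f \<phi> = 0)"
    by (simp add: borel_measurable_times)
qed

instance
proof
  fix a b :: real and f g h :: "'a bmeas"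
  show "f + g + h = f + (g + h)" "f + g = g + f" "0 + f = f" "- f + f = 0" "f - g = f + - g"
    "a *\<^sub>R (f + g) = a *\<^sub>R f + a *\<^sub>R g" "(a + b) *\<^sub>R f = a *\<^sub>R f + b *\<^sub>R f"
    "a *\<^sub>R b *\<^sub>R f = (a * b) *\<^sub>R f" "1 *\<^sub>R f = f"
    by (transfer; simp add: fun_eq_iff algebra_simps)+
qed

end

instantiation bmeas :: (compact_metric_space) real_normed_vector
begin

definition norm_bmeas :: "'a bmeas \<Rightarrow> real" where
  "norm_bmeas f = (SUP \<phi>\<in>unit_ball_C. \<bar>apply_bmeas f \<phi>\<bar>)"

definition dist_bmeas :: "'a bmeas \<Rightarrow> 'a bmeas \<Rightarrow> real" where
  "dist_bmeas f g = norm (f - g)"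

definition sgn_bmeas :: "'a bmeas \<Rightarrow> 'a bmeas" where
  "sgn_bmeas f = f /\<^sub>R norm f"

definition uniformity_bmeas :: "('a bmeas \<times> 'a bmeas) filter" where
  "uniformity_bmeas = (INF e\<in>{0 <..}. principal {(x, y). dist x y < e})"

definition open_bmeas :: "'a bmeas set \<Rightarrow> bool" where
  "open_bmeas U = (\<forall>x\<in>U. \<forall>\<^sub>F (x', y) in uniformity. x' = x \<longrightarrow> y \<in> U)"

instance
proof
  fix a :: real and f g :: "'a bmeas"
  have ne: "(unit_ball_C :: 'a cfun set) \<noteq> {}" by simp
  have up: "\<bar>apply_bmeas f \<phi>\<bar> \<le> norm f" if "\<phi> \<in> unit_ball_C" for f :: "'a bmeas" and \<phi>
    unfolding norm_bmeas_def by (rule cSUP_upper[OF that bdd_above_bmeas])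
  have le: "norm f \<le> c" if "\<And>\<phi>. \<phi> \<in> unit_ball_C \<Longrightarrow> \<bar>apply_bmeas f \<phi>\<bar> \<le> c"
    for f :: "'a bmeas" and c
    unfolding norm_bmeas_def using that by (intro cSUP_least[OF ne]) auto
  have nn: "0 \<le> norm f" for f :: "'a bmeas"
    using up[of 0 f] abs_ge_zero[of "apply_bmeas f 0"] by (simp del: abs_ge_zero)
  show "dist f g = norm (f - g)" by (fact dist_bmeas_def)
  show "sgn f = f /\<^sub>R norm f" by (fact sgn_bmeas_def)
  show "uniformity = (INF e\<in>{0 <..}. principal {(x, y::'a bmeas). dist x y < e})"
    by (fact uniformity_bmeas_def)
  show "open U = (\<forall>x\<in>U. \<forall>\<^sub>F (x', y) in uniformity. x' = x \<longrightarrow> y \<in> U)" for U :: "'a bmeas set"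
    by (fact open_bmeas_def)
  show "norm f = 0 \<longleftrightarrow> f = 0"
  proof
    assume "norm f = 0"
    then have "apply_bmeas f \<phi> = apply_bmeas 0 \<phi>" if "\<phi> \<in> unit_ball_C" for \<phi>
      using up[OF that, of f] by (simp add: zero_bmeas.rep_eq)
    then show "f = 0" by (rule bmeas_eqI)
  next
    assume "f = 0"
    then show "norm f = 0" using nn[of f] le[of f 0] by (simp add: zero_bmeas.rep_eq)
  qed
  show "norm (f + g) \<le> norm f + norm g"
  proof (rule le)
    fix \<phi> :: "'a cfun" assume "\<phi> \<in> unit_ball_C"
    then show "\<bar>apply_bmeas (f + g) \<phi>\<bar> \<le> norm f + norm g"
      using up[of \<phi> f] up[of \<phi> g] by (simp add: plus_bmeas.rep_eq)
  qed
  have sc: "norm (a *\<^sub>R f) \<le> \<bar>a\<bar> * norm f" for a and f :: "'a bmeas"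
    by (rule le) (use up in \<open>auto simp: scaleR_bmeas.rep_eq abs_mult intro!: mult_left_mono\<close>)
  show "norm (a *\<^sub>R f) = \<bar>a\<bar> * norm f"
  proof (cases "a = 0")
    case True
    then show ?thesis using sc[of a f] nn[of "a *\<^sub>R f"] by simp
  next
    case False
    have "inverse a *\<^sub>R (a *\<^sub>R f) = f"
      using False by transfer (simp add: fun_eq_iff)
    then have "norm f \<le> \<bar>inverse a\<bar> * norm (a *\<^sub>R f)" using sc[of "inverse a" "a *\<^sub>R f"] by simp
    then have "\<bar>a\<bar> * norm f \<le> norm (a *\<^sub>R f)" using False by (simp add: field_simps)
    then show ?thesis using sc[of a f] by simp
  qed
qed

end

lift_definition restrict_S :: "('a::compact_metric_space cfun \<Rightarrow>\<^sub>L real) \<Rightarrow> 'a bmeas" is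
  "\<lambda>\<mu> \<phi>. if \<phi> \<in> unit_ball_C then blinfun_apply \<mu> \<phi> else 0"
proof (intro CollectI conjI)
  fix \<mu> :: "'a cfun \<Rightarrow>\<^sub>L real"
  have "continuous_on UNIV (blinfun_apply \<mu>)"
    by (simp add: linear_continuous_on blinfun.bounded_linear_right)
  then have "blinfun_apply \<mu> \<in> borel_measurable (restrict_space borel unit_ball_C)"
    by (intro measurable_restrict_space1 borel_measurable_continuous_onI)
  then show "(\<lambda>\<phi>. if \<phi> \<in> unit_ball_C then blinfun_apply \<mu> \<phi> else 0)
      \<in> borel_measurable (restrict_space borel unit_ball_C)"
    by (rule measurable_cong[THEN iffD1, rotated]) (simp add: space_restrict_space)
  have "\<bar>blinfun_apply \<mu> \<phi>\<bar> \<le> norm \<mu>" if "norm \<phi> \<le> 1" for \<phi>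
    using norm_blinfun[of \<mu> \<phi>] mult_left_le[OF that norm_ge_zero[of \<mu>]] by simp
  then show "bounded ((\<lambda>\<phi>. if \<phi> \<in> unit_ball_C then blinfun_apply \<mu> \<phi> else 0) ` unit_ball_C)"
    by (auto simp: bounded_iff intro!: exI[of _ "norm \<mu>"])
qed auto

definition sigma_normal :: "('a::compact_metric_space bmeas \<Rightarrow> 'x::real_normed_vector) \<Rightarrow> bool" where
  "sigma_normal \<theta> \<longleftrightarrow>
     (\<forall>F f. bounded (range F) \<and>
        (\<forall>\<phi>\<in>unit_ball_C. (\<lambda>n. apply_bmeas (F n) \<phi>) \<longlonglongrightarrow> apply_bmeas f \<phi>) \<longrightarrow>
        (\<lambda>n. \<theta> (F n)) \<longlonglongrightarrow> \<theta> f)"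

definition tau ::
    "('a::compact_metric_space bmeas \<Rightarrow> 'x) \<Rightarrow> ('a cfun \<Rightarrow>\<^sub>L real) \<Rightarrow> 'x" where
  "tau \<theta> \<mu> = \<theta> (restrict_S \<mu>)"

text \<open>Throughout, the suffixes \<open>m\<close> and \<open>p\<close> stand for the subscripts minus and plus.\<close>

definition Theta ::
    "('a::compact_metric_space bmeas \<Rightarrow> 'x::real_normed_vector) \<Rightarrow>
     ('a bmeas \<Rightarrow> 'y::real_normed_vector) \<Rightarrow>
     ('x \<Rightarrow>\<^sub>L real) \<Rightarrow> ('y \<Rightarrow>\<^sub>L real) \<Rightarrow> 'a cfun" where
  "Theta \<theta>m \<theta>p ym yp = (THE \<Phi>. \<forall>\<mu>\<in>prob_measures.
     blinfun_apply yp (\<theta>p (restrict_S \<mu>)) - blinfun_apply ym (\<theta>m (restrict_S \<mu>))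
       = blinfun_apply \<mu> \<Phi>)"

definition holder_type ::
    "real \<Rightarrow> ('a::compact_metric_space bmeas \<Rightarrow> 'x::real_normed_vector) \<Rightarrow>
     ('a bmeas \<Rightarrow> 'y::real_normed_vector) \<Rightarrow> bool" where
  "holder_type \<eta> \<theta>m \<theta>p \<longleftrightarrow>
     (\<forall>ym yp. \<exists>\<alpha>. 0 < \<alpha> \<and> \<alpha> \<le> 1 \<and> Theta \<theta>m \<theta>p ym yp \<in> holder_functions \<eta> \<alpha>)"

section \<open>Entropy\<close>

definition transfer_op ::
    "'a measure \<Rightarrow> 'a::compact_metric_space cfun \<Rightarrow> (nat \<Rightarrow> 'a) \<Rightarrow> real" where
  "transfer_op m \<phi> \<sigma> = (LINT \<omega>|m. apply_bcontfun \<phi> (case_nat \<omega> \<sigma>))"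

text \<open>
  The integral of the continuous function \<open>ln (\<L>\<phi> / \<phi>)\<close> against \<open>\<mu>\<close> is the value of the
  functional \<open>\<mu>\<close> on it; \<open>entropy_integrand_bcontfun\<close> and \<open>entropy_integral\<close> below show that
  \<^const>\<open>Bcontfun\<close> is applied within its range and that the value is the integral.
\<close>

definition entropy ::
    "'a measure \<Rightarrow> ('a::compact_metric_space cfun \<Rightarrow>\<^sub>L real) \<Rightarrow> ereal" where
  "entropy m \<mu> = (INF \<phi>\<in>{\<phi>. \<forall>\<sigma>. 0 < apply_bcontfun \<phi> \<sigma>}.
     ereal (blinfun_apply \<mu> (Bcontfun (\<lambda>\<sigma>. ln (transfer_op m \<phi> \<sigma> / apply_bcontfun \<phi> \<sigma>)))))"

lemma continuous_case_nat:
  "continuous_on UNIV (\<lambda>(\<omega>, \<sigma>). case_nat \<omega> \<sigma> :: nat \<Rightarrow> 'a::topological_space)"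
  unfolding split_beta
proof (rule continuous_on_coordinatewise_then_product)
  fix i :: nat
  show "continuous_on UNIV (\<lambda>p::'a \<times> (nat \<Rightarrow> 'a). case_nat (fst p) (snd p) i)"
  proof (cases i)
    case (Suc j)
    have "continuous_on UNIV (\<lambda>p::'a \<times> (nat \<Rightarrow> 'a). snd p j)"
      by (rule continuous_on_product_then_coordinatewise) (intro continuous_intros)
    then show ?thesis using Suc by simp
  qed (simp add: continuous_on_fst)
qed

lemma continuous_transfer_op:
  fixes \<phi> :: "'a::compact_metric_space cfun"
  assumes "prob_space m" "sets m = sets borel"
  shows "continuous_on UNIV (transfer_op m \<phi>)"
proof -
  interpret prob_space m by fact
  have cont: "continuous_on UNIV (\<lambda>(\<omega>, \<sigma>). apply_bcontfun \<phi> (case_nat \<omega> \<sigma>))"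
    using continuous_on_compose2[OF continuous_on_apply_bcontfun[of UNIV \<phi>] continuous_case_nat]
    by (simp add: split_beta)
  have c1: "continuous_on UNIV (\<lambda>\<omega>. apply_bcontfun \<phi> (case_nat \<omega> \<sigma>))" for \<sigma>
    using continuous_on_compose2[OF cont, of UNIV "\<lambda>\<omega>. (\<omega>, \<sigma>)"]
    by (simp add: continuous_intros)
  have c2: "continuous_on UNIV (\<lambda>\<sigma>. apply_bcontfun \<phi> (case_nat \<omega> \<sigma>))" for \<omega>
    using continuous_on_compose2[OF cont, of UNIV "\<lambda>\<sigma>. (\<omega>, \<sigma>)"]
    by (simp add: continuous_intros)
  have meas: "(\<lambda>\<omega>. apply_bcontfun \<phi> (case_nat \<omega> \<sigma>)) \<in> borel_measurable m" for \<sigma>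
    using borel_measurable_continuous_onI[OF c1[of \<sigma>]] assms(2) by (simp cong: measurable_cong_sets)
  show ?thesis
  proof (rule continuous_on_sequentiallyI)
    fix s :: "nat \<Rightarrow> nat \<Rightarrow> 'a" and l assume s: "s \<longlonglongrightarrow> l"
    show "(\<lambda>n. transfer_op m \<phi> (s n)) \<longlonglongrightarrow> transfer_op m \<phi> l"
      unfolding transfer_op_def
    proof (rule integral_dominated_convergence[where w = "\<lambda>_. norm \<phi>"])
      show "AE \<omega> in m. (\<lambda>n. apply_bcontfun \<phi> (case_nat \<omega> (s n))) \<longlonglongrightarrow> apply_bcontfun \<phi> (case_nat \<omega> l)"
        using continuous_on_tendsto_compose[OF c2 s] by simp
    qed (use meas norm_bounded[of \<phi>] in auto)
  qed
qed

lemma transfer_op_pos: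
  fixes \<phi> :: "'a::compact_metric_space cfun"
  assumes "prob_space m" "sets m = sets borel" "\<And>\<sigma>. 0 < apply_bcontfun \<phi> \<sigma>"
  shows "0 < transfer_op m \<phi> \<sigma>"
proof -
  interpret prob_space m by fact
  have "continuous_on UNIV (\<lambda>\<omega>. case_nat \<omega> \<sigma>)"
    using continuous_on_compose2[OF continuous_case_nat, of UNIV "\<lambda>\<omega>. (\<omega>, \<sigma>)"]
    by (simp add: continuous_intros)
  then have "continuous_on UNIV (\<lambda>\<omega>. apply_bcontfun \<phi> (case_nat \<omega> \<sigma>))"
    using continuous_on_compose2[OF continuous_on_apply_bcontfun[of UNIV \<phi>]] by simp
  then have meas: "(\<lambda>\<omega>. apply_bcontfun \<phi> (case_nat \<omega> \<sigma>)) \<in> borel_measurable m"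
    using borel_measurable_continuous_onI assms(2) by (simp cong: measurable_cong_sets)
  have int: "integrable m (\<lambda>\<omega>. apply_bcontfun \<phi> (case_nat \<omega> \<sigma>))"
    by (rule integrable_const_bound[where B = "norm \<phi>"]) (use meas norm_bounded[of \<phi>] in auto)
  obtain \<sigma>0 where "\<And>\<sigma>. apply_bcontfun \<phi> \<sigma>0 \<le> apply_bcontfun \<phi> \<sigma>"
    using continuous_attains_inf[OF compact_UNIV _ continuous_on_apply_bcontfun[of UNIV \<phi>]] by auto
  then have "apply_bcontfun \<phi> \<sigma>0 \<le> transfer_op m \<phi> \<sigma>"
    unfolding transfer_op_def using integral_mono[OF integrable_const int] by (simp add: prob_space)
  then show ?thesis using assms(3)[of \<sigma>0] by simp
qed

lemma entropy_integrand_bcontfun: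
  fixes \<phi> :: "'a::compact_metric_space cfun"
  assumes "prob_space m" "sets m = sets borel" "\<And>\<sigma>. 0 < apply_bcontfun \<phi> \<sigma>"
  shows "(\<lambda>\<sigma>. ln (transfer_op m \<phi> \<sigma> / apply_bcontfun \<phi> \<sigma>)) \<in> bcontfun"
proof -
  have "continuous_on UNIV (\<lambda>\<sigma>. ln (transfer_op m \<phi> \<sigma> / apply_bcontfun \<phi> \<sigma>))"
    by (intro continuous_on_ln continuous_on_divide continuous_transfer_op[OF assms(1,2)]
        continuous_on_apply_bcontfun ballI)
      (metis assms(3) less_irrefl divide_pos_pos transfer_op_pos[OF assms])+
  moreover from compact_continuous_image[OF this compact_UNIV]
  have "bounded (range (\<lambda>\<sigma>. ln (transfer_op m \<phi> \<sigma> / apply_bcontfun \<phi> \<sigma>)))"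
    by (rule compact_imp_bounded)
  ultimately show ?thesis by (simp add: bcontfun_def)
qed

lemma entropy_integral:
  fixes \<phi> :: "'a::compact_metric_space cfun"
  assumes "prob_space m" "sets m = sets borel" "\<And>\<sigma>. 0 < apply_bcontfun \<phi> \<sigma>" "represents M \<mu>"
  shows "blinfun_apply \<mu> (Bcontfun (\<lambda>\<sigma>. ln (transfer_op m \<phi> \<sigma> / apply_bcontfun \<phi> \<sigma>)))
    = (LINT \<sigma>|M. ln (transfer_op m \<phi> \<sigma> / apply_bcontfun \<phi> \<sigma>))"
  using assms(4) Bcontfun_inverse[OF entropy_integrand_bcontfun[OF assms(1-3)]]
  by (simp add: represents_def)

section \<open>Convex analysis\<close>

definition lower_semicontinuous :: "('x::topological_space \<Rightarrow> real) \<Rightarrow> bool" where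
  "lower_semicontinuous g \<longleftrightarrow> (\<forall>a. open {x. a < g x})"

definition conjugate :: "('x::real_normed_vector \<Rightarrow> real) \<Rightarrow> ('x \<Rightarrow>\<^sub>L real) \<Rightarrow> ereal" where
  "conjugate g x = (SUP y. ereal (blinfun_apply x y - g y))"

definition minimal_linear_growth :: "(('x::real_normed_vector \<Rightarrow>\<^sub>L real) \<Rightarrow> ereal) \<Rightarrow> real \<Rightarrow> bool" where
  "minimal_linear_growth f c \<longleftrightarrow>
     ((\<lambda>R::real. SUP y\<in>- cball 0 R. ereal (c * norm y) - f y) \<longlongrightarrow> -\<infinity>) at_top"

definition subdifferential :: "('x::real_normed_vector \<Rightarrow> real) \<Rightarrow> 'x \<Rightarrow> ('x \<Rightarrow>\<^sub>L real) set" where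
  "subdifferential g z = {x. \<forall>y. blinfun_apply x (y - z) \<le> g y - g z}"

definition gateaux_differentiable :: "('x::real_normed_vector \<Rightarrow> real) \<Rightarrow> bool" where
  "gateaux_differentiable g \<longleftrightarrow>
     (\<forall>x. \<exists>D :: 'x \<Rightarrow>\<^sub>L real. \<forall>v.
        ((\<lambda>t::real. (g (x + t *\<^sub>R v) - g x) / t) \<longlongrightarrow> blinfun_apply D v) (at 0))"

section \<open>Variational objects\<close>

definition pressure_functional ::
    "'a measure \<Rightarrow> ('a::compact_metric_space bmeas \<Rightarrow> 'x::real_normed_vector) \<Rightarrow>
     ('a bmeas \<Rightarrow> 'y::real_normed_vector) \<Rightarrow> ('x \<Rightarrow> real) \<Rightarrow> ('y \<Rightarrow> real) \<Rightarrow>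
     ('a cfun \<Rightarrow>\<^sub>L real) \<Rightarrow> ereal" where
  "pressure_functional m \<theta>m \<theta>p gm gp \<mu> =
     entropy m \<mu> - ereal (gm (tau \<theta>m \<mu>)) + ereal (gp (tau \<theta>p \<mu>))"

definition M_P where
  "M_P m \<theta>m \<theta>p gm gp = {\<mu> \<in> inv_measures.
     pressure_functional m \<theta>m \<theta>p gm gp \<mu> = Sup (pressure_functional m \<theta>m \<theta>p gm gp ` inv_measures)}"

definition E_P where
  "E_P m \<theta>m \<theta>p gm gp = {\<mu> \<in> inv_measures. \<exists>\<mu>s :: nat \<Rightarrow> _.
     (\<forall>n. \<mu>s n \<in> inv_measures) \<and> limitin weak_star \<mu>s \<mu> sequentially \<and>
     (\<lambda>n. pressure_functional m \<theta>m \<theta>p gm gp (\<mu>s n))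
       \<longlonglongrightarrow> Sup (pressure_functional m \<theta>m \<theta>p gm gp ` inv_measures)}"

definition lin_functional ::
    "'a measure \<Rightarrow> ('a::compact_metric_space bmeas \<Rightarrow> 'x::real_normed_vector) \<Rightarrow>
     ('a bmeas \<Rightarrow> 'y::real_normed_vector) \<Rightarrow> ('y \<Rightarrow>\<^sub>L real) \<Rightarrow> ('x \<Rightarrow>\<^sub>L real) \<Rightarrow>
     ('a cfun \<Rightarrow>\<^sub>L real) \<Rightarrow> ereal" where
  "lin_functional m \<theta>m \<theta>p yp ym \<mu> =
     entropy m \<mu> - ereal (blinfun_apply ym (\<theta>m (restrict_S \<mu>)))
       + ereal (blinfun_apply yp (\<theta>p (restrict_S \<mu>)))"

definition P_L where
  "P_L m \<theta>m \<theta>p yp ym = Sup (lin_functional m \<theta>m \<theta>p yp ym ` inv_measures)"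

definition E_L where
  "E_L m \<theta>m \<theta>p yp ym =
     {\<nu> \<in> inv_measures. lin_functional m \<theta>m \<theta>p yp ym \<nu> = P_L m \<theta>m \<theta>p yp ym}"

text \<open>
  When \<open>P_L\<close> and \<open>conjugate gp\<close> are finite, the only possibly infinite term below is
  \<open>conjugate gm ym\<close>, with value \<open>\<infinity>\<close>.
\<close>

definition P_NL where
  "P_NL m \<theta>m \<theta>p gm gp yp ym = P_L m \<theta>m \<theta>p yp ym + conjugate gm ym - conjugate gp yp"

text \<open>
  \<open>P_flat\<close> and \<open>M_flat_minus\<close> are the functions \<open>P\<^sup>\<flat>(y\<^sub>+)\<close> and \<open>M\<^sup>\<flat>(y\<^sub>+)\<close> of \<open>y\<^sub>+\<close>, while \<open>P_flat_sup\<close> and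
  \<open>M_flat\<close> are the number and the set written with the same letters in roman type.
\<close>

definition P_flat where
  "P_flat m \<theta>m \<theta>p gm gp yp = (INF ym. P_NL m \<theta>m \<theta>p gm gp yp ym)"

definition P_flat_sup where
  "P_flat_sup m \<theta>m \<theta>p gm gp = (SUP yp. P_flat m \<theta>m \<theta>p gm gp yp)"

definition M_flat_minus where
  "M_flat_minus m \<theta>m \<theta>p gm gp yp =
     {xm. P_NL m \<theta>m \<theta>p gm gp yp xm = P_flat m \<theta>m \<theta>p gm gp yp}"

definition M_flat where
  "M_flat m \<theta>m \<theta>p gm gp = {xp. P_flat m \<theta>m \<theta>p gm gp xp = P_flat_sup m \<theta>m \<theta>p gm gp}"

definition E_L_sc where
  "E_L_sc m \<theta>m \<theta>p gm xp xm =
     {\<mu> \<in> E_L m \<theta>m \<theta>p xp xm. xm \<in> subdifferential gm (tau \<theta>m \<mu>)}"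

text \<open>The common value of \<open>E_L_sc\<close> over all \<open>xm\<close> in \<open>M_flat_minus\<close>, on which it does not depend.\<close>

definition E_L_sc_common where
  "E_L_sc_common m \<theta>m \<theta>p gm gp xp =
     (THE E. \<forall>xm\<in>M_flat_minus m \<theta>m \<theta>p gm gp xp. E = E_L_sc m \<theta>m \<theta>p gm xp xm)"

end

theory Submission
  imports Defs
begin

text \<open>
  A Hoelder potential \<open>A\<close> has a unique equilibrium measure, and it is ergodic. The transfer operator
  of \<open>A\<close> contracts cones of log-Hoelder functions, which yields a positive eigenfunction \<open>u\<close> and a
  normalized operator \<open>N\<close> whose iterates converge uniformly to the integral against a measure \<open>\<nu>\<close>
  (Riesz). Substituting \<open>exp A * \<psi> * u\<close> into the infimum defining the entropy, Jensen's inequality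
  shows that \<open>\<nu>\<close> is an equilibrium measure, and differentiation at \<open>\<psi> = 1\<close> shows that every
  equilibrium measure is \<open>N\<close>-invariant, hence equal to \<open>\<nu>\<close>.

  Each pair \<open>(x\<^sub>+, x\<^sub>-)\<close> thus has a single equilibrium measure. At a minimizer \<open>x\<^sub>-\<close> of
  \<open>P_NL x\<^sub>+\<close> the first-order condition, whose derivative exists because of this uniqueness, says that
  \<open>x\<^sub>-\<close> is a subgradient of \<open>gm\<close> at \<open>\<tau>\<^sub>-\<close> of the equilibrium measure. Hence this measure is the only
  maximizer of \<open>\<mu> \<mapsto> h \<mu> - gm (\<tau>\<^sub>- \<mu>) + x\<^sub>+ (\<tau>\<^sub>+ \<mu>) - gp\<^sup>* x\<^sub>+\<close>, with maximum
  \<open>P_flat x\<^sub>+\<close>; no minimax theorem is needed. Maximizing over \<open>x\<^sub>+\<close> as well gives the description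
  of \<open>M_P\<close>, and the pairs of maximizers form a compact graph whose two projections are \<open>M_flat\<close>
  and \<open>M_P\<close>.
\<close>

section \<open>Positive functionals on continuous functions\<close>

text \<open>Three obstacles shape the arguments. The weak-star topology of
  \<open>prob_measures\<close> is metrizable, so sequences suffice there, but the duals of the two
  normed spaces need not be metrizable on bounded sets. Minimizers in those duals and the compact
  graph are therefore obtained from intersections of closed sets and from the finite intersection
  property. The function \<open>gm\<close> is merely lower semicontinuous, so no subgradient at a
  prescribed point is available in advance; affine minorants with value just below \<open>gm\<close>
  at the point replace it, and a strict inequality is refuted with the room they leave. In contrast
  \<open>gp\<close>, being bounded on bounded sets, has a subgradient everywhere. Finally,
  everything must stay in a ball to be weak-star compact: a functional \<open>y\<close> satisfies
  \<open>\<bar>y (tau \<theta> \<mu>)\<bar> \<le> onorm \<theta> * norm y\<close> on probability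
  measures, and the growth conditions are calibrated to exactly this slope.\<close>

lemma bcontfun_compactI:
  fixes f :: "'b::compact_metric_space \<Rightarrow> real"
  assumes "continuous_on UNIV f"
  shows "f \<in> bcontfun"
  using assms compact_imp_bounded[OF compact_continuous_image[OF assms compact_UNIV]]
  by (simp add: bcontfun_def)

lemma apply_Bcontfun:
  fixes f :: "'b::compact_metric_space \<Rightarrow> real"
  assumes "continuous_on UNIV f"
  shows "apply_bcontfun (Bcontfun f) = f"
  by (rule Bcontfun_inverse[OF bcontfun_compactI[OF assms]])

lemma continuous_integrable:
  fixes f :: "'b::compact_metric_space \<Rightarrow> real"
  assumes "continuous_on UNIV f" "finite_measure M" "sets M = sets borel"
  shows "integrable M f"
proof -
  interpret finite_measure M by fact
  show ?thesis
    using assms norm_bounded[of "Bcontfun f"] borel_measurable_continuous_onI[OF assms(1)]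
    by (intro integrable_const_bound[where B = "norm (Bcontfun f)"])
       (auto simp: apply_Bcontfun cong: measurable_cong_sets)
qed

text \<open>Continuous functions increasing to the indicator of an open set. \<open>U = UNIV\<close>
  is a separate case because the distance to the empty set is 0 by convention, which would give the
  zero function.\<close>

definition bump :: "'b::metric_space set \<Rightarrow> nat \<Rightarrow> 'b \<Rightarrow> real" where
  "bump U k x = (if U = UNIV then 1 else min 1 (real k * infdist x (- U)))"

lemma continuous_on_bump [continuous_intros]: "continuous_on S (bump U k)"
  by (cases "U = UNIV") (auto simp: bump_def[abs_def] intro!: continuous_intros)

lemma bump_nonneg: "0 \<le> bump U k x" and bump_le_one: "bump U k x \<le> 1"
  by (auto simp: bump_def infdist_nonneg)

lemma bump_outside: "x \<notin> U \<Longrightarrow> bump U k x = 0"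
  by (auto simp: bump_def)

lemma bump_mono: "j \<le> k \<Longrightarrow> bump U j x \<le> bump U k x"
proof -
  assume "j \<le> k"
  then have "real j * infdist x (- U) \<le> real k * infdist x (- U)"
    by (intro mult_right_mono infdist_nonneg) simp
  then show ?thesis by (auto simp: bump_def)
qed

lemma bump_inside:
  assumes "open U" "x \<in> U"
  shows "\<exists>k0. \<forall>k\<ge>k0. bump U k x = 1"
proof (cases "U = UNIV")
  case False
  then have pos: "0 < infdist x (- U)"
    using assms by (intro infdist_pos_not_in_closed) auto
  obtain k0 where k0: "1 < real k0 * infdist x (- U)"
    using reals_Archimedean3[OF pos] by blast
  have "bump U k x = 1" if "k0 \<le> k" for k
  proof -
    have "real k0 * infdist x (- U) \<le> real k * infdist x (- U)"
      using that pos by (intro mult_right_mono) auto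
    with k0 False show ?thesis by (simp add: bump_def)
  qed
  then show ?thesis by blast
qed (simp add: bump_def)

lemma bump_tendsto:
  assumes "open U"
  shows "(\<lambda>k. bump U k x) \<longlonglongrightarrow> indicator U x"
proof (cases "x \<in> U")
  case True
  with bump_inside[OF assms True] show ?thesis
    by (intro tendsto_eventually) (simp add: eventually_sequentially)
qed (simp add: bump_outside)

lemma integral_bump_tendsto:
  fixes M :: "'b::compact_metric_space measure"
  assumes "finite_measure M" "sets M = sets borel" "open U"
  shows "(\<lambda>k. LINT x|M. bump U k x) \<longlonglongrightarrow> measure M U"
proof -
  interpret finite_measure M by fact
  have "(\<lambda>k. LINT x|M. bump U k x) \<longlonglongrightarrow> (LINT x|M. indicator U x)"
  proof (rule integral_dominated_convergence[where w = "\<lambda>_. 1"])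
    show "bump U k \<in> borel_measurable M" for k
      using borel_measurable_continuous_onI[OF continuous_on_bump] assms(2)
      by (simp cong: measurable_cong_sets)
    show "indicator U \<in> borel_measurable M"
      using assms by (intro borel_measurable_indicator) auto
  qed (use bump_tendsto[OF assms(3)] bump_nonneg[of U] bump_le_one[of U] in auto)
  moreover have "(LINT x|M. indicator U x) = measure M U"
    using assms sets_eq_imp_space_eq[OF assms(2)] by simp
  ultimately show ?thesis by simp
qed

text \<open>Testing only the bumps of a generating \<pi>-system of open sets, rather than all
  continuous functions, is what later yields a countable separating family.\<close>

lemma measure_eq_if_integrals_eq:
  fixes M N :: "'b::compact_metric_space measure"
  assumes M: "finite_measure M" "sets M = sets borel"
    and N: "finite_measure N" "sets N = sets borel"
    and B: "Int_stable B" "B \<subseteq> Collect open" "UNIV \<in> B" "sets borel = sigma_sets UNIV B"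
    and eq: "\<And>U k. U \<in> B \<Longrightarrow> (LINT x|M. bump U k x) = (LINT x|N. bump U k x)"
  shows "M = N"
proof (rule measure_eqI_generator_eq[where E = B and \<Omega> = UNIV and A = "\<lambda>_. UNIV"])
  interpret M: finite_measure M by fact
  interpret N: finite_measure N by fact
  show "emeasure M X = emeasure N X" if "X \<in> B" for X
  proof -
    have "measure M X = measure N X"
      using LIMSEQ_unique[OF integral_bump_tendsto[OF M, of X]] integral_bump_tendsto[OF N, of X]
        eq[OF that] B(2) that by auto
    then show ?thesis by (simp add: M.emeasure_eq_measure N.emeasure_eq_measure)
  qed
qed (use assms in \<open>auto simp: finite_measure.emeasure_finite\<close>)

text \<open>Finite intersections of members of a countable base; the empty intersection contributes
  \<open>UNIV\<close>.\<close>

lemma ex_Int_stable_countable_base: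
  "\<exists>B :: 'b::second_countable_topology set set. countable B \<and> Int_stable B \<and> B \<subseteq> Collect open \<and>
     UNIV \<in> B \<and> sets borel = sigma_sets UNIV B"
proof -
  obtain B0 :: "'b set set" where B0: "countable B0" "topological_basis B0"
    using ex_countable_basis by blast
  define B where "B = Inter ` {F. F \<subseteq> B0 \<and> finite F}"
  have "countable B"
    using countable_Collect_finite_subset[OF B0(1)] by (simp add: B_def conj_commute)
  moreover have "Int_stable B"
    unfolding Int_stable_def B_def
    by (auto simp: Inter_Un_distrib[symmetric] intro!: imageI)
  moreover have "B \<subseteq> Collect open"
    using topological_basis_open[OF B0(2)] by (auto simp: B_def intro!: open_Inter)
  moreover have "UNIV \<in> B"
    unfolding B_def by (rule image_eqI[of _ _ "{}"]) auto
  moreover have "sets borel = sigma_sets UNIV B"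
  proof
    have "B0 \<subseteq> B"
    proof
      fix b assume "b \<in> B0"
      then show "b \<in> B"
        unfolding B_def by (intro image_eqI[of _ _ "{b}"]) auto
    qed
    then have "sigma_sets UNIV B0 \<subseteq> sigma_sets UNIV B"
      by (intro sigma_sets_mono) auto
    then show "sets borel \<subseteq> sigma_sets UNIV B"
      by (simp add: borel_eq_countable_basis[OF B0])
    show "sigma_sets UNIV B \<subseteq> sets borel"
    proof -
      have "B \<subseteq> sets borel" using \<open>B \<subseteq> Collect open\<close> by auto
      from sets.sigma_sets_subset[OF this] show ?thesis by simp
    qed
  qed
  ultimately show ?thesis by blast
qed

lemma measure_eq_if_continuous_integrals_eq:
  fixes M N :: "'b::compact_metric_space measure"
  assumes "finite_measure M" "sets M = sets borel" "finite_measure N" "sets N = sets borel"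
    and "\<And>f :: 'b \<Rightarrow> real. continuous_on UNIV f \<Longrightarrow> (LINT x|M. f x) = (LINT x|N. f x)"
  shows "M = N"
proof -
  obtain B :: "'b set set" where "Int_stable B" "B \<subseteq> Collect open" "UNIV \<in> B"
    "sets borel = sigma_sets UNIV B"
    using ex_Int_stable_countable_base[where 'b='b] by blast
  then show ?thesis
    using assms by (intro measure_eq_if_integrals_eq[where B = B] assms(5) continuous_on_bump)
qed

section \<open>Riesz representation of positive normalized functionals\<close>

text \<open>\<open>L\<close> acts on raw functions, with laws only for continuous ones, so that both
  integration against an element of the dual and the limit functional \<open>mean\<close> below are
  instances.\<close>

locale positive_functional =
  fixes L :: "('b::compact_metric_space \<Rightarrow> real) \<Rightarrow> real"
  assumes add: "continuous_on UNIV f \<Longrightarrow> continuous_on UNIV g \<Longrightarrow> L (\<lambda>x. f x + g x) = L f + L g"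
    and scale: "continuous_on UNIV f \<Longrightarrow> L (\<lambda>x. c * f x) = c * L f"
    and nonneg: "continuous_on UNIV f \<Longrightarrow> (\<And>x. 0 \<le> f x) \<Longrightarrow> 0 \<le> L f"
    and one: "L (\<lambda>_. 1) = 1"
begin

lemma const: "L (\<lambda>_. c) = c"
  using scale[of "\<lambda>_. 1" c] one by simp

lemma diff:
  assumes "continuous_on UNIV f" "continuous_on UNIV g"
  shows "L (\<lambda>x. f x - g x) = L f - L g"
  using add[OF assms(1), of "\<lambda>x. - 1 * g x"] scale[OF assms(2), of "- 1"] assms(2)
  by (simp add: continuous_intros)

lemma mono:
  assumes "continuous_on UNIV f" "continuous_on UNIV g" "\<And>x. f x \<le> g x"
  shows "L f \<le> L g"
  using nonneg[of "\<lambda>x. g x - f x"] diff[OF assms(2,1)] assms by (simp add: continuous_intros)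

lemma sum:
  assumes "finite I" "\<And>i. i \<in> I \<Longrightarrow> continuous_on UNIV (f i)"
  shows "L (\<lambda>x. \<Sum>i\<in>I. f i x) = (\<Sum>i\<in>I. L (f i))"
  using assms
proof (induction I rule: finite_induct)
  case (insert i I)
  then show ?case
    using add[of "f i" "\<lambda>x. \<Sum>i\<in>I. f i x"] by (simp add: continuous_on_sum)
qed (simp add: const)

text \<open>The inner content of the Riesz construction. Domination by the indicator replaces the
  usual condition on supports; the difference is absorbed by an additive error in the two estimates
  below.\<close>

definition open_content :: "'b set \<Rightarrow> ennreal" where
  "open_content U = (SUP f\<in>{f. continuous_on UNIV f \<and> (\<forall>x. 0 \<le> f x \<and> f x \<le> indicator U x)}. ennreal (L f))"

definition outer :: "'b set \<Rightarrow> ennreal" where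
  "outer E = (INF U\<in>{U. open U \<and> E \<subseteq> U}. open_content U)"

lemma open_content_upper:
  "continuous_on UNIV f \<Longrightarrow> (\<And>x. 0 \<le> f x) \<Longrightarrow> (\<And>x. f x \<le> indicator U x) \<Longrightarrow> ennreal (L f) \<le> open_content U"
  unfolding open_content_def by (rule SUP_upper) auto

lemma open_content_mono: "U \<subseteq> V \<Longrightarrow> open_content U \<le> open_content V"
  unfolding open_content_def
proof (intro SUP_subset_mono order_refl subsetI CollectI conjI allI)
  fix f and x :: 'b
  assume "U \<subseteq> V" and f: "f \<in> {f. continuous_on UNIV f \<and> (\<forall>x. 0 \<le> f x \<and> f x \<le> (indicator U x :: real))}"
  from \<open>U \<subseteq> V\<close> have "(indicator U x :: real) \<le> indicator V x" by (auto simp: indicator_def)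
  with f show "f x \<le> indicator V x" by (auto intro: order_trans)
qed auto

lemma open_content_empty: "open_content {} = 0"
proof -
  have "f = (\<lambda>_. 0)" if "\<forall>x. 0 \<le> f x \<and> f x \<le> 0" for f :: "'b \<Rightarrow> real"
    using that by (auto intro: antisym)
  then show ?thesis
    unfolding open_content_def using const[of 0] by (intro antisym SUP_least) auto
qed

lemma open_content_UNIV: "open_content UNIV = 1"
proof (rule antisym)
  show "open_content UNIV \<le> 1"
    unfolding open_content_def
  proof (rule SUP_least)
    fix f assume "f \<in> {f. continuous_on UNIV f \<and> (\<forall>x::'b. 0 \<le> f x \<and> f x \<le> (indicator UNIV x :: real))}"
    then show "ennreal (L f) \<le> 1" using mono[of f "\<lambda>_. 1"] one by simp
  qed
  show "1 \<le> open_content UNIV"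
    using open_content_upper[of "\<lambda>_. 1" UNIV] one by simp
qed

lemma outer_open: "open U \<Longrightarrow> outer U = open_content U"
  unfolding outer_def by (rule antisym) (auto intro: INF_lower INF_greatest open_content_mono)

lemma outer_mono: "E \<subseteq> F \<Longrightarrow> outer E \<le> outer F"
  unfolding outer_def by (rule INF_superset_mono) auto

text \<open>A Dini-type argument: the sums \<open>g k\<close> of the bumps of the first
  \<open>k\<close> sets increase with \<open>k\<close> and finally exceed \<open>f - e\<close> at
  each point, so the open sets \<open>W k\<close> increase to the whole space and compactness
  provides a single \<open>k\<close>.\<close>

lemma open_content_UN_le:
  fixes U :: "nat \<Rightarrow> 'b set"
  assumes "\<And>n. open (U n)"
  shows "open_content (\<Union>n. U n) \<le> (\<Sum>n. open_content (U n))"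
  unfolding open_content_def[of "\<Union>n. U n"]
proof (rule SUP_least, rule ennreal_le_epsilon)
  fix f and e :: real
  assume "f \<in> {f. continuous_on UNIV f \<and> (\<forall>x. 0 \<le> f x \<and> f x \<le> (indicator (\<Union>n. U n) x :: real))}"
    and e: "0 < e"
  then have f: "continuous_on UNIV f" "\<And>x. 0 \<le> f x" "\<And>x. f x \<le> indicator (\<Union>n. U n) x" by auto
  define g where "g k x = (\<Sum>n<k. bump (U n) k x)" for k x
  have cg: "continuous_on UNIV (g k)" for k
    unfolding g_def by (intro continuous_intros)
  define W where "W k = {x. f x < g k x + e}" for k
  have W: "open (W k)" for k
    unfolding W_def by (intro open_Collect_less continuous_intros f cg)
  have incW: "W j \<subseteq> W k" if "j \<le> k" for j k
  proof -
    have "g j x \<le> g k x" for x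
    proof -
      have "g j x \<le> (\<Sum>n<j. bump (U n) k x)"
        unfolding g_def using that by (intro sum_mono bump_mono)
      also have "\<dots> \<le> g k x"
        unfolding g_def using that by (intro sum_mono2 bump_nonneg) auto
      finally show ?thesis .
    qed
    then show ?thesis unfolding W_def by (smt (verit, best) Collect_mono)
  qed
  have "x \<in> (\<Union>k. W k)" for x
  proof (cases "\<exists>n. x \<in> U n")
    case True
    then obtain n k0 where n: "\<forall>k\<ge>k0. bump (U n) k x = 1" using bump_inside[OF assms] by blast
    define k where "k = max k0 (Suc n)"
    have "bump (U n) k x \<le> g k x"
      unfolding g_def by (rule member_le_sum) (auto simp: k_def bump_nonneg)
    moreover have "f x \<le> 1" using f(3)[of x] by (rule order_trans) (rule indicator_le_1)
    ultimately have "x \<in> W k" using n e by (simp add: W_def k_def)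
    then show ?thesis by blast
  next
    case False
    then have "f x \<le> 0" using f(3)[of x] by simp
    moreover have "0 \<le> g 0 x" by (simp add: g_def)
    ultimately have "x \<in> W 0" using e by (simp add: W_def)
    then show ?thesis by blast
  qed
  then have "UNIV \<subseteq> (\<Union>k. W k)" by blast
  then obtain K where K: "finite K" "UNIV \<subseteq> (\<Union>k\<in>K. W k)"
    using compactE_image[OF compact_UNIV, of UNIV W] W by metis
  have "W k \<subseteq> W (Max K)" if "k \<in> K" for k using that K(1) by (intro incW) simp
  with K(2) have W1: "x \<in> W (Max K)" for x by blast
  define k where "k = Max K"
  have "L f \<le> L (\<lambda>x. g k x + e)"
    using W1 by (intro mono f continuous_intros cg) (auto simp: W_def k_def less_imp_le)
  also have "\<dots> = (\<Sum>n<k. L (bump (U n) k)) + e"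
    using add[OF cg, of "\<lambda>_. e" k] const[of e] sum[of "{..<k}" "\<lambda>n. bump (U n) k"]
    by (simp add: g_def[abs_def] continuous_on_bump)
  finally have "ennreal (L f) \<le> ennreal ((\<Sum>n<k. L (bump (U n) k)) + e)"
    by (rule ennreal_leI)
  also have "\<dots> = (\<Sum>n<k. ennreal (L (bump (U n) k))) + ennreal e"
    using e by (simp add: ennreal_plus sum_nonneg nonneg continuous_on_bump bump_nonneg sum_ennreal)
  also have "(\<Sum>n<k. ennreal (L (bump (U n) k))) \<le> (\<Sum>n<k. open_content (U n))"
    by (intro sum_mono open_content_upper continuous_on_bump bump_nonneg)
      (auto simp: indicator_def bump_outside bump_le_one)
  also have "\<dots> \<le> (\<Sum>n. open_content (U n))"
    by (rule sum_le_suminf) auto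
  finally show "ennreal (L f) \<le> (\<Sum>n. open_content (U n)) + ennreal e"
    by (simp add: add_right_mono)
qed

lemma outer_space: "outer_measure_space (Pow UNIV) outer"
  unfolding outer_measure_space_def
proof (intro conjI)
  show "positive (Pow UNIV) outer"
    using outer_open[of "{}"] open_content_empty by (simp add: positive_def)
  show "increasing (Pow UNIV) outer"
    using outer_mono by (simp add: increasing_def)
  show "countably_subadditive (Pow UNIV) outer"
    unfolding countably_subadditive_def
  proof (intro allI impI)
    fix A :: "nat \<Rightarrow> 'b set"
    show "outer (\<Union>i. A i) \<le> (\<Sum>i. outer (A i))"
    proof (rule ennreal_le_epsilon)
      fix e :: real assume e: "0 < e" and fin: "(\<Sum>i. outer (A i)) < top"
      have "\<exists>U. open U \<and> A n \<subseteq> U \<and> open_content U \<le> outer (A n) + ennreal (e * (1/2) ^ Suc n)" for n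
      proof -
        have "outer (A n) \<noteq> top"
          using fin sum_le_suminf[of "\<lambda>i. outer (A i)" "{n}"] by (auto simp: top_unique)
        then have "outer (A n) < outer (A n) + ennreal (e * (1/2) ^ Suc n)"
          using e ennreal_add_left_cancel_less[of "outer (A n)" 0 "ennreal (e * (1/2) ^ Suc n)"] by simp
        then obtain U where "open U" "A n \<subseteq> U" "open_content U < outer (A n) + ennreal (e * (1/2) ^ Suc n)"
          unfolding outer_def[of "A n"] INF_less_iff by blast
        then show ?thesis by (auto intro: less_imp_le)
      qed
      then obtain U where U: "\<And>n. open (U n)" "\<And>n. A n \<subseteq> U n"
        "\<And>n. open_content (U n) \<le> outer (A n) + ennreal (e * (1/2) ^ Suc n)" by metis
      have "outer (\<Union>i. A i) \<le> outer (\<Union>i. U i)"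
        using U(2) by (intro outer_mono) auto
      also have "\<dots> = open_content (\<Union>i. U i)" using U(1) by (intro outer_open) auto
      also have "\<dots> \<le> (\<Sum>i. open_content (U i))" by (rule open_content_UN_le[OF U(1)])
      also have "\<dots> \<le> (\<Sum>i. outer (A i) + ennreal (e * (1/2) ^ Suc i))"
        by (intro suminf_le U(3)) auto
      also have "\<dots> = (\<Sum>i. outer (A i)) + (\<Sum>i. ennreal (e * (1/2) ^ Suc i))"
        by (simp add: suminf_add[symmetric])
      also have "(\<Sum>i. ennreal (e * (1/2) ^ Suc i)) = ennreal e"
        using e sums_mult[OF power_half_series, of e] by (intro suminf_ennreal_eq) auto
      finally show "outer (\<Union>i. A i) \<le> (\<Sum>i. outer (A i)) + ennreal e" .
    qed
  qed
qed

text \<open>Truncating a competitor \<open>f\<close> for \<open>V \<inter> U\<close> at height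
  \<open>d\<close> makes it vanish on the open set \<open>W\<close>, which still contains
  \<open>V - U\<close>. A competitor for \<open>W\<close> can then be added without exceeding the
  indicator of \<open>V\<close>, and the truncation costs only \<open>d\<close>.\<close>

lemma open_content_split:
  assumes "open U" "open V"
  shows "open_content (V \<inter> U) + outer (V - U) \<le> open_content V"
proof -
  have "ennreal (L f) \<le> open_content V - outer (V - U)"
    if f: "continuous_on UNIV f" "\<And>x. 0 \<le> f x" "\<And>x. f x \<le> indicator (V \<inter> U) x" for f
  proof (rule ennreal_le_epsilon)
    fix d :: real assume d: "0 < d"
    define W where "W = V \<inter> {x. f x < d}"
    have oW: "open W"
      unfolding W_def by (intro open_Int assms open_Collect_less continuous_intros f)
    have "x \<in> W" if "x \<in> V - U" for x
      using that f(3)[of x] d by (simp add: W_def)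
    then have sub: "V - U \<subseteq> W" by blast
    define f' where "f' x = max 0 (f x - d)" for x
    have cf': "continuous_on UNIV f'" unfolding f'_def by (intro continuous_intros f)
    have "ennreal (L f') + open_content W \<le> open_content V"
      unfolding open_content_def[of W]
    proof (subst ennreal_SUP_add_right)
      show "(SUP g\<in>{g. continuous_on UNIV g \<and> (\<forall>x. 0 \<le> g x \<and> g x \<le> indicator W x)}.
         ennreal (L f') + ennreal (L g)) \<le> open_content V"
      proof (rule SUP_least)
        fix g assume "g \<in> {g. continuous_on UNIV g \<and> (\<forall>x. 0 \<le> g x \<and> g x \<le> (indicator W x :: real))}"
        then have g: "continuous_on UNIV g" "\<And>x. 0 \<le> g x" "\<And>x. g x \<le> indicator W x" by auto
        have "f' x + g x \<le> indicator V x" for x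
        proof -
          have "f x \<le> 1" using f(3)[of x] by (rule order_trans) (rule indicator_le_1)
          then show ?thesis
            using f(2,3)[of x] g(2,3)[of x] d
            by (auto simp: f'_def W_def indicator_def max_def split: if_splits)
        qed
        then have "ennreal (L (\<lambda>x. f' x + g x)) \<le> open_content V"
          using g by (intro open_content_upper continuous_intros cf') (auto simp: f'_def)
        then show "ennreal (L f') + ennreal (L g) \<le> open_content V"
          using add[OF cf' g(1)] nonneg[OF g(1,2)] nonneg[OF cf'] by (simp add: f'_def ennreal_plus)
      qed
    qed (auto intro!: exI[of _ "\<lambda>_. 0"])
    moreover have "outer (V - U) \<le> open_content W"
      using outer_mono[OF sub] outer_open[OF oW] by simp
    ultimately have "ennreal (L f') + outer (V - U) \<le> open_content V"
      by (meson add_left_mono order_trans)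
    then have "ennreal (L f') \<le> open_content V - outer (V - U)"
      by (metis ennreal_add_diff_cancel_right add_right_mono open_content_mono open_content_UNIV ennreal_minus_mono
          infinity_ennreal_def ennreal_one_less_top leD order_refl order_trans outer_mono outer_open open_UNIV subset_UNIV)
    moreover have "L f \<le> L (\<lambda>x. f' x + d)"
      by (intro mono f continuous_intros cf') (auto simp: f'_def)
    moreover have "L (\<lambda>x. f' x + d) = L f' + d"
      using add[OF cf', of "\<lambda>_. d"] const[of d] by simp
    ultimately show "ennreal (L f) \<le> open_content V - outer (V - U) + ennreal d"
      using d nonneg[OF cf']
      by (smt (verit) add_right_mono ennreal_leI ennreal_plus f'_def order_trans)
  qed
  then have "open_content (V \<inter> U) \<le> open_content V - outer (V - U)"
    unfolding open_content_def[of "V \<inter> U"] by (intro SUP_least) auto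
  then have "open_content (V \<inter> U) + outer (V - U) \<le> open_content V - outer (V - U) + outer (V - U)"
    by (rule add_right_mono)
  also have "\<dots> = open_content V"
    using outer_mono[of "V - U" V] outer_open[OF assms(2)] by (intro diff_add_cancel_ennreal) simp
  finally show ?thesis .
qed

text \<open>Caratheodory's condition for open sets. An arbitrary test set is enlarged to an open
  one, where \<open>open_content_split\<close> applies.\<close>

lemma open_in_lambda_system:
  assumes "open U"
  shows "U \<in> lambda_system UNIV (Pow UNIV) outer"
proof -
  interpret sigma_algebra UNIV "Pow UNIV :: 'b set set" by (rule sigma_algebra_Pow)
  have "outer (E \<inter> U) + outer (E - U) = outer E" for E
  proof (rule antisym)
    show "outer (E \<inter> U) + outer (E - U) \<le> outer E"
      unfolding outer_def[of E]
    proof (rule INF_greatest)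
      fix V assume "V \<in> {V. open V \<and> E \<subseteq> V}"
      then have V: "open V" "E \<subseteq> V" by auto
      have "outer (E \<inter> U) + outer (E - U) \<le> outer (V \<inter> U) + outer (V - U)"
        using V by (intro add_mono outer_mono) auto
      also have "\<dots> \<le> open_content V"
        using open_content_split[OF assms V(1)] outer_open[of "V \<inter> U"] assms V open_Int by metis
      finally show "outer (E \<inter> U) + outer (E - U) \<le> open_content V" .
    qed
    have "subadditive (Pow UNIV) outer"
      using outer_space countably_subadditive_subadditive by (auto simp: outer_measure_space_def)
    then show "outer E \<le> outer (E \<inter> U) + outer (E - U)"
      using subadditiveD[of "Pow UNIV" outer "E \<inter> U" "E - U"] by (auto simp: Int_Diff_Un)
  qed
  then show ?thesis by (subst lambda_system_eq) auto
qed

definition riesz :: "'b measure" where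
  "riesz = measure_of UNIV (sets borel) outer"

lemma sets_riesz: "sets riesz = sets borel"
  unfolding riesz_def using sets.sigma_sets_eq[of "borel :: 'b measure"] by simp

lemma emeasure_riesz:
  assumes "A \<in> sets borel"
  shows "emeasure riesz A = outer A"
  unfolding riesz_def
proof (rule emeasure_measure_of_sigma)
  interpret sigma_algebra UNIV "Pow UNIV :: 'b set set" by (rule sigma_algebra_Pow)
  have ms: "measure_space UNIV (lambda_system UNIV (Pow UNIV) outer) outer"
    by (rule caratheodory_lemma[OF outer_space])
  then have sa: "sigma_algebra UNIV (lambda_system UNIV (Pow UNIV) outer)"
    by (simp add: measure_space_def)
  have "sets borel \<subseteq> lambda_system UNIV (Pow UNIV) outer"
    using sigma_algebra.sigma_sets_subset[OF sa, of "Collect open"] open_in_lambda_system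
    by (auto simp only: borel_def sets_measure_of subset_Pow_Union subset_UNIV Pow_UNIV)
  then have "measure_space UNIV (sets borel) outer"
    using measure_down[OF ms] sets.sigma_algebra_axioms[of borel] by simp
  then show "sigma_algebra UNIV (sets (borel :: 'b measure))" "positive (sets borel) outer"
    "countably_additive (sets borel) outer"
    by (auto simp: measure_space_def)
qed fact

lemma prob_space_riesz: "prob_space riesz"
proof
  have "space riesz = UNIV" using sets_eq_imp_space_eq[OF sets_riesz] by simp
  then show "emeasure riesz (space riesz) = 1"
    using outer_open[of UNIV] open_content_UNIV by (simp add: emeasure_riesz)
qed

text \<open>Layer cake: \<open>n * f\<close> is the sum of the slices \<open>g i\<close>, each below
  the indicator of \<open>U i = {i < n * f}\<close>, while these indicators add up to at most
  \<open>n * f + 1\<close>. Hence the error \<open>1 / n\<close>.\<close>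

lemma le_integral_riesz:
  assumes f: "continuous_on UNIV f" "\<And>x. 0 \<le> f x" "\<And>x. f x \<le> 1"
  shows "L f \<le> (LINT x|riesz. f x)"
proof -
  interpret prob_space riesz by (rule prob_space_riesz)
  have "L f \<le> (LINT x|riesz. f x) + 1 / real n" if n: "0 < n" for n :: nat
  proof -
    define U where "U i = {x. real i < real n * f x}" for i
    have oU: "open (U i)" for i
      unfolding U_def by (intro open_Collect_less continuous_intros f)
    define g where "g i x = min 1 (max 0 (real n * f x - real i))" for i x
    have cg: "continuous_on UNIV (g i)" for i
      unfolding g_def by (intro continuous_intros f)
    have sg: "(\<Sum>i<k. g i x) = min (real n * f x) (real k)" for k x
    proof (induction k)
      case (Suc k) then show ?case using f(2)[of x] by (auto simp: g_def)
    qed (use f in simp)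
    have si: "(\<Sum>i<k. indicator (U i) x) \<le> real n * f x + (1::real)" for k x
    proof -
      have "(\<Sum>i<k. indicator (U i) x) \<le> min (real k) (real n * f x + (1::real))" 
      proof (induction k)
        case (Suc k) then show ?case by (auto simp: U_def indicator_def)
      qed (use f in simp)
      then show ?thesis by simp
    qed
    have gU: "L (g i) \<le> measure riesz (U i)" for i
    proof -
      have "ennreal (L (g i)) \<le> emeasure riesz (U i)"
        unfolding emeasure_riesz[OF borel_open[OF oU]] outer_open[OF oU]
        by (intro open_content_upper cg) (auto simp: g_def U_def indicator_def)
      then show ?thesis by (simp add: emeasure_eq_measure)
    qed
    have "real n * L f = L (\<lambda>x. real n * f x)" using scale[OF f(1)] by simp
    also have "\<dots> = L (\<lambda>x. \<Sum>i<n. g i x)" using f(3) by (simp add: sg min_absorb1 mult_left_le)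
    also have "\<dots> = (\<Sum>i<n. L (g i))" by (rule sum) (auto intro: cg)
    also have "\<dots> \<le> (\<Sum>i<n. measure riesz (U i))" by (intro sum_mono gU)
    also have "\<dots> = (LINT x|riesz. (\<Sum>i<n. indicator (U i) x))"
      using oU sets_eq_imp_space_eq[OF sets_riesz]
      by (subst Bochner_Integration.integral_sum) (auto simp: sets_riesz emeasure_eq_measure)
    also have "\<dots> \<le> (LINT x|riesz. real n * f x + 1)"
      using oU si f continuous_integrable[OF f(1) finite_measure_axioms sets_riesz]
      by (intro integral_mono Bochner_Integration.integrable_sum)
        (auto simp: sets_riesz emeasure_eq_measure)
    also have "\<dots> = real n * (LINT x|riesz. f x) + 1"
      using continuous_integrable[OF f(1) finite_measure_axioms sets_riesz] by (simp add: prob_space)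
    finally show ?thesis using n by (simp add: field_simps)
  qed
  then have "\<forall>\<^sub>F n in sequentially. L f \<le> (LINT x|riesz. f x) + 1 / real n"
    by (auto simp: eventually_sequentially intro!: exI[of _ 1])
  moreover have "(\<lambda>n. (LINT x|riesz. f x) + 1 / real n) \<longlonglongrightarrow> (LINT x|riesz. f x) + 0"
    by (intro tendsto_intros lim_const_over_n)
  ultimately show ?thesis
    using tendsto_lowerbound[OF _ _ sequentially_bot] by fastforce
qed

text \<open>One inequality is enough: it extends from values in \<open>[0, 1]\<close> to bounded
  functions by an affine rescaling, and it is then used for \<open>f\<close> and for
  \<open>- f\<close>.\<close>

theorem integral_riesz:
  assumes f: "continuous_on UNIV f"
  shows "L f = (LINT x|riesz. f x)"
proof -
  interpret prob_space riesz by (rule prob_space_riesz)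
  have int: "integrable riesz g" if "continuous_on UNIV g" for g :: "'b \<Rightarrow> real"
    by (rule continuous_integrable[OF that finite_measure_axioms sets_riesz])
  define B where "B = norm (Bcontfun f) + 1"
  have B: "0 < B" "\<bar>f x\<bar> \<le> B" for x
    using norm_bounded[of "Bcontfun f" x] f by (auto simp: B_def apply_Bcontfun add_nonneg_pos)
  have le: "L g \<le> (LINT x|riesz. g x)" if g: "continuous_on UNIV g" "\<And>x. \<bar>g x\<bar> \<le> B" for g
  proof -
    define h where "h x = (g x + B) / (2 * B)" for x
    have ch: "continuous_on UNIV h" unfolding h_def using B by (intro continuous_intros g) auto
    have "0 \<le> h x" "h x \<le> 1" for x using g(2)[of x] B by (auto simp: h_def field_simps)
    then have "L h \<le> (LINT x|riesz. h x)" by (intro le_integral_riesz ch)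
    moreover have gh: "g = (\<lambda>x. 2 * B * h x - B)" using B by (auto simp: h_def)
    ultimately show ?thesis
      using B int[OF ch] scale[OF ch, of "2 * B"] diff[of "\<lambda>x. 2 * B * h x" "\<lambda>_. B"] const[of B] ch
      by (simp add: gh[THEN fun_cong] prob_space continuous_intros)
  qed
  show ?thesis
    using le[OF f B(2)] le[of "\<lambda>x. - 1 * f x"] scale[OF f, of "- 1"] f B(2)
    by (simp add: continuous_intros)
qed

end

section \<open>Weak-star topology\<close>

lemma topspace_weak_star [simp]: "topspace weak_star = UNIV"
  by (rule strong_operator_topology_topspace)

lemma weak_star_apply_continuous: "continuous_map weak_star euclidean (\<lambda>f. blinfun_apply f x)"
  by (rule strong_operator_topology_continuous_evaluation)

text \<open>Meant for the weak-star topology, which is the pullback of the product topology along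
  \<open>blinfun_apply\<close>.\<close>

lemma compactin_pullback_topology:
  assumes "compactin T (f ` S)"
  shows "compactin (pullback_topology UNIV f T) S"
  unfolding compactin_def
proof (intro conjI allI impI)
  show "S \<subseteq> topspace (pullback_topology UNIV f T)"
    using compactin_subset_topspace[OF assms] by (auto simp: topspace_pullback_topology)
  fix \<U> assume U: "Ball \<U> (openin (pullback_topology UNIV f T)) \<and> S \<subseteq> \<Union>\<U>"
  then have "\<forall>u\<in>\<U>. \<exists>v. openin T v \<and> u = f -` v"
    by (auto simp: openin_pullback_topology)
  then obtain V where V: "\<And>u. u \<in> \<U> \<Longrightarrow> openin T (V u)" "\<And>u. u \<in> \<U> \<Longrightarrow> u = f -` V u" by metis
  have "f ` S \<subseteq> \<Union> (V ` \<U>)" using U V(2) by blast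
  then obtain F where F: "finite F" "F \<subseteq> V ` \<U>" "f ` S \<subseteq> \<Union>F"
    using assms V(1) unfolding compactin_def by (smt (verit, ccfv_SIG) imageE)
  then obtain G where G: "G \<subseteq> \<U>" "finite G" "F = V ` G" by (meson finite_subset_image)
  have "S \<subseteq> \<Union>G"
  proof
    fix x assume "x \<in> S"
    then obtain u where "u \<in> G" "f x \<in> V u" using F(3) G(3) by blast
    then show "x \<in> \<Union>G" using V(2)[of u] G(1) by auto
  qed
  with G show "\<exists>\<F>. finite \<F> \<and> \<F> \<subseteq> \<U> \<and> S \<subseteq> \<Union>\<F>" by blast
qed

text \<open>Banach-Alaoglu: in the function space the ball becomes the set of linear functions,
  closed under pointwise convergence, inside a product of compact intervals.\<close>

theorem compactin_weak_star_cball: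
  "compactin weak_star (cball (0 :: 'x::real_normed_vector \<Rightarrow>\<^sub>L real) R)"
proof (cases "0 \<le> R")
  case True
  define K where "K = PiE UNIV (\<lambda>x::'x. {- (R * norm x)..R * norm x})"
  have "compactin (product_topology (\<lambda>_. euclidean) UNIV) K"
    unfolding K_def by (subst compactin_PiE) auto
  then have K: "compact K" by (simp add: euclidean_product_topology)
  define Lin where "Lin = {g :: 'x \<Rightarrow> real. \<forall>x y. g (x + y) = g x + g y} \<inter> {g. \<forall>c x. g (c *\<^sub>R x) = c * g x}"
  have "closed Lin"
    unfolding Lin_def
    by (intro closed_Int closed_Collect_all closed_Collect_eq continuous_intros
        continuous_on_product_coordinates)
  then have "compact (K \<inter> Lin)" by (rule compact_Int_closed[OF K])
  moreover have "blinfun_apply ` cball 0 R = K \<inter> Lin"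
  proof
    show "blinfun_apply ` cball 0 R \<subseteq> K \<inter> Lin"
    proof safe
      fix f :: "'x \<Rightarrow>\<^sub>L real" assume f: "f \<in> cball 0 R"
      have "\<bar>blinfun_apply f x\<bar> \<le> R * norm x" for x
        using norm_blinfun[of f x] f mult_right_mono[of "norm f" R "norm x"] by simp
      then have "- (R * norm x) \<le> blinfun_apply f x \<and> blinfun_apply f x \<le> R * norm x" for x
        by (smt (verit))
      then show "blinfun_apply f \<in> K" by (simp add: K_def PiE_iff)
    qed (auto simp: Lin_def blinfun.add_right blinfun.scaleR_right)
    show "K \<inter> Lin \<subseteq> blinfun_apply ` cball 0 R"
    proof
      fix g assume g: "g \<in> K \<inter> Lin"
      then have bnd: "\<bar>g x\<bar> \<le> R * norm x" for x
        by (auto simp: K_def PiE_iff abs_le_iff minus_le_iff)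
      have bl: "bounded_linear g"
        by (rule bounded_linear_intro[where K = R])
          (use g bnd in \<open>auto simp: Lin_def mult.commute\<close>)
      have "norm (Blinfun g) \<le> R"
        using True bnd by (intro norm_blinfun_bound) (auto simp: bounded_linear_Blinfun_apply[OF bl])
      then show "g \<in> blinfun_apply ` cball 0 R"
        by (intro image_eqI[of _ _ "Blinfun g"]) (auto simp: bounded_linear_Blinfun_apply[OF bl])
    qed
  qed
  ultimately show ?thesis
    unfolding strong_operator_topology_def by (intro compactin_pullback_topology) simp
qed (simp add: cball_empty)

lemma limitin_weak_star:
  "limitin weak_star f l F \<longleftrightarrow> (\<forall>x. ((\<lambda>n. blinfun_apply (f n) x) \<longlongrightarrow> blinfun_apply l x) F)"
proof
  assume "limitin weak_star f l F"
  from continuous_map_limit[OF weak_star_apply_continuous this]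
  show "\<forall>x. ((\<lambda>n. blinfun_apply (f n) x) \<longlongrightarrow> blinfun_apply l x) F"
    by (simp add: o_def)
next
  assume "\<forall>x. ((\<lambda>n. blinfun_apply (f n) x) \<longlongrightarrow> blinfun_apply l x) F"
  then have "limitin (product_topology (\<lambda>_. euclidean) UNIV) (\<lambda>n. blinfun_apply (f n)) (blinfun_apply l) F"
    by (simp add: limitin_componentwise)
  then have lim: "limitin euclidean (\<lambda>n. blinfun_apply (f n)) (blinfun_apply l) F"
    by (simp add: euclidean_product_topology)
  show "limitin weak_star f l F"
    unfolding limitin_def
  proof (intro conjI allI impI)
    fix U assume "openin weak_star U \<and> l \<in> U"
    then obtain V where V: "open V" "U = blinfun_apply -` V" "blinfun_apply l \<in> V"
      by (auto simp: strong_operator_topology_def openin_pullback_topology)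
    from lim V(1,3) have "\<forall>\<^sub>F n in F. blinfun_apply (f n) \<in> V"
      by (simp add: tendsto_def)
    then show "\<forall>\<^sub>F n in F. f n \<in> U" by (simp add: V(2))
  qed simp
qed

lemma closedin_weak_star_le: "closedin weak_star {f. blinfun_apply f x \<le> c}"
  using closedin_continuous_map_preimage[OF weak_star_apply_continuous, of "{..c}" x] by simp

lemma closedin_weak_star_eq:
  "closedin weak_star {f. blinfun_apply f x = blinfun_apply f y}"
  using closedin_continuous_map_preimage[OF weak_star_apply_continuous, of "{0}" "x - y"]
  by (simp add: blinfun.diff_right)

lemma Hausdorff_weak_star: "Hausdorff_space (weak_star :: ('x::real_normed_vector \<Rightarrow>\<^sub>L real) topology)"
  unfolding Hausdorff_space_def
proof (intro allI impI)
  fix f g :: "'x \<Rightarrow>\<^sub>L real"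
  assume "f \<in> topspace weak_star \<and> g \<in> topspace weak_star \<and> f \<noteq> g"
  then obtain x where "blinfun_apply f x \<noteq> blinfun_apply g x" by (meson blinfun_eqI)
  then obtain U V where UV: "open U" "open V" "blinfun_apply f x \<in> U" "blinfun_apply g x \<in> V" "U \<inter> V = {}"
    using hausdorff by metis
  have "openin weak_star {f. blinfun_apply f x \<in> U}" "openin weak_star {f. blinfun_apply f x \<in> V}"
    using openin_continuous_map_preimage[OF weak_star_apply_continuous, of _ x] UV by force+
  with UV show "\<exists>U V. openin weak_star U \<and> openin weak_star V \<and> f \<in> U \<and> g \<in> V \<and> disjnt U V"
    by (intro exI conjI) (assumption | auto simp: disjnt_def)+
qed

section \<open>Probability measures and invariant measures\<close>

lemma represents_nonneg:
  assumes "represents M \<mu>" "\<And>\<sigma>. 0 \<le> apply_bcontfun \<phi> \<sigma>"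
  shows "0 \<le> blinfun_apply \<mu> \<phi>"
  using assms by (simp add: represents_def)

lemma represents_const:
  assumes "represents M \<mu>"
  shows "blinfun_apply \<mu> (const_bcontfun c) = c"
proof -
  interpret prob_space M using assms by (simp add: represents_def)
  show ?thesis using assms by (simp add: represents_def prob_space)
qed

abbreviation expect :: "('a::compact_metric_space cfun \<Rightarrow>\<^sub>L real) \<Rightarrow> ((nat \<Rightarrow> 'a) \<Rightarrow> real) \<Rightarrow> real" where
  "expect \<mu> f \<equiv> blinfun_apply \<mu> (Bcontfun f)"

lemma positive_functional_blinfun:
  fixes \<mu> :: "'a::compact_metric_space cfun \<Rightarrow>\<^sub>L real"
  assumes pos: "\<And>\<phi>. (\<And>\<sigma>. 0 \<le> apply_bcontfun \<phi> \<sigma>) \<Longrightarrow> 0 \<le> blinfun_apply \<mu> \<phi>"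
    and one: "blinfun_apply \<mu> (const_bcontfun 1) = 1"
  shows "positive_functional (expect \<mu>)"
proof
  fix f g :: "(nat \<Rightarrow> 'a) \<Rightarrow> real" and c
  assume f: "continuous_on UNIV f"
  show "0 \<le> expect \<mu> f" if "\<And>x. 0 \<le> f x"
    using that by (intro pos) (simp add: apply_Bcontfun f)
  have "Bcontfun (\<lambda>x. c * f x) = c *\<^sub>R Bcontfun f"
    using f by (intro bcontfun_eqI) (simp add: apply_Bcontfun continuous_intros)
  then show "expect \<mu> (\<lambda>x. c * f x) = c * expect \<mu> f"
    by (simp add: blinfun.scaleR_right)
  assume g: "continuous_on UNIV g"
  have "Bcontfun (\<lambda>x. f x + g x) = Bcontfun f + Bcontfun g"
    using f g by (intro bcontfun_eqI) (simp add: apply_Bcontfun continuous_intros)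
  then show "expect \<mu> (\<lambda>x. f x + g x) =
      expect \<mu> f + expect \<mu> g"
    by (simp add: blinfun.add_right)
next
  have "Bcontfun (\<lambda>_. 1) = (const_bcontfun 1 :: 'a cfun)"
    by (intro bcontfun_eqI) (simp add: apply_Bcontfun)
  then show "expect \<mu> (\<lambda>_. 1) = 1" using one by simp
qed

text \<open>Riesz representation removes the existential over measures. What remains are conditions
  on single values of the functional, hence weak-star closed ones.\<close>

lemma prob_measures_eq:
  "prob_measures = {\<mu> :: 'a::compact_metric_space cfun \<Rightarrow>\<^sub>L real.
     (\<forall>\<phi>. (\<forall>\<sigma>. 0 \<le> apply_bcontfun \<phi> \<sigma>) \<longrightarrow> 0 \<le> blinfun_apply \<mu> \<phi>) \<and>
     blinfun_apply \<mu> (const_bcontfun 1) = 1}"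
proof safe
  fix \<mu> :: "'a cfun \<Rightarrow>\<^sub>L real"
  assume pos: "\<forall>\<phi>. (\<forall>\<sigma>. 0 \<le> apply_bcontfun \<phi> \<sigma>) \<longrightarrow> 0 \<le> blinfun_apply \<mu> \<phi>"
    and one: "blinfun_apply \<mu> (const_bcontfun 1) = 1"
  interpret positive_functional "expect \<mu>"
    by (rule positive_functional_blinfun; use pos one in blast)
  have "blinfun_apply \<mu> \<phi> = (LINT \<sigma>|riesz. apply_bcontfun \<phi> \<sigma>)" for \<phi>
    using integral_riesz[of "apply_bcontfun \<phi>"] by (simp add: apply_bcontfun_inverse)
  then have "represents riesz \<mu>"
    unfolding represents_def by (intro conjI allI prob_space_riesz sets_riesz)
  then show "\<mu> \<in> prob_measures" by (auto simp: prob_measures_def)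
qed (auto simp: prob_measures_def represents_nonneg represents_const)

lemma positive_functional_prob_measures:
  "\<mu> \<in> prob_measures \<Longrightarrow> positive_functional (expect \<mu>)"
  by (rule positive_functional_blinfun; unfold prob_measures_eq; blast)

lemma prob_measures_nonneg:
  "\<mu> \<in> prob_measures \<Longrightarrow> (\<And>\<sigma>. 0 \<le> apply_bcontfun \<phi> \<sigma>) \<Longrightarrow> 0 \<le> blinfun_apply \<mu> \<phi>"
  by (simp add: prob_measures_eq)

lemma prob_measures_const:
  assumes "\<mu> \<in> prob_measures"
  shows "blinfun_apply \<mu> (const_bcontfun c) = c"
proof -
  have "const_bcontfun c = c *\<^sub>R (const_bcontfun 1 :: 'a cfun)" by (rule bcontfun_eqI) simp
  then show ?thesis using assms by (simp add: prob_measures_eq blinfun.scaleR_right)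
qed

lemma prob_measures_mono:
  assumes "\<mu> \<in> prob_measures" "\<And>\<sigma>. apply_bcontfun \<phi> \<sigma> \<le> apply_bcontfun \<psi> \<sigma>"
  shows "blinfun_apply \<mu> \<phi> \<le> blinfun_apply \<mu> \<psi>"
  using prob_measures_nonneg[OF assms(1), of "\<psi> - \<phi>"] assms(2) by (simp add: blinfun.diff_right)

lemma prob_measures_le_const:
  assumes "\<mu> \<in> prob_measures" "\<And>\<sigma>. apply_bcontfun \<phi> \<sigma> \<le> c"
  shows "blinfun_apply \<mu> \<phi> \<le> c"
  using prob_measures_mono[OF assms(1), of \<phi> "const_bcontfun c"] assms
  by (simp add: prob_measures_const)

lemma prob_measures_abs_le:
  assumes "\<mu> \<in> prob_measures"
  shows "\<bar>blinfun_apply \<mu> \<phi>\<bar> \<le> norm \<phi>"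
  using prob_measures_le_const[OF assms, of \<phi> "norm \<phi>"] norm_bounded[of \<phi>]
    prob_measures_le_const[OF assms, of "- \<phi>" "norm \<phi>"]
  by (auto simp: blinfun.minus_right abs_le_iff)

lemma prob_measures_norm_le: "\<mu> \<in> prob_measures \<Longrightarrow> norm \<mu> \<le> 1"
  using prob_measures_abs_le by (intro norm_blinfun_bound) auto

lemma closedin_prob_measures: "closedin weak_star prob_measures"
proof -
  have *: "prob_measures = (\<Inter>\<phi>\<in>{\<phi>. \<forall>\<sigma>. 0 \<le> apply_bcontfun \<phi> \<sigma>}. {\<mu>. blinfun_apply \<mu> (- \<phi>) \<le> 0}) \<inter>
    {\<mu>. blinfun_apply \<mu> (const_bcontfun 1) \<le> 1} \<inter> {\<mu>. blinfun_apply \<mu> (- const_bcontfun 1) \<le> - 1}"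
    by (auto simp: prob_measures_eq blinfun.minus_right)
  show ?thesis
    unfolding * by (intro closedin_Int closedin_INT closedin_weak_star_le)
      (auto intro!: exI[of _ 0])
qed

lemma compactin_prob_measures: "compactin weak_star prob_measures"
  using prob_measures_norm_le
  by (intro closed_compactin[OF compactin_weak_star_cball[of 1] _ closedin_prob_measures]) auto

lemma continuous_shift: "continuous_on UNIV (shift :: (nat \<Rightarrow> 'a::topological_space) \<Rightarrow> _)"
  unfolding shift_def[abs_def]
  by (intro continuous_on_coordinatewise_then_product continuous_on_product_coordinates)

definition shift_fun :: "'a::compact_metric_space cfun \<Rightarrow> 'a cfun" where
  "shift_fun \<phi> = Bcontfun (\<lambda>\<sigma>. apply_bcontfun \<phi> (shift \<sigma>))"

lemma apply_shift_fun [simp]: "apply_bcontfun (shift_fun \<phi>) \<sigma> = apply_bcontfun \<phi> (shift \<sigma>)"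
  unfolding shift_fun_def
  by (subst apply_Bcontfun) (auto intro: continuous_on_compose2[OF continuous_on_apply_bcontfun continuous_shift])

text \<open>Continuous functions determine a Borel measure, so invariance of the measure can be
  tested on the functional; this form is visibly weak-star closed.\<close>

lemma inv_measures_eq:
  "(inv_measures :: ('a::compact_metric_space cfun \<Rightarrow>\<^sub>L real) set) = {\<mu> \<in> prob_measures. \<forall>\<phi>. blinfun_apply \<mu> (shift_fun \<phi>) = blinfun_apply \<mu> \<phi>}"
proof safe
  have sm: "shift \<in> measurable M borel" if "sets M = sets borel" for M :: "(nat \<Rightarrow> 'a) measure"
    using borel_measurable_continuous_onI[OF continuous_shift] that by (simp cong: measurable_cong_sets)
  have int: "(LINT \<sigma>|distr M borel shift. apply_bcontfun \<phi> \<sigma>) = blinfun_apply \<mu> (shift_fun \<phi>)"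
    if "represents M \<mu>" for M \<mu> and \<phi> :: "'a cfun"
    using that sm[of M]
    by (subst integral_distr) (auto simp: represents_def borel_measurable_continuous_onI)
  {
    fix \<mu> :: "'a cfun \<Rightarrow>\<^sub>L real" and \<phi>
    assume "\<mu> \<in> inv_measures"
    then obtain M where M: "represents M \<mu>" "distr M borel shift = M" by (auto simp: inv_measures_def)
    show "\<mu> \<in> prob_measures" using M by (auto simp: prob_measures_def)
    show "blinfun_apply \<mu> (shift_fun \<phi>) = blinfun_apply \<mu> \<phi>"
      using int[OF M(1), of \<phi>] M by (simp add: represents_def)
  }
  fix \<mu> :: "'a cfun \<Rightarrow>\<^sub>L real"
  assume "\<mu> \<in> prob_measures" and inv: "\<forall>\<phi>. blinfun_apply \<mu> (shift_fun \<phi>) = blinfun_apply \<mu> \<phi>"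
  then obtain M where M: "represents M \<mu>" by (auto simp: prob_measures_def)
  then have M': "prob_space M" "sets M = sets borel" by (auto simp: represents_def)
  have "distr M borel shift = M"
  proof (rule measure_eq_if_continuous_integrals_eq)
    show "finite_measure (distr M borel shift)" "finite_measure M"
      using M' prob_space.prob_space_distr[OF M'(1) sm[OF M'(2)]] by (auto intro: prob_space.axioms(1))
    fix f :: "(nat \<Rightarrow> 'a) \<Rightarrow> real" assume f: "continuous_on UNIV f"
    show "(LINT x|distr M borel shift. f x) = (LINT x|M. f x)"
      using int[OF M, of "Bcontfun f"] inv M f by (simp add: represents_def apply_Bcontfun)
  qed (use M' in auto)
  with M show "\<mu> \<in> inv_measures" by (auto simp: inv_measures_def)
qed

lemma inv_measures_subset: "inv_measures \<subseteq> prob_measures"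
  by (auto simp: inv_measures_eq)

lemma closedin_inv_measures: "closedin weak_star inv_measures"
proof -
  have *: "inv_measures = prob_measures \<inter> (\<Inter>\<phi>. {\<mu>. blinfun_apply \<mu> (shift_fun \<phi>) = blinfun_apply \<mu> \<phi>})"
    by (auto simp: inv_measures_eq)
  show ?thesis
    unfolding * by (intro closedin_Int closedin_INT closedin_prob_measures closedin_weak_star_eq) auto
qed

lemma compactin_inv_measures: "compactin weak_star inv_measures"
  by (rule closed_compactin[OF compactin_prob_measures inv_measures_subset closedin_inv_measures])

section \<open>Metrizability and sequential compactness of the probability measures\<close>

lemma prob_measures_separating_sequence:
  "\<exists>\<psi> :: nat \<Rightarrow> 'a::compact_metric_space cfun.
     inj_on (\<lambda>\<mu> n. blinfun_apply \<mu> (\<psi> n)) prob_measures"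
proof -
  obtain B :: "(nat \<Rightarrow> 'a) set set" where B: "countable B" "Int_stable B" "B \<subseteq> Collect open" "UNIV \<in> B"
    "sets borel = sigma_sets UNIV B"
    using ex_Int_stable_countable_base[where 'b="nat \<Rightarrow> 'a"] by blast
  define e where "e = from_nat_into (B \<times> (UNIV :: nat set))"
  have e: "range e = B \<times> UNIV"
    unfolding e_def using B(1,4) by (intro range_from_nat_into) auto
  define \<psi> :: "nat \<Rightarrow> 'a cfun" where "\<psi> n = Bcontfun (bump (fst (e n)) (snd (e n)))" for n
  have "inj_on (\<lambda>\<mu> n. blinfun_apply \<mu> (\<psi> n)) prob_measures"
  proof (rule inj_onI)
    fix \<mu> \<nu> :: "'a cfun \<Rightarrow>\<^sub>L real"
    assume "\<mu> \<in> prob_measures" "\<nu> \<in> prob_measures"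
      and eq: "(\<lambda>n. blinfun_apply \<mu> (\<psi> n)) = (\<lambda>n. blinfun_apply \<nu> (\<psi> n))"
    then obtain M N where MN: "represents M \<mu>" "represents N \<nu>" by (auto simp: prob_measures_def)
    have "M = N"
    proof (rule measure_eq_if_integrals_eq[OF _ _ _ _ B(2-5)])
      fix U k assume "U \<in> B"
      then obtain n where "e n = (U, k)" using e by (metis (no_types, lifting) UNIV_I image_iff mem_Sigma_iff)
      then show "(LINT x|M. bump U k x) = (LINT x|N. bump U k x)"
        using fun_cong[OF eq, of n] MN
        by (simp add: represents_def \<psi>_def apply_Bcontfun continuous_on_bump)
    qed (use MN in \<open>auto simp: represents_def intro: prob_space.axioms(1)\<close>)
    then show "\<mu> = \<nu>" using MN by (intro blinfun_eqI) (simp add: represents_def)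
  qed
  then show ?thesis by blast
qed

text \<open>Evaluation at a separating sequence is a continuous injection of a compact space into
  the Hausdorff space \<open>nat \<Rightarrow> real\<close>, hence a homeomorphism onto its
  image.\<close>

lemma prob_measures_metrization:
  "\<exists>(E :: (nat \<Rightarrow> real) set) e g.
     homeomorphic_maps (subtopology weak_star (prob_measures :: ('a::compact_metric_space cfun \<Rightarrow>\<^sub>L real) set))
       (top_of_set E) e g \<and> compact E"
proof -
  obtain \<psi> :: "nat \<Rightarrow> 'a cfun" where inj: "inj_on (\<lambda>\<mu> n. blinfun_apply \<mu> (\<psi> n)) prob_measures"
    using prob_measures_separating_sequence by blast
  define e where "e \<mu> n = blinfun_apply \<mu> (\<psi> n)" for \<mu> :: "'a cfun \<Rightarrow>\<^sub>L real" and n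
  let ?X = "subtopology weak_star (prob_measures :: ('a cfun \<Rightarrow>\<^sub>L real) set)"
  have ce: "continuous_map ?X euclidean e"
    unfolding e_def[abs_def] euclidean_product_topology[symmetric]
    by (subst continuous_map_componentwise_UNIV)
      (auto intro: continuous_map_from_subtopology weak_star_apply_continuous)
  have cX: "compact_space ?X" by (rule compact_space_subtopology[OF compactin_prob_measures])
  have "homeomorphic_map ?X (top_of_set (e ` prob_measures)) e"
    using ce cX inj by (intro continuous_imp_homeomorphic_map)
      (auto simp: continuous_map_in_subtopology e_def[abs_def] Hausdorff_space_subtopology)
  moreover have "compact (e ` prob_measures)"
    using image_compactin[of ?X "prob_measures" euclidean e] ce compactin_prob_measures
    by (simp add: compactin_subtopology)
  ultimately show ?thesis unfolding homeomorphic_map_maps by blast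
qed

lemma prob_measures_seq_compact:
  fixes \<mu>s :: "nat \<Rightarrow> 'a::compact_metric_space cfun \<Rightarrow>\<^sub>L real"
  assumes "\<And>n. \<mu>s n \<in> prob_measures"
  obtains \<mu> r where "\<mu> \<in> prob_measures" "strict_mono r"
    "\<And>\<phi>. (\<lambda>n. blinfun_apply (\<mu>s (r n)) \<phi>) \<longlonglongrightarrow> blinfun_apply \<mu> \<phi>"
proof -
  let ?X = "subtopology weak_star (prob_measures :: ('a cfun \<Rightarrow>\<^sub>L real) set)"
  obtain E :: "(nat \<Rightarrow> real) set" and e g where h: "homeomorphic_maps ?X (top_of_set E) e g" and E: "compact E"
    using prob_measures_metrization by blast
  have "e (\<mu>s n) \<in> E" for n
    using h assms[of n] by (auto simp: homeomorphic_maps_def continuous_map_def Pi_iff)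
  then obtain y r where y: "y \<in> E" "strict_mono r" "(\<lambda>n. e (\<mu>s (r n))) \<longlonglongrightarrow> y"
    using E[unfolded compact_def, rule_format, of "\<lambda>n. e (\<mu>s n)"] by (auto simp: o_def)
  have "limitin (top_of_set E) (\<lambda>n. e (\<mu>s (r n))) y sequentially"
    using y \<open>\<And>n. e (\<mu>s n) \<in> E\<close> by (simp add: limitin_subtopology)
  from continuous_map_limit[OF _ this, of ?X g]
  have "limitin ?X (\<lambda>n. g (e (\<mu>s (r n)))) (g y) sequentially"
    using h by (simp add: homeomorphic_maps_def o_def)
  then have "limitin ?X (\<lambda>n. \<mu>s (r n)) (g y) sequentially"
    using h assms by (simp add: homeomorphic_maps_def)
  then show ?thesis
    using that[of "g y" r] y(2) by (simp add: limitin_subtopology limitin_weak_star)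
qed

lemma inv_measures_seq_compact:
  fixes \<mu>s :: "nat \<Rightarrow> 'a::compact_metric_space cfun \<Rightarrow>\<^sub>L real"
  assumes "\<And>n. \<mu>s n \<in> inv_measures"
  obtains \<mu> r where "\<mu> \<in> inv_measures" "strict_mono r"
    "\<And>\<phi>. (\<lambda>n. blinfun_apply (\<mu>s (r n)) \<phi>) \<longlonglongrightarrow> blinfun_apply \<mu> \<phi>"
proof -
  obtain \<mu> r where *: "\<mu> \<in> prob_measures" "strict_mono r"
    "\<And>\<phi>. (\<lambda>n. blinfun_apply (\<mu>s (r n)) \<phi>) \<longlonglongrightarrow> blinfun_apply \<mu> \<phi>"
    using prob_measures_seq_compact assms inv_measures_subset by (metis subsetD)
  have "blinfun_apply \<mu> (shift_fun \<phi>) = blinfun_apply \<mu> \<phi>" for \<phi>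
    using LIMSEQ_unique[OF *(3)[of \<phi>]] *(3)[of "shift_fun \<phi>"] assms by (simp add: inv_measures_eq)
  with *(1) have "\<mu> \<in> inv_measures" by (simp add: inv_measures_eq)
  from that[OF this *(2,3)] show ?thesis .
qed

text \<open>As \<^const>\<open>prob_measures\<close> is metrizable, sequential continuity suffices.\<close>

lemma continuous_map_prob_measures:
  fixes F :: "('a::compact_metric_space cfun \<Rightarrow>\<^sub>L real) \<Rightarrow> 'z::topological_space"
  assumes "\<And>\<mu>s \<mu>. (\<And>n. \<mu>s n \<in> prob_measures) \<Longrightarrow> \<mu> \<in> prob_measures \<Longrightarrow>
      (\<And>\<phi>. (\<lambda>n. blinfun_apply (\<mu>s n) \<phi>) \<longlonglongrightarrow> blinfun_apply \<mu> \<phi>) \<Longrightarrow> (\<lambda>n. F (\<mu>s n)) \<longlonglongrightarrow> F \<mu>"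
  shows "continuous_map (subtopology weak_star prob_measures) euclidean F"
proof -
  let ?X = "subtopology weak_star (prob_measures :: ('a cfun \<Rightarrow>\<^sub>L real) set)"
  obtain E :: "(nat \<Rightarrow> real) set" and e g where h: "homeomorphic_maps ?X (top_of_set E) e g" and E: "compact E"
    using prob_measures_metrization by blast
  have g: "g y \<in> prob_measures" if "y \<in> E" for y
    using h that by (auto simp: homeomorphic_maps_def continuous_map_def Pi_iff)
  have "continuous_on E (F \<circ> g)"
  proof (rule continuous_on_sequentiallyI)
    fix ys y assume y: "\<forall>n. ys n \<in> E" "y \<in> E" "ys \<longlonglongrightarrow> y"
    then have "limitin (top_of_set E) ys y sequentially" by (simp add: limitin_subtopology)
    from continuous_map_limit[OF _ this, of ?X g]
    have "limitin ?X (\<lambda>n. g (ys n)) (g y) sequentially"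
      using h by (simp add: homeomorphic_maps_def o_def)
    then show "(\<lambda>n. (F \<circ> g) (ys n)) \<longlonglongrightarrow> (F \<circ> g) y"
      using assms[of "\<lambda>n. g (ys n)" "g y"] g y by (simp add: limitin_subtopology limitin_weak_star)
  qed
  then have "continuous_map (top_of_set E) euclidean (F \<circ> g)" by simp
  then have "continuous_map ?X euclidean ((F \<circ> g) \<circ> e)"
    using h by (intro continuous_map_compose[of ?X "top_of_set E"]) (auto simp: homeomorphic_maps_def)
  then show ?thesis
    by (rule continuous_map_eq) (use h in \<open>auto simp: homeomorphic_maps_def\<close>)
qed

section \<open>Transfer operators\<close>

lemma continuous_on_cons:
  fixes g :: "(nat \<Rightarrow> 'a::topological_space) \<Rightarrow> 'b::topological_space"
  assumes "continuous_on UNIV g"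
  shows "continuous_on UNIV (\<lambda>\<omega>. g (case_nat \<omega> \<sigma>))"
proof -
  have "continuous_on UNIV (\<lambda>\<omega>. case_nat \<omega> \<sigma> :: nat \<Rightarrow> 'a)"
    using continuous_on_compose2[OF continuous_case_nat, of UNIV "\<lambda>\<omega>. (\<omega>, \<sigma>)"]
    by (simp add: continuous_intros)
  then show ?thesis using continuous_on_compose2[OF assms] by simp
qed

text \<open>\<open>D\<close> stands for a power of \<open>d_eta\<close>, so that Hoelder functions
  become Lipschitz. \<open>D_cons\<close> is the expansion of the shift, read backwards as a
  contraction of its inverse branches; \<open>D_coordinate\<close> makes Lipschitz functions
  separate points.\<close>

locale transfer_operator =
  fixes m :: "'a::compact_metric_space measure"
    and D :: "(nat \<Rightarrow> 'a) \<Rightarrow> (nat \<Rightarrow> 'a) \<Rightarrow> real"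
    and a C :: real
    and A :: "(nat \<Rightarrow> 'a) \<Rightarrow> real"
  assumes m: "prob_space m" "sets m = sets borel"
    and a: "0 < a" "a < 1"
    and C: "0 \<le> C"
    and D_nonneg: "0 \<le> D x y"
    and D_le_one: "D x y \<le> 1"
    and D_sym: "D x y = D y x"
    and D_cons: "D (case_nat \<omega> x) (case_nat \<omega> y) = a * D x y"
    and D_coordinate: "\<exists>B. \<forall>x y. dist (x n) (y n) \<le> B * D x y"
    and A_cont: "continuous_on UNIV A"
    and A_lip: "A x - A y \<le> C * D x y"
begin

definition L :: "((nat \<Rightarrow> 'a) \<Rightarrow> real) \<Rightarrow> (nat \<Rightarrow> 'a) \<Rightarrow> real" where
  "L f \<sigma> = (LINT \<omega>|m. exp (A (case_nat \<omega> \<sigma>)) * f (case_nat \<omega> \<sigma>))"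

text \<open>Nonnegative functions whose logarithm is \<open>K\<close>-Lipschitz for
  \<open>D\<close>, written multiplicatively so that the zero function is included.\<close>

definition cone :: "real \<Rightarrow> ((nat \<Rightarrow> 'a) \<Rightarrow> real) set" where
  "cone K = {f. continuous_on UNIV f \<and> (\<forall>x. 0 \<le> f x) \<and> (\<forall>x y. f x \<le> exp (K * D x y) * f y)}"

lemma finite_m: "finite_measure m"
  using m(1) by (rule prob_space.axioms(1))

lemma integrable_cons:
  fixes g :: "(nat \<Rightarrow> 'a) \<Rightarrow> real"
  shows "continuous_on UNIV g \<Longrightarrow> integrable m (\<lambda>\<omega>. g (case_nat \<omega> \<sigma>))"
  by (intro continuous_integrable continuous_on_cons finite_m m)

lemma integrable_L:
  "continuous_on UNIV f \<Longrightarrow> integrable m (\<lambda>\<omega>. exp (A (case_nat \<omega> \<sigma>)) * f (case_nat \<omega> \<sigma>))"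
  by (rule integrable_cons[of "\<lambda>\<sigma>. exp (A \<sigma>) * f \<sigma>"]) (intro continuous_intros A_cont)

lemma L_eq_transfer_op:
  assumes "continuous_on UNIV f"
  shows "L f = transfer_op m (Bcontfun (\<lambda>\<sigma>. exp (A \<sigma>) * f \<sigma>))"
  using assms A_cont
  by (intro ext) (simp add: L_def transfer_op_def apply_Bcontfun continuous_intros)

lemma L_continuous: "continuous_on UNIV f \<Longrightarrow> continuous_on UNIV (L f)"
  by (simp add: L_eq_transfer_op continuous_transfer_op m)

lemma L_pow_continuous: "continuous_on UNIV f \<Longrightarrow> continuous_on UNIV ((L ^^ n) f)"
  by (induction n) (auto intro: L_continuous)

lemma L_combination:
  assumes "continuous_on UNIV f" "continuous_on UNIV g"
  shows "L (\<lambda>x. c * f x + d * g x) = (\<lambda>x. c * L f x + d * L g x)"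
proof
  fix \<sigma>
  show "L (\<lambda>x. c * f x + d * g x) \<sigma> = c * L f \<sigma> + d * L g \<sigma>"
    using integrable_L[OF assms(1), of \<sigma>] integrable_L[OF assms(2), of \<sigma>]
    unfolding L_def by (subst Bochner_Integration.integral_mult_right_zero[symmetric])+
      (subst Bochner_Integration.integral_add[symmetric]; simp add: algebra_simps)
qed

lemma L_scale: "continuous_on UNIV f \<Longrightarrow> L (\<lambda>x. c * f x) = (\<lambda>x. c * L f x)"
  using L_combination[of f f c 0] by simp

lemma L_diff:
  "continuous_on UNIV f \<Longrightarrow> continuous_on UNIV g \<Longrightarrow> L (\<lambda>x. f x - c * g x) = (\<lambda>x. L f x - c * L g x)"
  using L_combination[of f g 1 "- c"] by simp

lemma L_mono:
  assumes "continuous_on UNIV f" "continuous_on UNIV g" "\<And>x. f x \<le> g x"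
  shows "L f \<sigma> \<le> L g \<sigma>"
  unfolding L_def using assms by (intro integral_mono integrable_L) auto

lemma L_pow_combination:
  assumes "continuous_on UNIV f" "continuous_on UNIV g"
  shows "(L ^^ n) (\<lambda>x. c * f x + d * g x) = (\<lambda>x. c * (L ^^ n) f x + d * (L ^^ n) g x)"
  by (induction n) (use assms in \<open>simp_all add: L_combination L_pow_continuous\<close>)

lemma L_pow_mono:
  assumes "continuous_on UNIV f" "continuous_on UNIV g" "\<And>x. f x \<le> g x"
  shows "(L ^^ n) f \<sigma> \<le> (L ^^ n) g \<sigma>"
  using assms(3) by (induction n arbitrary: \<sigma>) (use assms in \<open>auto intro!: L_mono L_pow_continuous\<close>)

lemma L_pos:
  assumes "continuous_on UNIV f" "\<And>x. 0 < f x"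
  shows "0 < L f \<sigma>"
  unfolding L_eq_transfer_op[OF assms(1)]
  using assms A_cont by (intro transfer_op_pos m) (simp add: apply_Bcontfun continuous_intros)

section \<open>Cones of log-Lipschitz functions\<close>

lemma coneD:
  assumes "f \<in> cone K"
  shows "continuous_on UNIV f" "0 \<le> f x" "f x \<le> exp (K * D x y) * f y"
  using assms by (auto simp: cone_def)

lemma cone_bound:
  assumes "f \<in> cone K" "0 \<le> K"
  shows "f x \<le> exp K * f y"
proof -
  have "exp (K * D x y) \<le> exp K" using assms(2) D_le_one[of x y] by (simp add: mult_left_le)
  then have "exp (K * D x y) * f y \<le> exp K * f y" using coneD(2)[OF assms(1)] by (rule mult_right_mono)
  with coneD(3)[OF assms(1), of x y] show ?thesis by simp
qed

lemma cone_mono: "K' \<le> K \<Longrightarrow> cone K' \<subseteq> cone K"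
proof (safe)
  fix f assume "K' \<le> K" and f: "f \<in> cone K'"
  then have "exp (K' * D x y) * f y \<le> exp (K * D x y) * f y" for x y
    using coneD(2)[OF f] D_nonneg by (intro mult_right_mono) (auto intro: mult_right_mono)
  with coneD(3)[OF f] have "f x \<le> exp (K * D x y) * f y" for x y by (rule order_trans)
  then show "f \<in> cone K" using f unfolding cone_def by auto
qed

lemma cone_one: "0 \<le> K \<Longrightarrow> (\<lambda>_. 1) \<in> cone K"
  by (auto simp: cone_def D_nonneg)

lemma cone_mult:
  assumes "f \<in> cone K" "g \<in> cone K'"
  shows "(\<lambda>x. f x * g x) \<in> cone (K + K')"
proof -
  have "f x * g x \<le> exp ((K + K') * D x y) * (f y * g y)" for x y
    using mult_mono[OF coneD(3)[OF assms(1), of x y] coneD(3)[OF assms(2), of x y]]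
      coneD(2)[OF assms(1)] coneD(2)[OF assms(2)]
    by (simp add: distrib_right exp_add mult.assoc mult.left_commute)
  then show ?thesis
    using coneD(1,2)[OF assms(1)] coneD(1,2)[OF assms(2)] by (auto simp: cone_def intro: continuous_on_mult)
qed

lemma cone_scale: "f \<in> cone K \<Longrightarrow> 0 \<le> c \<Longrightarrow> (\<lambda>x. c * f x) \<in> cone K"
  by (auto simp: cone_def mult_left_mono mult.left_commute intro: continuous_on_mult_left)

text \<open>A common first letter shrinks \<open>D\<close> by the factor \<open>a\<close>, in the
  weight \<open>exp A\<close> and in the argument of \<open>f\<close> alike. For large
  \<open>K\<close> the new constant is therefore smaller than \<open>K\<close>.\<close>

lemma L_cone:
  assumes f: "f \<in> cone K"
  shows "L f \<in> cone (a * (C + K))"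
proof -
  note cf = coneD(1)[OF f]
  have le: "exp (A (case_nat \<omega> x)) * f (case_nat \<omega> x)
      \<le> exp (a * (C + K) * D x y) * (exp (A (case_nat \<omega> y)) * f (case_nat \<omega> y))" for \<omega> x y
  proof -
    have "exp (A (case_nat \<omega> x)) \<le> exp (C * (a * D x y)) * exp (A (case_nat \<omega> y))"
      using A_lip[of "case_nat \<omega> x" "case_nat \<omega> y"] by (simp add: D_cons exp_add[symmetric])
    moreover have "f (case_nat \<omega> x) \<le> exp (K * (a * D x y)) * f (case_nat \<omega> y)"
      using coneD(3)[OF f, of "case_nat \<omega> x" "case_nat \<omega> y"] by (simp add: D_cons)
    ultimately have "exp (A (case_nat \<omega> x)) * f (case_nat \<omega> x)
        \<le> (exp (C * (a * D x y)) * exp (A (case_nat \<omega> y))) * (exp (K * (a * D x y)) * f (case_nat \<omega> y))"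
      using coneD(2)[OF f] by (intro mult_mono) auto
    also have "\<dots> = exp (a * (C + K) * D x y) * (exp (A (case_nat \<omega> y)) * f (case_nat \<omega> y))"
      by (simp add: algebra_simps exp_add)
    finally show ?thesis .
  qed
  have "L f x \<le> exp (a * (C + K) * D x y) * L f y" for x y
    unfolding L_def using le[of _ x y] integrable_L[OF cf]
    by (subst Bochner_Integration.integral_mult_right_zero[symmetric])
      (intro integral_mono Bochner_Integration.integrable_mult_right)
  moreover have "0 \<le> L f x" for x
    unfolding L_def using coneD(2)[OF f] by (intro integral_nonneg_AE) auto
  ultimately show ?thesis using L_continuous[OF cf] by (auto simp: cone_def)
qed

text \<open>The margin between the cones \<open>cone K'\<close> and \<open>cone K\<close> leaves room to subtract a multiple of \<open>G\<close>.\<close>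

lemma cone_subtract:
  assumes F: "F \<in> cone K'" and G: "G \<in> cone K'" and K: "0 \<le> K'" "K' < K"
    and \<rho>: "0 \<le> \<rho>" "\<And>y. \<rho> * G y \<le> F y"
    and \<beta>: "\<beta> = (K - K') / (exp K - 1 + K')"
  shows "(\<lambda>x. F x - \<beta> * \<rho> * G x) \<in> cone K"
proof -
  have den: "K \<le> exp K - 1 + K'" "0 < exp K - 1 + K'"
    using exp_ge_add_one_self[of K] K by linarith+
  have \<beta>01: "0 \<le> \<beta>" "\<beta> \<le> 1"
    unfolding \<beta> using K den by (auto simp: divide_le_eq)
  \<comment> \<open>The inequality in one variable, with \<open>t\<close> for \<open>D x y\<close>,
    that fixes \<beta>: a chord bound for \<open>exp (K * t)\<close> and a tangent bound for
    \<open>exp (- (K' * t))\<close> estimate the left side by \<open>(K - K') * t\<close>, and a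
    tangent bound gives the same number below the right side.\<close>
  have key: "\<beta> * (exp (K * t) - exp (- (K' * t))) \<le> exp (K * t) - exp (K' * t)"
    if t: "0 \<le> t" "t \<le> 1" for t
  proof -
    have "exp ((1 - t) * 0 + t * K) \<le> (1 - t) * exp 0 + t * exp K"
      using convex_onD[OF exp_convex, of t 0 K] t by simp
    then have "exp (K * t) \<le> 1 + t * (exp K - 1)" by (simp add: algebra_simps)
    moreover have "1 - K' * t \<le> exp (- (K' * t))" using exp_ge_add_one_self[of "- (K' * t)"] by simp
    ultimately have "exp (K * t) - exp (- (K' * t)) \<le> t * (exp K - 1 + K')" by (simp add: algebra_simps)
    then have "\<beta> * (exp (K * t) - exp (- (K' * t))) \<le> \<beta> * (t * (exp K - 1 + K'))"
      using \<beta>01 by (intro mult_left_mono)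
    also have "\<dots> = (K - K') * t" using den by (simp add: \<beta>)
    also have "\<dots> \<le> exp ((K - K') * t) - 1" using exp_ge_add_one_self[of "(K - K') * t"] by linarith
    also have "\<dots> \<le> exp (K' * t) * (exp ((K - K') * t) - 1)"
    proof -
      have "1 \<le> exp (K' * t)" "0 \<le> exp ((K - K') * t) - 1" using K t by auto
      from mult_right_mono[OF this] show ?thesis by simp
    qed
    also have "\<dots> = exp (K * t) - exp (K' * t)" by (simp add: algebra_simps exp_add[symmetric])
    finally show ?thesis .
  qed
  have "F x - \<beta> * \<rho> * G x \<le> exp (K * D x y) * (F y - \<beta> * \<rho> * G y)" for x y
  proof -
    let ?t = "D x y"
    note t = D_nonneg[of x y] D_le_one[of x y]
    have "G y \<le> exp (K' * ?t) * G x" using coneD(3)[OF G, of y x] by (simp add: D_sym[of y x])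
    then have "exp (- (K' * ?t)) * G y \<le> exp (- (K' * ?t)) * (exp (K' * ?t) * G x)"
      by (intro mult_left_mono) auto
    also have "\<dots> = G x" by (simp add: mult.assoc[symmetric] exp_add[symmetric])
    finally have 1: "exp (- (K' * ?t)) * G y \<le> G x" .
    have 2: "F x \<le> exp (K' * ?t) * F y" by (rule coneD(3)[OF F])
    have "\<beta> * \<rho> * G y * (exp (K * ?t) - exp (- (K' * ?t)))
        = \<rho> * G y * (\<beta> * (exp (K * ?t) - exp (- (K' * ?t))))" by simp
    also have "\<dots> \<le> \<rho> * G y * (exp (K * ?t) - exp (K' * ?t))"
      using \<rho>(1) coneD(2)[OF G] by (intro mult_left_mono key t) auto
    also have "\<dots> \<le> F y * (exp (K * ?t) - exp (K' * ?t))"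
      using \<rho>(2)[of y] K t by (intro mult_right_mono) (auto intro: mult_right_mono)
    finally have 3: "\<beta> * \<rho> * G y * (exp (K * ?t) - exp (- (K' * ?t))) \<le> F y * (exp (K * ?t) - exp (K' * ?t))" .
    have "\<beta> * \<rho> * (exp (- (K' * ?t)) * G y) \<le> \<beta> * \<rho> * G x"
      using 1 \<beta>01 \<rho> by (intro mult_left_mono) auto
    with 2 3 show ?thesis by (simp add: algebra_simps)
  qed
  moreover have "\<beta> * \<rho> * G x \<le> F x" for x
  proof -
    have "\<beta> * (\<rho> * G x) \<le> 1 * (\<rho> * G x)"
      using \<beta>01 \<rho> coneD(2)[OF G] by (intro mult_right_mono) auto
    with \<rho>(2)[of x] show ?thesis by (simp add: mult.assoc)
  qed
  ultimately show ?thesis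
    using coneD(1)[OF F] coneD(1)[OF G] by (auto simp: cone_def intro!: continuous_intros)
qed

text \<open>With this opening \<open>K\<close> the operator maps \<open>cone K\<close> into \<open>cone (K - 1)\<close>.\<close>

definition K :: real where "K = (a * C + 1) / (1 - a)"

lemma K_eq: "a * (C + K) = K - 1"
  using a by (simp add: K_def field_simps)

lemma K_ge_one: "1 \<le> K"
  using a C by (simp add: K_def field_simps)

definition \<beta> :: real where "\<beta> = 1 / (exp K - 1 + (K - 1))"

lemma \<beta>_bounds: "0 < \<beta>" "\<beta> \<le> 1"
proof -
  have "1 \<le> exp K - 1 + (K - 1)" using exp_ge_add_one_self[of K] K_ge_one by linarith
  then show "0 < \<beta>" "\<beta> \<le> 1" by (auto simp: \<beta>_def)
qed

lemma cone_subtract_K: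
  "F \<in> cone (K - 1) \<Longrightarrow> G \<in> cone (K - 1) \<Longrightarrow> 0 \<le> \<rho> \<Longrightarrow> (\<And>y. \<rho> * G y \<le> F y) \<Longrightarrow>
    (\<lambda>x. F x - \<beta> * \<rho> * G x) \<in> cone K"
  using K_ge_one by (intro cone_subtract[where K' = "K - 1"]) (auto simp: \<beta>_def)

lemma L_cone_K: "f \<in> cone K \<Longrightarrow> L f \<in> cone (K - 1)"
  using L_cone[of f K] by (simp add: K_eq)

lemma L_cone_K': "f \<in> cone K \<Longrightarrow> L f \<in> cone K"
  using L_cone_K cone_mono[of "K - 1" K] by auto

text \<open>The oscillation bound \<open>exp (K - 1)\<close> is spent twice, once on
  \<open>L g\<close> and once on the larger of two differences, which gives
  \<open>exp (- (2 * (K - 1)))\<close>. The half comes from selecting the larger difference at one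
  point, and \<beta> from \<open>cone_subtract_K\<close>.\<close>

definition q :: real where "q = 1 - \<beta> * exp (- (2 * (K - 1))) / 2"

lemma q_bounds: "0 < q" "q < 1"
proof -
  have "exp (- (2 * (K - 1))) \<le> 1" using K_ge_one by simp
  then have "\<beta> * exp (- (2 * (K - 1))) \<le> 1 * 1" using \<beta>_bounds by (intro mult_mono) auto
  then show "0 < q" "q < 1" using \<beta>_bounds by (auto simp: q_def)
qed

section \<open>Contraction on the cone\<close>

text \<open>An elementary substitute for the contraction of the projective metric. The differences
  \<open>F1\<close> and \<open>F2\<close> add up to \<open>(hi - lo) * L g\<close>, so at a given
  point one of them is at least half of this. Bounded oscillation in the cone carries this to all
  points with a loss, and \<open>cone_subtract_K\<close> then moves the corresponding endpoint
  inwards by \<open>\<beta> * \<rho>\<close>.\<close>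

lemma contraction_step:
  assumes g: "g \<in> cone K" and f: "continuous_on UNIV f"
    and lo: "(\<lambda>x. f x - lo * g x) \<in> cone K" and hi: "(\<lambda>x. hi * g x - f x) \<in> cone K"
    and le: "lo \<le> hi"
  shows "\<exists>lo' hi'. lo \<le> lo' \<and> lo' \<le> hi' \<and> hi' \<le> hi \<and> hi' - lo' = q * (hi - lo) \<and>
    (\<lambda>x. L f x - lo' * L g x) \<in> cone K \<and> (\<lambda>x. hi' * L g x - L f x) \<in> cone K"
proof -
  note cg = coneD(1)[OF g]
  define \<rho> where "\<rho> = exp (- (2 * (K - 1))) * ((hi - lo) / 2)"
  have \<rho>0: "0 \<le> \<rho>" using le by (simp add: \<rho>_def)
  have diff: "(hi - lo) - \<beta> * \<rho> = q * (hi - lo)" by (simp add: \<rho>_def q_def algebra_simps)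
  have q0: "0 \<le> q * (hi - lo)" using q_bounds le by simp
  define F1 where "F1 x = L f x - lo * L g x" for x
  define F2 where "F2 x = hi * L g x - L f x" for x
  have F1: "F1 \<in> cone (K - 1)"
    using L_cone_K[OF lo] by (simp add: F1_def[abs_def] L_diff f cg)
  have F2: "F2 \<in> cone (K - 1)"
    using L_cone_K[OF hi] L_combination[OF cg f, of hi "- 1"] by (simp add: F2_def[abs_def])
  have G: "L g \<in> cone (K - 1)" by (rule L_cone_K[OF g])
  have spread: "\<rho> * L g y \<le> F y"
    if F: "F \<in> cone (K - 1)" and x0: "(hi - lo) / 2 * L g x0 \<le> F x0" for F x0 y
  proof -
    have e2: "exp (- (2 * (K - 1))) = exp (- (K - 1)) * exp (- (K - 1))"
      by (simp add: exp_add[symmetric])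
    have g1: "exp (- (K - 1)) * L g y \<le> L g x0"
      using cone_bound[OF G, of y x0] K_ge_one by (simp add: exp_minus divide_simps mult.commute del: minus_diff_eq)
    have "\<rho> * L g y = exp (- (K - 1)) * ((hi - lo) / 2 * (exp (- (K - 1)) * L g y))"
      unfolding \<rho>_def e2 by (simp only: mult.assoc mult.left_commute)
    also have "\<dots> \<le> exp (- (K - 1)) * ((hi - lo) / 2 * L g x0)"
      using g1 le by (intro mult_left_mono) auto
    also have "\<dots> \<le> exp (- (K - 1)) * F x0" using x0 by (intro mult_left_mono) auto
    also have "\<dots> \<le> F y"
      using cone_bound[OF F, of x0 y] K_ge_one by (simp add: exp_minus divide_simps mult.commute del: minus_diff_eq)
    finally show ?thesis .
  qed
  \<comment> \<open>\<open>undefined\<close> is merely some point of the sequence space.\<close>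
  have "F1 undefined + F2 undefined = 2 * ((hi - lo) / 2 * L g undefined)"
    by (simp add: F1_def F2_def left_diff_distrib)
  then have "(hi - lo) / 2 * L g undefined \<le> F1 undefined \<or> (hi - lo) / 2 * L g undefined \<le> F2 undefined"
    by linarith
  then consider "\<And>y. \<rho> * L g y \<le> F1 y" | "\<And>y. \<rho> * L g y \<le> F2 y"
    using spread[OF F1] spread[OF F2] by blast
  then show ?thesis
  proof cases
    case 1
    from cone_subtract_K[OF F1 G \<rho>0 1]
    have "(\<lambda>x. L f x - (lo + \<beta> * \<rho>) * L g x) \<in> cone K" by (simp add: F1_def algebra_simps)
    moreover have "(\<lambda>x. hi * L g x - L f x) \<in> cone K"
      using F2 cone_mono[of "K - 1" K] by (auto simp: F2_def[abs_def])
    ultimately show ?thesis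
      using diff \<rho>0 \<beta>_bounds q0 by (intro exI[of _ "lo + \<beta> * \<rho>"] exI[of _ hi]) auto
  next
    case 2
    from cone_subtract_K[OF F2 G \<rho>0 2]
    have "(\<lambda>x. (hi - \<beta> * \<rho>) * L g x - L f x) \<in> cone K" by (simp add: F2_def algebra_simps)
    moreover have "(\<lambda>x. L f x - lo * L g x) \<in> cone K"
      using F1 cone_mono[of "K - 1" K] by (auto simp: F1_def[abs_def])
    ultimately show ?thesis
      using diff \<rho>0 \<beta>_bounds q0 by (intro exI[of _ lo] exI[of _ "hi - \<beta> * \<rho>"]) auto
  qed
qed

lemma L_pow_cone: "f \<in> cone K \<Longrightarrow> (L ^^ n) f \<in> cone K"
  by (induction n) (auto intro: L_cone_K')

text \<open>Iterating the step produces nested intervals of length \<open>(hi - lo) * q ^ n\<close>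
  with common point \<open>c\<close>. Nonnegativity of the cone elements traps
  \<open>(L ^^ n) f\<close> between the endpoints times \<open>(L ^^ n) g\<close>.\<close>

theorem contraction:
  assumes g: "g \<in> cone K" and f: "continuous_on UNIV f"
    and lo: "(\<lambda>x. f x - lo * g x) \<in> cone K" and hi: "(\<lambda>x. hi * g x - f x) \<in> cone K"
    and le: "lo \<le> hi"
  obtains c where "lo \<le> c" "c \<le> hi"
    "\<And>n x. \<bar>(L ^^ n) f x - c * (L ^^ n) g x\<bar> \<le> (hi - lo) * q ^ n * (L ^^ n) g x"
proof -
  \<comment> \<open>The clause for \<open>n = 0\<close> pins the start of the sequence to
    \<open>(lo, hi)\<close>, which dependent choice alone would not do.\<close>
  define P where "P n p \<longleftrightarrow> (n = 0 \<longrightarrow> p = (lo, hi)) \<and> fst p \<le> snd p \<and>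
    (\<lambda>x. (L ^^ n) f x - fst p * (L ^^ n) g x) \<in> cone K \<and>
    (\<lambda>x. snd p * (L ^^ n) g x - (L ^^ n) f x) \<in> cone K" for n :: nat and p :: "real \<times> real"
  have "\<exists>s. \<forall>n. P n (s n) \<and> (fst (s n) \<le> fst (s (Suc n)) \<and> snd (s (Suc n)) \<le> snd (s n) \<and>
     snd (s (Suc n)) - fst (s (Suc n)) = q * (snd (s n) - fst (s n)))"
  proof (rule dependent_nat_choice)
    show "\<exists>p. P 0 p"
      using assms by (intro exI[of _ "(lo, hi)"]) (simp add: P_def)
    fix p and n :: nat
    assume "P n p"
    then have p: "(\<lambda>x. (L ^^ n) f x - fst p * (L ^^ n) g x) \<in> cone K"
      "(\<lambda>x. snd p * (L ^^ n) g x - (L ^^ n) f x) \<in> cone K" "fst p \<le> snd p"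
      by (simp_all only: P_def)
    obtain lo' hi' where "fst p \<le> lo'" "lo' \<le> hi'" "hi' \<le> snd p" "hi' - lo' = q * (snd p - fst p)"
      "(\<lambda>x. L ((L ^^ n) f) x - lo' * L ((L ^^ n) g) x) \<in> cone K"
      "(\<lambda>x. hi' * L ((L ^^ n) g) x - L ((L ^^ n) f) x) \<in> cone K"
      using contraction_step[OF L_pow_cone[OF g] L_pow_continuous[OF f] p] by blast
    then show "\<exists>p'. P (Suc n) p' \<and> fst p \<le> fst p' \<and> snd p' \<le> snd p \<and>
        snd p' - fst p' = q * (snd p - fst p)"
      by (intro exI[of _ "(lo', hi')"]) (simp add: P_def)
  qed
  then obtain s where s: "\<And>n. P n (s n)" "\<And>n. fst (s n) \<le> fst (s (Suc n))"
    "\<And>n. snd (s (Suc n)) \<le> snd (s n)" "\<And>n. snd (s (Suc n)) - fst (s (Suc n)) = q * (snd (s n) - fst (s n))"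
    by metis
  have s0: "s 0 = (lo, hi)" using s(1)[of 0] by (simp add: P_def)
  have inc: "incseq (\<lambda>n. fst (s n))" and dec: "decseq (\<lambda>n. snd (s n))"
    using s(2,3) by (auto intro: incseq_SucI decseq_SucI)
  have gap: "snd (s n) - fst (s n) = (hi - lo) * q ^ n" for n
    by (induction n) (simp_all add: s0 s(4))
  have cross: "fst (s k) \<le> snd (s n)" for k n
  proof -
    have "fst (s k) \<le> fst (s (max k n))" using inc by (auto simp: incseq_def)
    also have "\<dots> \<le> snd (s (max k n))" using s(1) by (auto simp: P_def)
    also have "\<dots> \<le> snd (s n)" using dec by (auto simp: decseq_def)
    finally show ?thesis .
  qed
  have "\<forall>n. fst (s n) \<le> hi" using cross[of _ 0] s0 by simp
  from incseq_convergent[OF inc this]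
  obtain c where c': "(\<lambda>n. fst (s n)) \<longlonglongrightarrow> c" "\<forall>n. fst (s n) \<le> c" by blast
  note c = c'(2)[rule_format]
  have c2: "c \<le> snd (s n)" for n
    by (rule LIMSEQ_le_const2[OF c'(1)]) (use cross in blast)
  show ?thesis
  proof (rule that)
    show "lo \<le> c" "c \<le> hi" using c[of 0] c2[of 0] s0 by auto
    fix n x
    let ?G = "(L ^^ n) g x" and ?F = "(L ^^ n) f x"
    have G0: "0 \<le> ?G" by (rule coneD(2)[OF L_pow_cone[OF g]])
    have "(\<lambda>x. (L ^^ n) f x - fst (s n) * (L ^^ n) g x) \<in> cone K"
      "(\<lambda>x. snd (s n) * (L ^^ n) g x - (L ^^ n) f x) \<in> cone K"
      using s(1)[of n] by (simp_all only: P_def)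
    from coneD(2)[OF this(1), of x] coneD(2)[OF this(2), of x]
    have "0 \<le> ?F - fst (s n) * ?G" "0 \<le> snd (s n) * ?G - ?F" .
    moreover have "fst (s n) * ?G \<le> c * ?G" "c * ?G \<le> snd (s n) * ?G"
      using c(1) c2 G0 by (auto intro: mult_right_mono)
    ultimately have "\<bar>?F - c * ?G\<bar> \<le> (snd (s n) - fst (s n)) * ?G"
      by (simp add: abs_le_iff algebra_simps)
    then show "\<bar>?F - c * ?G\<bar> \<le> (hi - lo) * q ^ n * ?G" by (simp add: gap)
  qed
qed

end

section \<open>A positive eigenfunction\<close>

context transfer_operator begin

lemma L_pow_one_pos: "0 < (L ^^ n) (\<lambda>_. 1) x"
proof (induction n arbitrary: x)
  case (Suc n)
  then show ?case using L_pos[OF L_pow_continuous[of "\<lambda>_. 1" n]] by simp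
qed simp

lemma L_dominated:
  assumes lim: "\<And>x. (\<lambda>n. f n x) \<longlonglongrightarrow> g x" and f: "\<And>n. continuous_on UNIV (f n)" "\<And>n x. \<bar>f n x\<bar> \<le> B"
    and g: "continuous_on UNIV g"
  shows "(\<lambda>n. L (f n) x) \<longlonglongrightarrow> L g x"
  unfolding L_def
proof (rule integral_dominated_convergence)
  show "integrable m (\<lambda>\<omega>. exp (A (case_nat \<omega> x)) * B)"
    by (rule integrable_L[of "\<lambda>_. B"]) simp
qed (use integrable_L f g in \<open>auto intro!: tendsto_intros lim simp: abs_mult\<close>)

text \<open>The normalized iterates \<open>v n = L\<^sup>n 1 / (L\<^sup>n 1) x0\<close> converge uniformly to an eigenfunction.\<close>

theorem eigenfunction:
  obtains lam u where "0 < lam" "u \<in> cone K" "\<And>x. 0 < u x" "L u = (\<lambda>x. lam * u x)"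
proof -
  define f where "f = L (\<lambda>_. 1)"
  have one: "(\<lambda>_. 1) \<in> cone (K - 1)" "(\<lambda>_. 1) \<in> cone K"
    using K_ge_one by (auto intro: cone_one)
  have fc: "f \<in> cone (K - 1)" unfolding f_def by (rule L_cone_K[OF one(2)])
  have cf: "continuous_on UNIV f" by (rule coneD(1)[OF fc])
  have fpos: "0 < f x" for x unfolding f_def by (rule L_pos) auto
  obtain x1 where x1: "\<And>y. f x1 \<le> f y"
    using continuous_attains_inf[OF compact_UNIV _ cf] by auto
  obtain x2 where x2: "\<And>y. f y \<le> f x2"
    using continuous_attains_sup[OF compact_UNIV _ cf] by auto
  \<comment> \<open>Both \<open>f\<close> and the constant 1 lie in \<open>cone (K - 1)\<close>, so
    \<open>cone_subtract_K\<close> places \<open>f - \<beta> * min f\<close> and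
    \<open>1 - \<beta> * f / max f\<close> in \<open>cone K\<close>; the second is multiplied by
    \<open>hi\<close>.\<close>
  define lo hi where "lo = \<beta> * f x1" and "hi = f x2 / \<beta>"
  have lo0: "0 < lo" using \<beta>_bounds fpos by (simp add: lo_def)
  have lo_f: "lo \<le> f x" for x
    using x1[of x] \<beta>_bounds fpos[of x1] mult_right_mono[of \<beta> 1 "f x1"] unfolding lo_def by linarith
  have f_hi: "f x \<le> hi" for x
  proof -
    have "f x2 * 1 \<le> f x2 * (1 / \<beta>)"
      using \<beta>_bounds fpos[of x2] by (intro mult_left_mono) auto
    with x2[of x] show ?thesis by (simp add: hi_def)
  qed
  have lohi: "lo \<le> hi" using lo_f f_hi order_trans by blast
  have lo_cone: "(\<lambda>x. f x - lo * 1) \<in> cone K"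
    using cone_subtract_K[OF fc one(1), of "f x1"] fpos[of x1] x1 by (simp add: lo_def)
  have hi_cone: "(\<lambda>x. hi * 1 - f x) \<in> cone K"
  proof -
    have "(\<lambda>x. 1 - \<beta> * (1 / f x2) * f x) \<in> cone K"
      using fpos x2 by (intro cone_subtract_K one fc) (auto simp: divide_le_eq less_imp_le)
    from cone_scale[OF this, of hi] have "(\<lambda>x. hi * (1 - \<beta> * (1 / f x2) * f x)) \<in> cone K"
      using lo0 lohi by simp
    moreover have "hi * (1 - \<beta> * (1 / f x2) * f x) = hi * 1 - f x" for x
      using \<beta>_bounds fpos[of x2] by (simp add: hi_def field_simps)
    ultimately show ?thesis by simp
  qed
  \<comment> \<open>The iterates of \<open>f\<close> are those of 1 with the index shifted by one.
    Hence the quotients \<open>r n\<close> of consecutive iterates tend uniformly and geometrically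
    to \<open>c\<close>, the future eigenvalue.\<close>
  obtain c where c: "lo \<le> c" "c \<le> hi"
    "\<And>n x. \<bar>(L ^^ n) f x - c * (L ^^ n) (\<lambda>_. 1) x\<bar> \<le> (hi - lo) * q ^ n * (L ^^ n) (\<lambda>_. 1) x"
    using contraction[OF one(2) cf lo_cone hi_cone lohi] by blast
  define w where "w n = (L ^^ n) (\<lambda>_. 1)" for n
  have wf: "(L ^^ n) f = w (Suc n)" for n
    by (simp add: f_def w_def funpow_swap1)
  have wpos: "0 < w n x" for n x unfolding w_def by (rule L_pow_one_pos)
  have wcone: "w n \<in> cone K" for n unfolding w_def by (rule L_pow_cone[OF one(2)])
  define r where "r n x = w (Suc n) x / w n x" for n x
  have w_Suc: "w (Suc n) x = r n x * w n x" for n x using wpos[of n x] by (simp add: r_def)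
  have r_c: "\<bar>r n x - c\<bar> \<le> (hi - lo) * q ^ n" for n x
  proof -
    have "\<bar>r n x - c\<bar> * w n x = \<bar>(L ^^ n) f x - c * (L ^^ n) (\<lambda>_. 1) x\<bar>"
      using wpos[of n x] by (simp add: wf w_Suc w_def[symmetric] abs_mult_pos left_diff_distrib)
    also have "\<dots> \<le> (hi - lo) * q ^ n * w n x" unfolding w_def by (rule c(3))
    finally show ?thesis using wpos[of n x] by (rule mult_right_le_imp_le)
  qed
  have r_lo: "lo \<le> r n x" for n x
  proof -
    have "(L ^^ n) (\<lambda>_. lo * 1 + 0 * 1) x \<le> (L ^^ n) f x"
      using lo_f by (intro L_pow_mono cf) auto
    moreover have "(L ^^ n) (\<lambda>_. lo * 1 + 0 * 1) x = lo * w n x"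
      by (subst L_pow_combination) (auto simp: w_def)
    ultimately have "lo * w n x \<le> r n x * w n x" by (simp add: wf w_Suc)
    then show ?thesis using wpos[of n x] by (rule mult_right_le_imp_le)
  qed
  define x0 :: "nat \<Rightarrow> 'a" where "x0 = undefined"
  define v where "v n x = w n x / w n x0" for n x
  have vcone: "v n \<in> cone K" for n
    using cone_scale[OF wcone[of n], of "1 / w n x0"] wpos[of n x0] by (simp add: v_def[abs_def])
  have v_x0: "v n x0 = 1" for n using wpos[of n x0] by (simp add: v_def)
  have K0: "0 \<le> K" using K_ge_one by simp
  have v_le: "v n x \<le> exp K" for n x using cone_bound[OF vcone[of n] K0, of x x0] by (simp add: v_x0)
  have v_ge: "exp (- K) \<le> v n x" for n x
    using cone_bound[OF vcone[of n] K0, of x0 x] by (simp add: v_x0 exp_minus divide_simps mult.commute)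
  define B where "B = exp K * (2 * (hi - lo)) / lo"
  have v_diff: "\<bar>v (Suc n) x - v n x\<bar> \<le> B * q ^ n" for n x
  proof -
    have r0: "0 < r n x0" using r_lo[of n x0] lo0 by simp
    have "v (Suc n) x - v n x = v n x * ((r n x - r n x0) / r n x0)"
      using wpos[of n x0] r0 by (simp add: v_def w_Suc field_simps)
    then have "\<bar>v (Suc n) x - v n x\<bar> = v n x * (\<bar>r n x - r n x0\<bar> / r n x0)"
      using coneD(2)[OF vcone] r0 by (simp add: abs_mult)
    also have "\<dots> \<le> exp K * ((2 * ((hi - lo) * q ^ n)) / lo)"
      using r_c[of n x] r_c[of n x0] r_lo[of n x0] lo0
      by (intro mult_mono v_le frac_le) auto
    also have "\<dots> = B * q ^ n" by (simp add: B_def)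
    finally show ?thesis .
  qed
  \<comment> \<open>The limit of \<open>v\<close> as a telescoping series; the leading 1 is
    \<open>v 0\<close>.\<close>
  define u where "u x = 1 + (\<Sum>n. v (Suc n) x - v n x)" for x
  have "uniform_limit UNIV (\<lambda>n x. \<Sum>i<n. v (Suc i) x - v i x) (\<lambda>x. \<Sum>i. v (Suc i) x - v i x) sequentially"
    using v_diff q_bounds by (intro Weierstrass_m_test[where M = "\<lambda>n. B * q ^ n"]) (auto intro: summable_geometric)
  then have "uniform_limit UNIV (\<lambda>n x. 1 + (\<Sum>i<n. v (Suc i) x - v i x)) u sequentially"
    unfolding u_def[abs_def] by (intro uniform_limit_intros)
  moreover have "1 + (\<Sum>i<n. v (Suc i) x - v i x) = v n x" for n x
    using sum_lessThan_telescope[of "\<lambda>n. v n x" n] by (simp add: v_def w_def)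
  ultimately have ul: "uniform_limit UNIV v u sequentially" by simp
  have lim: "(\<lambda>n. v n x) \<longlonglongrightarrow> u x" for x by (rule tendsto_uniform_limitI[OF ul]) simp
  have cu: "continuous_on UNIV u"
    using ul coneD(1)[OF vcone] by (intro uniform_limit_theorem[of _ v sequentially]) auto
  have upos: "0 < u x" for x
  proof -
    have "exp (- K) \<le> u x" by (rule LIMSEQ_le_const[OF lim]) (use v_ge in auto)
    then show ?thesis by (rule less_le_trans[OF exp_gt_zero])
  qed
  have uc: "u \<in> cone K"
    unfolding cone_def
  proof (intro CollectI conjI allI cu)
    fix x y
    show "0 \<le> u x" using upos[of x] by simp
    show "u x \<le> exp (K * D x y) * u y"
      by (rule LIMSEQ_le[OF lim tendsto_mult_left[OF lim]]) (use coneD(3)[OF vcone] in auto)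
  qed
  have "L u x = c * u x" for x
  proof (rule LIMSEQ_unique)
    show "(\<lambda>n. L (v n) x) \<longlonglongrightarrow> L u x"
      using coneD(2)[OF vcone] v_le by (intro L_dominated[where B = "exp K"] lim cu coneD(1)[OF vcone]) auto
    have "(\<lambda>n. (hi - lo) * q ^ n) \<longlonglongrightarrow> 0"
      using q_bounds by (intro tendsto_mult_right_zero LIMSEQ_power_zero) auto
    then have "(\<lambda>n. r n x0 - c) \<longlonglongrightarrow> 0"
      by (rule Lim_null_comparison[rotated]) (simp add: r_c)
    then have "(\<lambda>n. r n x0) \<longlonglongrightarrow> c" by (rule LIM_zero_cancel)
    then have "(\<lambda>n. r n x0 * v (Suc n) x) \<longlonglongrightarrow> c * u x"
      using LIMSEQ_Suc[OF lim] by (intro tendsto_mult)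
    moreover have "L (v n) x = r n x0 * v (Suc n) x" for n
    proof -
      have "L (\<lambda>y. 1 / w n x0 * w n y) x = 1 / w n x0 * L (w n) x"
        by (simp only: L_scale[OF coneD(1)[OF wcone]])
      moreover have "L (w n) = w (Suc n)" by (simp add: w_def)
      moreover have "(\<lambda>y. 1 / w n x0 * w n y) = v n" by (simp add: v_def[abs_def])
      ultimately show ?thesis
        using wpos[of n x0] wpos[of "Suc n" x0] by (simp add: v_def r_def)
    qed
    ultimately show "(\<lambda>n. L (v n) x) \<longlonglongrightarrow> c * u x" by simp
  qed
  then have "L u = (\<lambda>x. c * u x)" by (rule ext)
  moreover have "0 < c" using c(1) lo0 by simp
  ultimately show ?thesis using that uc upos by blast
qed

end

section \<open>The normalized operator\<close>

locale normalized_operator = transfer_operator +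
  fixes u :: "(nat \<Rightarrow> 'a) \<Rightarrow> real" and lam :: real
  assumes lam: "0 < lam" and u_cone: "u \<in> cone K" and u_pos: "0 < u x"
    and L_u: "L u = (\<lambda>x. lam * u x)"
begin

lemma u_cont: "continuous_on UNIV u"
  by (rule coneD(1)[OF u_cone])

text \<open>Being an eigenfunction, \<open>u\<close> inherits the smaller cone into which
  \<open>L\<close> maps. The gained margin 1 leaves room for a factor from
  \<open>cone 1\<close>.\<close>

lemma u_cone': "u \<in> cone (K - 1)"
  using cone_scale[OF L_cone_K[OF u_cone], of "1 / lam"] lam by (simp add: L_u)

text \<open>Conjugation by the eigenfunction and division by the eigenvalue: a Markov operator,
  since it is positive and fixes constants.\<close>

definition N :: "((nat \<Rightarrow> 'a) \<Rightarrow> real) \<Rightarrow> (nat \<Rightarrow> 'a) \<Rightarrow> real" where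
  "N f x = L (\<lambda>y. f y * u y) x / (lam * u x)"

lemma lam_u_neq_0: "lam * u x \<noteq> 0"
  using lam u_pos[of x] by simp

lemma fu_cont: "continuous_on UNIV f \<Longrightarrow> continuous_on UNIV (\<lambda>y. f y * u y)"
  by (intro continuous_on_mult u_cont)

lemma N_continuous: "continuous_on UNIV f \<Longrightarrow> continuous_on UNIV (N f)"
  unfolding N_def[abs_def] using lam_u_neq_0
  by (intro continuous_on_divide continuous_on_mult continuous_on_const L_continuous u_cont) auto

lemma N_pow_continuous: "continuous_on UNIV f \<Longrightarrow> continuous_on UNIV ((N ^^ n) f)"
  by (induction n) (auto intro: N_continuous)

lemma N_combination:
  assumes "continuous_on UNIV f" "continuous_on UNIV g"
  shows "N (\<lambda>x. c * f x + d * g x) = (\<lambda>x. c * N f x + d * N g x)"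
proof -
  have "L (\<lambda>y. (c * f y + d * g y) * u y) = (\<lambda>x. c * L (\<lambda>y. f y * u y) x + d * L (\<lambda>y. g y * u y) x)"
    using L_combination[OF fu_cont[OF assms(1)] fu_cont[OF assms(2)], of c d]
    by (simp add: distrib_right mult.assoc)
  then show ?thesis by (simp add: N_def[abs_def] add_divide_distrib)
qed

lemma N_pow_combination:
  assumes "continuous_on UNIV f" "continuous_on UNIV g"
  shows "(N ^^ n) (\<lambda>x. c * f x + d * g x) = (\<lambda>x. c * (N ^^ n) f x + d * (N ^^ n) g x)"
  by (induction n) (use assms in \<open>simp_all add: N_combination N_pow_continuous\<close>)

lemma N_const: "N (\<lambda>_. c) = (\<lambda>_. c)"
  using lam_u_neq_0 by (simp add: N_def[abs_def] L_scale u_cont L_u)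

lemma N_pow_const: "(N ^^ n) (\<lambda>_. c) = (\<lambda>_. c)"
  by (induction n) (simp_all add: N_const)

lemma N_mono:
  assumes "continuous_on UNIV f" "continuous_on UNIV g" "\<And>x. f x \<le> g x"
  shows "N f x \<le> N g x"
  unfolding N_def using assms(3) u_pos lam
  by (intro divide_right_mono L_mono fu_cont assms(1,2) mult_right_mono) (auto simp: less_imp_le)

lemma N_pow_mono:
  assumes "continuous_on UNIV f" "continuous_on UNIV g" "\<And>x. f x \<le> g x"
  shows "(N ^^ n) f x \<le> (N ^^ n) g x"
  using assms(3) by (induction n arbitrary: x) (use assms in \<open>auto intro!: N_mono N_pow_continuous\<close>)

lemma N_pow_abs_le:
  assumes "continuous_on UNIV f" "\<And>x. \<bar>f x\<bar> \<le> B"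
  shows "\<bar>(N ^^ n) f x\<bar> \<le> B"
proof -
  have "- B \<le> f y \<and> f y \<le> B" for y using assms(2)[of y] by linarith
  then have "(N ^^ n) f x \<le> (N ^^ n) (\<lambda>_. B) x" "(N ^^ n) (\<lambda>_. - B) x \<le> (N ^^ n) f x"
    by (intro N_pow_mono assms(1) continuous_on_const; blast)+
  then show ?thesis by (simp add: N_pow_const abs_le_iff minus_le_iff)
qed

lemma N_pos:
  assumes "continuous_on UNIV f" "\<And>x. 0 < f x"
  shows "0 < N f x"
  unfolding N_def using assms u_pos lam by (intro divide_pos_pos L_pos fu_cont) auto

text \<open>Shifting away the letter just prefixed returns \<open>x\<close>, so \<open>g\<close>
  leaves the integral. Thus \<open>N\<close> is a left inverse of composition with the shift, the
  source of invariance and of decay of correlations.\<close>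

lemma N_shift: "N (\<lambda>x. g (shift x) * f x) = (\<lambda>x. g x * N f x)"
proof -
  have "L (\<lambda>y. g (shift y) * f y * u y) x = g x * L (\<lambda>y. f y * u y) x" for x
  proof -
    have "L (\<lambda>y. g (shift y) * f y * u y) x =
        (LINT \<omega>|m. g x * (exp (A (case_nat \<omega> x)) * (f (case_nat \<omega> x) * u (case_nat \<omega> x))))"
      by (simp add: L_def shift_def mult_ac)
    then show ?thesis by (simp add: L_def)
  qed
  then show ?thesis by (simp add: N_def[abs_def])
qed

lemma N_pow_shift: "(N ^^ n) (\<lambda>x. g ((shift ^^ n) x) * f x) = (\<lambda>x. g x * (N ^^ n) f x)"
proof (induction n arbitrary: f)
  case (Suc n)
  have "(N ^^ Suc n) (\<lambda>x. g ((shift ^^ Suc n) x) * f x)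
      = (N ^^ n) (N (\<lambda>x. (\<lambda>y. g ((shift ^^ n) y)) (shift x) * f x))"
    by (simp add: funpow_Suc_right del: funpow.simps)
  also have "\<dots> = (\<lambda>x. g x * (N ^^ Suc n) f x)"
    unfolding N_shift[of "\<lambda>y. g ((shift ^^ n) y)"] Suc.IH[of "N f"]
    by (simp add: funpow_Suc_right del: funpow.simps)
  finally show ?case .
qed simp

lemma L_pow_eq:
  assumes "continuous_on UNIV f"
  shows "(L ^^ n) (\<lambda>y. f y * u y) = (\<lambda>x. lam ^ n * u x * (N ^^ n) f x)"
proof (induction n)
  case (Suc n)
  have "(L ^^ Suc n) (\<lambda>y. f y * u y) = L (\<lambda>y. lam ^ n * ((N ^^ n) f y * u y))"
    by (simp add: Suc.IH mult_ac)
  also have "\<dots> = (\<lambda>x. lam ^ n * L (\<lambda>y. (N ^^ n) f y * u y) x)"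
    by (intro L_scale fu_cont N_pow_continuous assms)
  also have "\<dots> = (\<lambda>x. lam ^ Suc n * u x * (N ^^ Suc n) f x)"
    using lam_u_neq_0 by (auto simp add: N_def fun_eq_iff)
  finally show ?case .
qed (simp add: mult.commute)

section \<open>Uniform convergence of the iterates to constants\<close>

definition lipschitz :: "((nat \<Rightarrow> 'a) \<Rightarrow> real) \<Rightarrow> bool" where
  "lipschitz f \<longleftrightarrow> continuous_on UNIV f \<and> (\<exists>V. \<forall>x y. \<bar>f x - f y\<bar> \<le> V * D x y)"

lemma lipschitz_bound:
  assumes "lipschitz f"
  obtains V where "0 \<le> V" "\<And>x y. \<bar>f x - f y\<bar> \<le> V * D x y"
proof -
  obtain V where V: "\<And>x y. \<bar>f x - f y\<bar> \<le> V * D x y" using assms by (auto simp: lipschitz_def)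
  have "\<bar>f x - f y\<bar> \<le> max 0 V * D x y" for x y
    using V[of x y] mult_right_mono[of V "max 0 V" "D x y"] D_nonneg by auto
  then show ?thesis using that[of "max 0 V"] by simp
qed

lemma continuous_bounded:
  fixes f :: "(nat \<Rightarrow> 'a) \<Rightarrow> real"
  assumes "continuous_on UNIV f"
  obtains B where "0 < B" "\<And>x. \<bar>f x\<bar> \<le> B"
proof (rule that[of "norm (Bcontfun f) + 1"])
  show "0 < norm (Bcontfun f) + 1" by (simp add: add_nonneg_pos)
  show "\<bar>f x\<bar> \<le> norm (Bcontfun f) + 1" for x
    using norm_bounded[of "Bcontfun f" x] assms by (simp add: apply_Bcontfun)
qed

text \<open>Adding \<open>b = V + B\<close> keeps the function at least \<open>V\<close>, so its
  variation \<open>V * D x y\<close> is at most \<open>D x y\<close> times its value, which is the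
  condition of \<open>cone 1\<close>. The same holds for \<open>- f\<close>. After multiplication by
  \<open>u\<close> the contraction theorem applies with \<open>g = u\<close>, whose iterates are
  explicit.\<close>

lemma lipschitz_convergence:
  assumes "lipschitz f"
  shows "\<exists>c B. \<forall>n x. \<bar>(N ^^ n) f x - c\<bar> \<le> B * q ^ n"
proof -
  have cf: "continuous_on UNIV f" using assms by (simp add: lipschitz_def)
  obtain V where V: "0 \<le> V" "\<And>x y. \<bar>f x - f y\<bar> \<le> V * D x y" using lipschitz_bound[OF assms] by blast
  obtain B where B: "0 < B" "\<And>x. \<bar>f x\<bar> \<le> B" using continuous_bounded[OF cf] by blast
  define b where "b = V + B"
  have cone1: "(\<lambda>x. h x + b) \<in> cone 1"
    if ch: "continuous_on UNIV h" and hB: "\<And>x. \<bar>h x\<bar> \<le> B" and hV: "\<And>x y. \<bar>h x - h y\<bar> \<le> V * D x y" for h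
  proof -
    have "h x + b \<le> exp (1 * D x y) * (h y + b)" for x y
    proof -
      have hb: "V \<le> h y + b" using hB[of y] unfolding b_def by linarith
      have "h x + b \<le> (h y + b) + V * D x y" using hV[of x y] by linarith
      also have "\<dots> \<le> (h y + b) + (h y + b) * D x y"
        using hb D_nonneg by (intro add_left_mono mult_right_mono) auto
      also have "\<dots> = (1 + D x y) * (h y + b)" by (simp add: algebra_simps)
      also have "\<dots> \<le> exp (1 * D x y) * (h y + b)"
        using hb V(1) exp_ge_add_one_self[of "D x y"] by (intro mult_right_mono) auto
      finally show ?thesis .
    qed
    moreover have "0 \<le> h x + b" for x using hB[of x] V(1) unfolding b_def by linarith
    ultimately show ?thesis using ch by (auto simp: cone_def intro!: continuous_intros)
  qed
  have prod: "(\<lambda>x. h x * u x) \<in> cone K" if "h \<in> cone 1" for h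
    using cone_mult[OF that u_cone'] by simp
  have 1: "(\<lambda>x. f x * u x - (- b) * u x) \<in> cone K"
    using prod[OF cone1[OF cf B(2) V(2)]] by (simp add: algebra_simps)
  have "(\<lambda>x. - f x + b) \<in> cone 1"
    using B(2) V(2) by (intro cone1) (auto intro!: continuous_intros cf simp: abs_minus_commute)
  from prod[OF this] have 2: "(\<lambda>x. b * u x - f x * u x) \<in> cone K"
    by (simp add: algebra_simps)
  have 3: "- b \<le> b" using B V(1) by (simp add: b_def)
  have "\<exists>c. \<forall>n x. \<bar>(L ^^ n) (\<lambda>x. f x * u x) x - c * (L ^^ n) u x\<bar> \<le> (b - - b) * q ^ n * (L ^^ n) u x"
    by (rule contraction[OF u_cone fu_cont[OF cf] 1 2 3], rule exI, intro allI)
  then obtain c where c: "\<And>n x. \<bar>(L ^^ n) (\<lambda>x. f x * u x) x - c * (L ^^ n) u x\<bar> \<le> (b - - b) * q ^ n * (L ^^ n) u x"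
    by (elim exE) iprover
  have Lu: "(L ^^ n) u x = lam ^ n * u x" for n x
    using fun_cong[OF L_pow_eq[of "\<lambda>_. 1" n], of x] by (simp add: N_pow_const)
  have "\<bar>(N ^^ n) f x - c\<bar> \<le> (2 * b) * q ^ n" for n x
  proof -
    have p: "0 < lam ^ n * u x" using lam u_pos by simp
    have "(L ^^ n) (\<lambda>x. f x * u x) x - c * (L ^^ n) u x = ((N ^^ n) f x - c) * (lam ^ n * u x)"
      unfolding L_pow_eq[OF cf] Lu by (simp add: algebra_simps)
    then have "\<bar>(N ^^ n) f x - c\<bar> * (lam ^ n * u x) = \<bar>(L ^^ n) (\<lambda>x. f x * u x) x - c * (L ^^ n) u x\<bar>"
      using p by (simp add: abs_mult_pos)
    also have "\<dots> \<le> (2 * b) * q ^ n * (lam ^ n * u x)" using c[of n x] by (simp add: Lu)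
    finally show ?thesis using p by (rule mult_right_le_imp_le)
  qed
  then show ?thesis by (intro exI allI)
qed

text \<open>Stone-Weierstrass: Lipschitz functions form an algebra, and the distance of one
  coordinate to a fixed letter separates points by \<open>D_coordinate\<close>.\<close>

lemma lipschitz_dense:
  assumes "continuous_on UNIV f" "0 < e"
  obtains g where "lipschitz g" "\<And>x. \<bar>f x - g x\<bar> < e"
proof -
  have "\<exists>g. lipschitz g \<and> (\<forall>x\<in>UNIV. \<bar>f x - g x\<bar> < e)"
  proof (rule Stone_Weierstrass_HOL[OF compact_UNIV])
    show "lipschitz (\<lambda>_. c)" for c by (auto simp: lipschitz_def intro: exI[of _ 0])
    show "continuous_on UNIV g" if "lipschitz g" for g using that by (simp add: lipschitz_def)
    show "lipschitz (\<lambda>x. g x + h x)" if gh: "lipschitz g \<and> lipschitz h" for g h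
    proof -
      obtain V where V: "\<And>x y. \<bar>g x - g y\<bar> \<le> V * D x y" using lipschitz_bound gh by blast
      obtain W where W: "\<And>x y. \<bar>h x - h y\<bar> \<le> W * D x y" using lipschitz_bound gh by blast
      have "\<bar>(g x + h x) - (g y + h y)\<bar> \<le> (V + W) * D x y" for x y
        using V[of x y] W[of x y] unfolding distrib_right by linarith
      with gh show ?thesis by (auto simp: lipschitz_def intro!: continuous_intros)
    qed
    show "lipschitz (\<lambda>x. g x * h x)" if gh: "lipschitz g \<and> lipschitz h" for g h
    proof -
      obtain V where V: "\<And>x y. \<bar>g x - g y\<bar> \<le> V * D x y" using lipschitz_bound gh by blast
      obtain W where W: "\<And>x y. \<bar>h x - h y\<bar> \<le> W * D x y" using lipschitz_bound gh by blast
      have cont: "continuous_on UNIV g" "continuous_on UNIV h" using gh by (simp_all add: lipschitz_def)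
      obtain G where G: "0 < G" "\<And>x. \<bar>g x\<bar> \<le> G" using continuous_bounded[OF cont(1)] by blast
      obtain H where H: "0 < H" "\<And>x. \<bar>h x\<bar> \<le> H" using continuous_bounded[OF cont(2)] by blast
      have "\<bar>g x * h x - g y * h y\<bar> \<le> (G * W + H * V) * D x y" for x y
      proof -
        have "g x * h x - g y * h y = g x * (h x - h y) + h y * (g x - g y)" by (simp add: algebra_simps)
        then have "\<bar>g x * h x - g y * h y\<bar> \<le> \<bar>g x\<bar> * \<bar>h x - h y\<bar> + \<bar>h y\<bar> * \<bar>g x - g y\<bar>"
          by (metis abs_mult abs_triangle_ineq)
        also have "\<dots> \<le> G * (W * D x y) + H * (V * D x y)"
          using G(1) H(1) by (intro add_mono mult_mono G(2) H(2) V W) auto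
        finally show ?thesis by (simp add: algebra_simps)
      qed
      with gh show ?thesis by (auto simp: lipschitz_def intro!: continuous_intros)
    qed
    show "\<exists>g. lipschitz g \<and> g x \<noteq> g y" if xy: "x \<in> UNIV \<and> y \<in> UNIV \<and> x \<noteq> y" for x y
    proof -
      obtain n where n: "x n \<noteq> y n" using xy by (auto simp: fun_eq_iff)
      obtain B where B: "\<And>x y. dist (x n) (y n) \<le> B * D x y" using D_coordinate by blast
      have "\<bar>dist (x' n) (y n) - dist (y' n) (y n)\<bar> \<le> B * D x' y'" for x' y'
        using B[of x' y'] abs_dist_diff_le[of "x' n" "y n" "y' n"] by (simp add: dist_commute)
      moreover have "continuous_on UNIV (\<lambda>z. dist (z n) (y n))"
        by (intro continuous_intros continuous_on_product_coordinates)
      ultimately have "lipschitz (\<lambda>z. dist (z n) (y n))" by (auto simp: lipschitz_def)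
      with n show ?thesis by (intro exI[of _ "\<lambda>z. dist (z n) (y n)"]) auto
    qed
  qed fact+
  then show ?thesis using that by auto
qed

text \<open>The iterates of \<open>N\<close> do not increase the sup norm, so convergence passes
  from the dense class to all continuous functions. Allowing different points \<open>x\<close> and
  \<open>y\<close> records that the limit is constant.\<close>

lemma uniformly_Cauchy:
  assumes f: "continuous_on UNIV f" and e: "0 < e"
  shows "\<exists>n0. \<forall>n\<ge>n0. \<forall>k\<ge>n0. \<forall>x y. \<bar>(N ^^ n) f x - (N ^^ k) f y\<bar> < e"
proof -
  obtain g where g: "lipschitz g" "\<And>x. \<bar>f x - g x\<bar> < e / 4"
    using lipschitz_dense[OF f, of "e / 4"] e by auto
  have cg: "continuous_on UNIV g" using g(1) by (simp add: lipschitz_def)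
  obtain c B where "\<forall>n x. \<bar>(N ^^ n) g x - c\<bar> \<le> B * q ^ n"
    using lipschitz_convergence[OF g(1)] by (elim exE)
  then have B: "\<bar>(N ^^ n) g x - c\<bar> \<le> B * q ^ n" for n x by (simp only:)
  have "(\<lambda>n. B * q ^ n) \<longlonglongrightarrow> B * 0"
    using q_bounds by (intro tendsto_intros LIMSEQ_power_zero) auto
  then have "\<forall>\<^sub>F n in sequentially. B * q ^ n < e / 4"
    using e by (intro order_tendstoD(2)[of _ "B * 0"]) auto
  then obtain n0 where n0: "\<And>n. n0 \<le> n \<Longrightarrow> B * q ^ n < e / 4" by (auto simp: eventually_sequentially)
  have fg: "\<bar>(N ^^ n) f x - (N ^^ n) g x\<bar> \<le> e / 4" for n x
  proof -
    have "\<bar>(N ^^ n) (\<lambda>x. 1 * f x + (- 1) * g x) x\<bar> \<le> e / 4"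
      using g(2) by (intro N_pow_abs_le continuous_intros f cg) (simp add: less_imp_le)
    then show ?thesis unfolding N_pow_combination[OF f cg] by simp
  qed
  have "\<bar>(N ^^ n) f x - (N ^^ k) f y\<bar> < e" if "n0 \<le> n" "n0 \<le> k" for n k x y
    using fg[of n x] fg[of k y] B[of n x] B[of k y] n0[OF that(1)] n0[OF that(2)] by linarith
  then show ?thesis by blast
qed

text \<open>The base point \<open>undefined\<close> is arbitrary, as \<open>mean_uniform\<close>
  shows.\<close>

definition mean :: "((nat \<Rightarrow> 'a) \<Rightarrow> real) \<Rightarrow> real" where
  "mean f = lim (\<lambda>n. (N ^^ n) f undefined)"

lemma mean_uniform:
  assumes f: "continuous_on UNIV f" and e: "0 < e"
  shows "\<exists>n0. \<forall>n\<ge>n0. \<forall>x. \<bar>(N ^^ n) f x - mean f\<bar> < e"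
proof -
  have "Cauchy (\<lambda>n. (N ^^ n) f undefined)"
    unfolding Cauchy_def dist_real_def using uniformly_Cauchy[OF f] by meson
  then have lim: "(\<lambda>n. (N ^^ n) f undefined) \<longlonglongrightarrow> mean f"
    unfolding mean_def by (simp add: Cauchy_convergent_iff convergent_LIMSEQ_iff)
  obtain n0 where n0: "\<And>n k x y. n0 \<le> n \<Longrightarrow> n0 \<le> k \<Longrightarrow> \<bar>(N ^^ n) f x - (N ^^ k) f y\<bar> < e / 2"
    using uniformly_Cauchy[OF f half_gt_zero[OF e]] by blast
  have *: "\<bar>(N ^^ n) f x - mean f\<bar> \<le> e / 2" if "n0 \<le> n" for n x
  proof (rule LIMSEQ_le_const2)
    show "(\<lambda>k. \<bar>(N ^^ n) f x - (N ^^ k) f undefined\<bar>) \<longlonglongrightarrow> \<bar>(N ^^ n) f x - mean f\<bar>"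
      by (intro tendsto_intros lim)
  qed (use n0[OF that] in \<open>auto intro!: exI[of _ n0] less_imp_le\<close>)
  then have "\<bar>(N ^^ n) f x - mean f\<bar> < e"
    if "n0 \<le> n" for n x
    using le_less_trans[OF *[OF that], of e] e by simp
  then show ?thesis by blast
qed

lemma mean_LIMSEQ:
  assumes "continuous_on UNIV f"
  shows "(\<lambda>n. (N ^^ n) f x) \<longlonglongrightarrow> mean f"
proof (rule LIMSEQ_I)
  fix e :: real assume "0 < e"
  from mean_uniform[OF assms this] show "\<exists>n0. \<forall>n\<ge>n0. norm ((N ^^ n) f x - mean f) < e" by auto
qed

lemma mean_N:
  assumes "continuous_on UNIV f"
  shows "mean (N f) = mean f"
proof (rule LIMSEQ_unique)
  show "(\<lambda>n. (N ^^ n) (N f) undefined) \<longlonglongrightarrow> mean (N f)"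
    by (intro mean_LIMSEQ N_continuous assms)
  show "(\<lambda>n. (N ^^ n) (N f) undefined) \<longlonglongrightarrow> mean f"
    using LIMSEQ_Suc[OF mean_LIMSEQ[OF assms, of undefined]] by (simp add: funpow_swap1)
qed

lemma mean_N_pow: "continuous_on UNIV f \<Longrightarrow> mean ((N ^^ n) f) = mean f"
  by (induction n) (simp_all add: mean_N N_pow_continuous)

lemma mean_combination:
  assumes "continuous_on UNIV f" "continuous_on UNIV g"
  shows "mean (\<lambda>x. c * f x + d * g x) = c * mean f + d * mean g"
proof (rule LIMSEQ_unique)
  show "(\<lambda>n. (N ^^ n) (\<lambda>x. c * f x + d * g x) undefined) \<longlonglongrightarrow> mean (\<lambda>x. c * f x + d * g x)"
    using assms by (intro mean_LIMSEQ continuous_intros)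
  show "(\<lambda>n. (N ^^ n) (\<lambda>x. c * f x + d * g x) undefined) \<longlonglongrightarrow> c * mean f + d * mean g"
    unfolding N_pow_combination[OF assms] by (intro tendsto_intros mean_LIMSEQ assms)
qed

lemma mean_const: "mean (\<lambda>_. c) = c"
  by (simp add: mean_def N_pow_const)

lemma mean_nonneg:
  assumes "continuous_on UNIV f" "\<And>x. 0 \<le> f x"
  shows "0 \<le> mean f"
proof (rule LIMSEQ_le_const[OF mean_LIMSEQ[OF assms(1), of undefined]])
  have "(N ^^ n) (\<lambda>_. 0) undefined \<le> (N ^^ n) f undefined" for n
    using assms by (intro N_pow_mono) auto
  then show "\<exists>n0. \<forall>n\<ge>n0. 0 \<le> (N ^^ n) f undefined" by (simp add: N_pow_const)
qed

lemma positive_functional_mean: "positive_functional mean"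
proof
  fix f g :: "(nat \<Rightarrow> 'a) \<Rightarrow> real" and c :: real
  assume f: "continuous_on UNIV f"
  show "mean (\<lambda>x. c * f x) = c * mean f" using mean_combination[OF f f, of c 0] by simp
  show "0 \<le> mean f" if "\<And>x. 0 \<le> f x" using f that by (rule mean_nonneg)
  assume g: "continuous_on UNIV g"
  show "mean (\<lambda>x. f x + g x) = mean f + mean g" using mean_combination[OF f g, of 1 1] by simp
qed (rule mean_const)

sublocale mean: positive_functional mean
  by (rule positive_functional_mean)

end

context normalized_operator begin

section \<open>Equilibrium measures\<close>

definition nu :: "'a cfun \<Rightarrow>\<^sub>L real" where
  "nu = Blinfun (\<lambda>\<phi>. mean (apply_bcontfun \<phi>))"

lemma nu_apply: "blinfun_apply nu \<phi> = mean (apply_bcontfun \<phi>)"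
proof -
  have le: "mean (apply_bcontfun \<phi>) \<le> norm \<phi>" for \<phi> :: "'a cfun"
    using mean.mono[of "apply_bcontfun \<phi>" "\<lambda>_. norm \<phi>"] norm_bounded[of \<phi>]
    by (simp add: mean_const abs_le_iff)
  have minus: "mean (apply_bcontfun (- \<phi>)) = - mean (apply_bcontfun \<phi>)" for \<phi> :: "'a cfun"
    using mean.scale[of "apply_bcontfun \<phi>" "- 1"] by simp
  have "bounded_linear (\<lambda>\<phi> :: 'a cfun. mean (apply_bcontfun \<phi>))"
  proof (rule bounded_linear_intro[where K = 1])
    fix \<phi> \<psi> :: "'a cfun" and r :: real
    show "mean (apply_bcontfun (\<phi> + \<psi>)) = mean (apply_bcontfun \<phi>) + mean (apply_bcontfun \<psi>)"
      using mean.add[of "apply_bcontfun \<phi>" "apply_bcontfun \<psi>"] by simp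
    show "mean (apply_bcontfun (r *\<^sub>R \<phi>)) = r *\<^sub>R mean (apply_bcontfun \<phi>)"
      using mean.scale[of "apply_bcontfun \<phi>" r] by simp
    show "norm (mean (apply_bcontfun \<phi>)) \<le> norm \<phi> * 1"
      using le[of \<phi>] le[of "- \<phi>"] by (simp only: minus norm_minus_cancel) (simp add: abs_le_iff)
  qed
  then show ?thesis by (simp add: nu_def bounded_linear_Blinfun_apply)
qed

lemma nu_apply_Bcontfun: "continuous_on UNIV f \<Longrightarrow> expect nu f = mean f"
  by (simp add: nu_apply apply_Bcontfun)

lemma nu_prob: "nu \<in> prob_measures"
  by (auto simp: prob_measures_eq nu_apply mean_const intro: mean.nonneg)

section \<open>Invariance, uniqueness of the fixed point, ergodicity\<close>

lemma shift_pow_continuous: "continuous_on UNIV ((shift ^^ n) :: (nat \<Rightarrow> 'a) \<Rightarrow> _)"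
  by (induction n) (auto intro: continuous_on_compose2[OF continuous_shift])

lemma comp_shift_pow_continuous:
  fixes f :: "(nat \<Rightarrow> 'a) \<Rightarrow> real"
  shows "continuous_on UNIV f \<Longrightarrow> continuous_on UNIV (\<lambda>x. f ((shift ^^ n) x))"
  by (rule continuous_on_compose2[OF _ shift_pow_continuous]) auto

lemma mean_shift_pow:
  assumes "continuous_on UNIV f"
  shows "mean (\<lambda>x. f ((shift ^^ n) x)) = mean f"
proof -
  have "(N ^^ n) (\<lambda>x. f ((shift ^^ n) x) * 1) = f"
    using N_pow_shift[of n f "\<lambda>_. 1"] by (simp add: N_pow_const)
  then show ?thesis
    using mean_N_pow[OF comp_shift_pow_continuous[OF assms], of n n] by simp
qed

lemma nu_inv: "nu \<in> inv_measures"
  unfolding inv_measures_eq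
proof (intro CollectI conjI allI nu_prob)
  fix \<phi> :: "'a cfun"
  show "blinfun_apply nu (shift_fun \<phi>) = blinfun_apply nu \<phi>"
    using mean_shift_pow[of "apply_bcontfun \<phi>" 1] by (simp add: nu_apply ext[OF apply_shift_fun])
qed

text \<open>The value of \<mu> on \<open>(N ^^ n) f\<close> does not change with \<open>n\<close>,
  while the function itself approaches the constant \<open>mean f\<close> uniformly.\<close>

lemma fixed_point_unique:
  assumes \<mu>: "\<mu> \<in> prob_measures"
    and fix_N: "\<And>f. continuous_on UNIV f \<Longrightarrow> expect \<mu> (N f) = expect \<mu> f"
  shows "\<mu> = nu"
proof (rule blinfun_eqI)
  fix \<phi> :: "'a cfun"
  interpret \<mu>: positive_functional "expect \<mu>"
    by (rule positive_functional_prob_measures[OF \<mu>])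
  let ?f = "apply_bcontfun \<phi>"
  have pow: "expect \<mu> ((N ^^ n) ?f) = blinfun_apply \<mu> \<phi>" for n
    by (induction n) (simp_all add: fix_N N_pow_continuous apply_bcontfun_inverse)
  have "\<bar>blinfun_apply \<mu> \<phi> - mean ?f\<bar> \<le> e" if e: "0 < e" for e
  proof -
    obtain n where n: "\<And>x. \<bar>(N ^^ n) ?f x - mean ?f\<bar> < e"
      using mean_uniform[OF _ e, of ?f] by auto
    have c: "continuous_on UNIV ((N ^^ n) ?f)" by (rule N_pow_continuous) simp
    have "expect \<mu> ((N ^^ n) ?f) \<le> expect \<mu> (\<lambda>_. mean ?f + e)"
      by (rule \<mu>.mono[OF c]) (use n in \<open>auto simp: abs_less_iff algebra_simps less_imp_le\<close>)
    moreover have "expect \<mu> (\<lambda>_. mean ?f - e) \<le> expect \<mu> ((N ^^ n) ?f)"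
      by (rule \<mu>.mono[OF _ c]) (use n in \<open>auto simp: abs_less_iff algebra_simps less_imp_le\<close>)
    ultimately show ?thesis unfolding \<mu>.const pow by linarith
  qed
  then have "\<bar>blinfun_apply \<mu> \<phi> - mean ?f\<bar> \<le> 0" by (rule field_le_epsilon) simp
  then show "blinfun_apply \<mu> \<phi> = blinfun_apply nu \<phi>" by (simp add: nu_apply)
qed

text \<open>
  Sums of \<open>f\<close> along the powers of \<open>shift ^^ p\<close> have small variance when \<open>p\<close> is large, since the
  correlations are controlled by \<open>N ^^ p\<close>. This replaces the ergodic theorem.
\<close>

fun birkhoff :: "nat \<Rightarrow> ((nat \<Rightarrow> 'a) \<Rightarrow> real) \<Rightarrow> nat \<Rightarrow> (nat \<Rightarrow> 'a) \<Rightarrow> real" where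
  "birkhoff p f 0 = (\<lambda>_. 0)"
| "birkhoff p f (Suc k) = (\<lambda>x. f x + birkhoff p f k ((shift ^^ p) x))"

lemma birkhoff_continuous: "continuous_on UNIV f \<Longrightarrow> continuous_on UNIV (birkhoff p f k)"
  by (induction k) (auto intro!: continuous_on_add comp_shift_pow_continuous)

lemma birkhoff_bound:
  assumes "\<And>x. \<bar>f x\<bar> \<le> B"
  shows "\<bar>birkhoff p f k x\<bar> \<le> real k * B"
proof (induction k arbitrary: x)
  case (Suc k)
  show ?case using Suc.IH[of "(shift ^^ p) x"] assms[of x] by (simp add: distrib_right)
qed simp

text \<open>Expanding the square in the induction step leaves one cross term, between
  \<open>f\<close> and the remaining sum composed with \<open>shift ^^ p\<close>. Invariance of
  \<open>mean\<close> under \<open>N ^^ p\<close> together with \<open>N_pow_shift\<close> moves the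
  operator onto \<open>f\<close>, where it is small.\<close>

lemma mean_birkhoff_square:
  assumes f: "continuous_on UNIV f" and B: "0 \<le> B" "\<And>x. \<bar>f x\<bar> \<le> B" and e: "\<And>x. \<bar>(N ^^ p) f x\<bar> \<le> e"
  shows "mean (\<lambda>x. (birkhoff p f k x)\<^sup>2) \<le> real k * B\<^sup>2 + e * B * (real k)\<^sup>2"
proof (induction k)
  case 0
  then show ?case by (simp add: mean_const)
next
  case (Suc k)
  let ?S = "birkhoff p f k"
  note cS = birkhoff_continuous[OF f, of p k]
  note cS' = comp_shift_pow_continuous[OF cS, of p]
  have e0: "0 \<le> e" using e[of undefined] by linarith
  have "mean (\<lambda>x. ?S ((shift ^^ p) x) * f x) = mean ((N ^^ p) (\<lambda>x. ?S ((shift ^^ p) x) * f x))"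
    by (rule mean_N_pow[symmetric]) (intro continuous_intros cS' f)
  also have "\<dots> = mean (\<lambda>x. ?S x * (N ^^ p) f x)" by (simp add: N_pow_shift)
  also have "\<dots> \<le> mean (\<lambda>_. (real k * B) * e)"
  proof (rule mean.mono)
    fix x
    have "\<bar>?S x * (N ^^ p) f x\<bar> \<le> (real k * B) * e"
      unfolding abs_mult using B(1) by (intro mult_mono birkhoff_bound B e) auto
    then show "?S x * (N ^^ p) f x \<le> (real k * B) * e" by linarith
  qed (intro continuous_intros cS N_pow_continuous f)+
  finally have corr: "mean (\<lambda>x. ?S ((shift ^^ p) x) * f x) \<le> real k * B * e" by (simp add: mean_const)
  have sq: "mean (\<lambda>x. (f x)\<^sup>2) \<le> B\<^sup>2"
  proof -
    have "mean (\<lambda>x. (f x)\<^sup>2) \<le> mean (\<lambda>_. B\<^sup>2)"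
      using B by (intro mean.mono continuous_intros f) (auto simp: abs_le_square_iff[symmetric])
    then show ?thesis by (simp add: mean_const)
  qed
  have "mean (\<lambda>x. (birkhoff p f (Suc k) x)\<^sup>2)
      = mean (\<lambda>x. ((f x)\<^sup>2 + 2 * (?S ((shift ^^ p) x) * f x)) + (?S ((shift ^^ p) x))\<^sup>2)"
    by (simp add: power2_sum mult_ac add_ac)
  also have "\<dots> = (mean (\<lambda>x. (f x)\<^sup>2) + 2 * mean (\<lambda>x. ?S ((shift ^^ p) x) * f x)) + mean (\<lambda>x. (?S ((shift ^^ p) x))\<^sup>2)"
    by (subst mean.add mean.scale, (intro continuous_intros cS' f)+)+ simp
  also have "mean (\<lambda>x. (?S ((shift ^^ p) x))\<^sup>2) = mean (\<lambda>x. (?S x)\<^sup>2)"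
    using mean_shift_pow[of "\<lambda>x. (?S x)\<^sup>2" p] cS by (simp add: continuous_intros)
  finally have "mean (\<lambda>x. (birkhoff p f (Suc k) x)\<^sup>2)
      \<le> B\<^sup>2 + 2 * (real k * B * e) + (real k * B\<^sup>2 + e * B * (real k)\<^sup>2)"
    using corr sq Suc.IH by linarith
  also have "\<dots> \<le> real (Suc k) * B\<^sup>2 + e * B * (real (Suc k))\<^sup>2"
    using B(1) e0 by (simp add: algebra_simps power2_eq_square)
  finally show ?case .
qed

text \<open>Second moments of Birkhoff sums of a centred function are small under \<open>nu\<close>,
  hence by domination also under \<mu> up to the factor \<open>1 / s\<close>. Invariance makes the
  \<mu>-integral of the sum \<open>k\<close> times that of the function, which therefore cannot
  exceed any \<open>d > 0\<close>. Using \<phi> and \<open>- \<phi>\<close> gives equality.\<close>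

lemma dominated_eq_nu:
  assumes \<mu>: "\<mu> \<in> inv_measures" and s: "0 < s"
    and dom: "\<And>\<phi>. (\<And>\<sigma>. 0 \<le> apply_bcontfun \<phi> \<sigma>) \<Longrightarrow> s * blinfun_apply \<mu> \<phi> \<le> blinfun_apply nu \<phi>"
  shows "\<mu> = nu"
proof -
  interpret \<mu>: positive_functional "expect \<mu>"
    using \<mu> inv_measures_subset by (intro positive_functional_prob_measures) auto
  have shift1: "expect \<mu> (\<lambda>x. f (shift x)) = expect \<mu> f"
    if "continuous_on UNIV f" for f
  proof -
    have "blinfun_apply \<mu> (shift_fun (Bcontfun f)) = expect \<mu> f"
      using \<mu> unfolding inv_measures_eq by blast
    then show ?thesis using that by (simp add: shift_fun_def apply_Bcontfun)
  qed
  have shiftn: "expect \<mu> (\<lambda>x. f ((shift ^^ n) x)) = expect \<mu> f"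
    if "continuous_on UNIV f" for f n
  proof (induction n)
    case (Suc n)
    then show ?case
      using shift1[OF comp_shift_pow_continuous[OF that], of n] by (simp add: funpow_swap1)
  qed simp
  have le: "expect \<mu> f \<le> mean f" if f: "continuous_on UNIV f" for f
  proof (rule field_le_epsilon)
    fix d :: real assume d: "0 < d"
    define g where "g x = f x - mean f" for x
    have g: "continuous_on UNIV g" unfolding g_def by (intro continuous_intros f)
    obtain B where B: "0 < B" "\<And>x. \<bar>g x\<bar> \<le> B" using continuous_bounded[OF g] by blast
    \<comment> \<open>\<open>k\<close> bounds the diagonal part of the second moment, and
      \<open>e\<close> below its correlation part, each by half of
      \<open>s * d^2 * k^2\<close>.\<close>
    obtain k :: nat where k: "2 * B\<^sup>2 / (s * d\<^sup>2) < real k" using reals_Archimedean2 by blast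
    define e where "e = s * d\<^sup>2 / (2 * B)"
    have e: "0 < e" using s d B by (simp add: e_def)
    have mg: "mean g = 0" unfolding g_def using mean.diff[OF f, of "\<lambda>_. mean f"] by (simp add: mean_const)
    obtain p where p: "\<And>x. \<bar>(N ^^ p) g x\<bar> < e"
      using mean_uniform[OF g e] by (auto simp: mg)
    have k0: "0 < real k" using k s d B by (smt (verit) divide_nonneg_pos mult_pos_pos zero_le_power2 zero_less_power)
    define S where "S = birkhoff p g k"
    have cS: "continuous_on UNIV S" unfolding S_def by (rule birkhoff_continuous[OF g])
    have birk: "expect \<mu> (birkhoff p g j) = real j * expect \<mu> g" for j
    proof (induction j)
      case (Suc j)
      have "expect \<mu> (birkhoff p g (Suc j))
          = expect \<mu> g + expect \<mu> (\<lambda>x. birkhoff p g j ((shift ^^ p) x))"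
        unfolding birkhoff.simps
        by (rule \<mu>.add[OF g comp_shift_pow_continuous[OF birkhoff_continuous[OF g]]])
      then show ?case by (simp add: shiftn birkhoff_continuous g Suc.IH algebra_simps)
    qed (simp add: \<mu>.const)
    have "mean (\<lambda>x. (S x)\<^sup>2) \<le> real k * B\<^sup>2 + e * B * (real k)\<^sup>2"
      unfolding S_def using B p by (intro mean_birkhoff_square g) (auto simp: less_imp_le)
    also have "\<dots> \<le> s * d\<^sup>2 * (real k)\<^sup>2"
    proof -
      have "real k * B\<^sup>2 \<le> real k * (real k * (s * d\<^sup>2) / 2)"
        using k s d by (intro mult_left_mono) (auto simp: field_simps)
      also have "\<dots> = s * d\<^sup>2 * (real k)\<^sup>2 / 2" by (simp add: power2_eq_square)
      finally have "real k * B\<^sup>2 \<le> s * d\<^sup>2 * (real k)\<^sup>2 / 2" .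
      moreover have "e * B * (real k)\<^sup>2 = s * d\<^sup>2 * (real k)\<^sup>2 / 2" using B by (simp add: e_def)
      ultimately show ?thesis by linarith
    qed
    finally have var: "mean (\<lambda>x. (S x)\<^sup>2) \<le> s * d\<^sup>2 * (real k)\<^sup>2" .
    have "s * expect \<mu> (\<lambda>x. (S x)\<^sup>2) \<le> mean (\<lambda>x. (S x)\<^sup>2)"
      using dom[of "Bcontfun (\<lambda>x. (S x)\<^sup>2)"] cS by (simp add: apply_Bcontfun nu_apply continuous_intros)
    with var s have var\<mu>: "expect \<mu> (\<lambda>x. (S x)\<^sup>2) \<le> d\<^sup>2 * (real k)\<^sup>2"
      by (smt (verit) mult.assoc mult_le_cancel_left_pos)
    let ?t = "1 / (2 * (d * real k))"
    have t0: "0 < d * real k" using d k0 by simp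
    \<comment> \<open>AM-GM: \<open>S \<le> S\<^sup>2 / (2 d k) + d k / 2\<close>\<close>
    have "real k * expect \<mu> g = expect \<mu> S" by (simp add: S_def birk)
    also have "\<dots> \<le> expect \<mu> (\<lambda>x. ?t * (S x)\<^sup>2 + d * real k / 2)"
    proof (intro \<mu>.mono cS continuous_intros)
      fix x
      have "0 \<le> (S x - d * real k)\<^sup>2 / (2 * (d * real k))" using t0 by simp
      also have "\<dots> = ?t * (S x)\<^sup>2 + d * real k / 2 - S x"
        using d k0 by (simp add: power2_eq_square field_simps)
      finally show "S x \<le> ?t * (S x)\<^sup>2 + d * real k / 2" by simp
    qed
    also have "\<dots> = ?t * expect \<mu> (\<lambda>x. (S x)\<^sup>2) + d * real k / 2"
      by (subst \<mu>.add \<mu>.scale, (intro continuous_intros cS)+)+ (simp add: \<mu>.const)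
    also have "\<dots> \<le> ?t * (d\<^sup>2 * (real k)\<^sup>2) + d * real k / 2"
      using var\<mu> t0 by (intro add_right_mono mult_left_mono) auto
    also have "\<dots> = real k * d" using t0 by (simp add: power2_eq_square field_simps)
    finally have "expect \<mu> g \<le> d" using k0 by simp
    then show "expect \<mu> f \<le> mean f + d"
      unfolding g_def using \<mu>.diff[OF f, of "\<lambda>_. mean f"] by (simp add: \<mu>.const)
  qed
  show ?thesis
  proof (rule blinfun_eqI)
    fix \<phi> :: "'a cfun"
    have "blinfun_apply \<mu> \<phi> \<le> blinfun_apply nu \<phi>" for \<phi>
      using le[of "apply_bcontfun \<phi>"] by (simp add: nu_apply apply_bcontfun_inverse)
    from this[of \<phi>] this[of "- \<phi>"] show "blinfun_apply \<mu> \<phi> = blinfun_apply nu \<phi>"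
      by (simp add: blinfun.minus_right)
  qed
qed

text \<open>A proper convex combination dominates each of its components, with the weight as the
  constant \<open>s\<close>.\<close>

theorem nu_erg: "nu \<in> erg_measures"
proof -
  have "nu \<notin> open_segment \<mu>1 \<mu>2" if \<mu>: "\<mu>1 \<in> inv_measures" "\<mu>2 \<in> inv_measures" for \<mu>1 \<mu>2
  proof
    assume "nu \<in> open_segment \<mu>1 \<mu>2"
    then obtain t where t: "\<mu>1 \<noteq> \<mu>2" "0 < t" "t < 1" "nu = (1 - t) *\<^sub>R \<mu>1 + t *\<^sub>R \<mu>2"
      by (auto simp: in_segment)
    have pos: "0 \<le> blinfun_apply \<mu>1 \<phi>" "0 \<le> blinfun_apply \<mu>2 \<phi>"
      if "\<And>\<sigma>. 0 \<le> apply_bcontfun \<phi> \<sigma>" for \<phi>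
      using prob_measures_nonneg[OF _ that] \<mu> inv_measures_subset by blast+
    have "\<mu>1 = nu"
      by (rule dominated_eq_nu[OF \<mu>(1), of "1 - t"])
        (use t pos(2) in \<open>auto simp: blinfun.add_left blinfun.scaleR_left\<close>)
    moreover have "\<mu>2 = nu"
      by (rule dominated_eq_nu[OF \<mu>(2), of t])
        (use t pos(1) in \<open>auto simp: blinfun.add_left blinfun.scaleR_left\<close>)
    ultimately show False using t(1) by simp
  qed
  then show ?thesis using nu_inv by (auto simp: erg_measures_def extreme_point_of_def)
qed

section \<open>Entropy in terms of the normalized operator\<close>

text \<open>With \<open>\<phi> = exp A * \<psi> * u\<close> the eigenfunction cancels at the same
  point \<sigma>, so the identity is pointwise and holds for every probability measure.\<close>

lemma entropy_integrand:
  assumes \<psi>: "continuous_on UNIV \<psi>" "\<And>x. 0 < \<psi> x" and \<mu>: "\<mu> \<in> prob_measures"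
    and \<phi>: "\<phi> = Bcontfun (\<lambda>x. exp (A x) * (\<psi> x * u x))"
  shows "expect \<mu> (\<lambda>\<sigma>. ln (transfer_op m \<phi> \<sigma> / apply_bcontfun \<phi> \<sigma>))
    = ln lam - expect \<mu> A +
      (expect \<mu> (\<lambda>x. ln (N \<psi> x)) - expect \<mu> (\<lambda>x. ln (\<psi> x)))"
proof -
  interpret \<mu>: positive_functional "expect \<mu>"
    by (rule positive_functional_prob_measures[OF \<mu>])
  have N\<psi>: "0 < N \<psi> x" for x by (rule N_pos[OF \<psi>])
  have "ln (transfer_op m \<phi> \<sigma> / apply_bcontfun \<phi> \<sigma>)
      = ((ln lam - A \<sigma>) + ln (N \<psi> \<sigma>)) - ln (\<psi> \<sigma>)" for \<sigma>
  proof -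
    have "transfer_op m \<phi> \<sigma> = L (\<lambda>y. \<psi> y * u y) \<sigma>"
      unfolding \<phi> by (rule fun_cong[OF L_eq_transfer_op[symmetric]]) (rule fu_cont[OF \<psi>(1)])
    also have "\<dots> = lam * u \<sigma> * N \<psi> \<sigma>" using lam_u_neq_0[of \<sigma>] by (simp add: N_def)
    finally have "transfer_op m \<phi> \<sigma> / apply_bcontfun \<phi> \<sigma> = lam * N \<psi> \<sigma> / (exp (A \<sigma>) * \<psi> \<sigma>)"
      using u_pos[of \<sigma>] A_cont fu_cont[OF \<psi>(1)]
      by (simp add: \<phi> apply_Bcontfun continuous_intros)
    then show ?thesis
      using lam N\<psi>[of \<sigma>] \<psi>(2)[of \<sigma>] by (simp add: ln_div ln_mult)
  qed
  moreover have c: "continuous_on UNIV (\<lambda>x. ln (N \<psi> x))" "continuous_on UNIV (\<lambda>x. ln (\<psi> x))"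
    using N\<psi> \<psi> by (auto intro!: continuous_on_ln N_continuous simp: less_imp_neq[symmetric])
  moreover have "expect \<mu> (\<lambda>\<sigma>. ((ln lam - A \<sigma>) + ln (N \<psi> \<sigma>)) - ln (\<psi> \<sigma>))
      = ((ln lam - expect \<mu> A) + expect \<mu> (\<lambda>x. ln (N \<psi> x)))
        - expect \<mu> (\<lambda>x. ln (\<psi> x))"
    by (subst \<mu>.diff \<mu>.add, (intro continuous_intros c A_cont)+)+ (simp add: \<mu>.const)
  ultimately show ?thesis by simp
qed

lemma entropy_le:
  assumes \<mu>: "\<mu> \<in> prob_measures" and \<psi>: "continuous_on UNIV \<psi>" "\<And>x. 0 < \<psi> x"
  shows "entropy m \<mu> \<le> ereal (ln lam - expect \<mu> A +
      (expect \<mu> (\<lambda>x. ln (N \<psi> x)) - expect \<mu> (\<lambda>x. ln (\<psi> x))))"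
proof -
  have "continuous_on UNIV (\<lambda>x. exp (A x) * (\<psi> x * u x))" by (intro continuous_intros A_cont \<psi> u_cont)
  then have "\<forall>\<sigma>. 0 < apply_bcontfun (Bcontfun (\<lambda>x. exp (A x) * (\<psi> x * u x))) \<sigma>"
    using \<psi>(2) u_pos by (simp add: apply_Bcontfun)
  then show ?thesis
    unfolding entropy_integrand[OF \<psi> \<mu> refl, symmetric] entropy_def by (intro INF_lower) simp
qed

lemma entropy_upper_bound:
  "\<mu> \<in> prob_measures \<Longrightarrow> entropy m \<mu> \<le> ereal (ln lam - expect \<mu> A)"
  using entropy_le[of \<mu> "\<lambda>_. 1"] by (simp add: N_const)

lemma entropy_nu: "entropy m nu = ereal (ln lam - expect nu A)"
proof (rule antisym[OF entropy_upper_bound[OF nu_prob]])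
  show "ereal (ln lam - expect nu A) \<le> entropy m nu"
    unfolding entropy_def
  proof (rule INF_greatest)
    fix \<phi> :: "'a cfun" assume "\<phi> \<in> {\<phi>. \<forall>\<sigma>. 0 < apply_bcontfun \<phi> \<sigma>}"
    then have pos: "0 < apply_bcontfun \<phi> \<sigma>" for \<sigma> by simp
    \<comment> \<open>Every positive test function has the substituted form, so the whole infimum is
      covered.\<close>
    define \<psi> where "\<psi> x = apply_bcontfun \<phi> x / (exp (A x) * u x)" for x
    have u0: "u x \<noteq> 0" for x using u_pos[of x] by simp
    have \<psi>: "continuous_on UNIV \<psi>" "\<And>x. 0 < \<psi> x"
      using pos u_pos u0 by (auto simp: \<psi>_def[abs_def] intro!: continuous_intros A_cont u_cont)
    have \<phi>: "\<phi> = Bcontfun (\<lambda>x. exp (A x) * (\<psi> x * u x))"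
      using u0 by (simp add: \<psi>_def mult.commute apply_bcontfun_inverse)
    have N\<psi>: "0 < N \<psi> x" for x by (rule N_pos[OF \<psi>])
    have c: "continuous_on UNIV (\<lambda>x. ln (N \<psi> x))" "continuous_on UNIV (\<lambda>x. ln (\<psi> x))"
      using N\<psi> \<psi> by (auto intro!: continuous_on_ln N_continuous simp: less_imp_neq[symmetric])
    \<comment> \<open>Jensen's inequality for \<open>N\<close>, from the tangent line of the logarithm at \<open>N \<psi> x\<close>\<close>
    have jensen: "N (\<lambda>y. ln (\<psi> y)) x \<le> ln (N \<psi> x)" for x
    proof -
      let ?c = "N \<psi> x"
      have "N (\<lambda>y. ln (\<psi> y)) x \<le> N (\<lambda>y. (1 / ?c) * \<psi> y + (ln ?c - 1) * 1) x"
      proof (rule N_mono[OF c(2)])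
        show "continuous_on UNIV (\<lambda>y. (1 / ?c) * \<psi> y + (ln ?c - 1) * 1)" by (intro continuous_intros \<psi>)
        fix y
        show "ln (\<psi> y) \<le> (1 / ?c) * \<psi> y + (ln ?c - 1) * 1"
          using ln_le_minus_one[of "\<psi> y / ?c"] \<psi>(2)[of y] N\<psi>[of x] by (simp add: ln_div)
      qed
      also have "\<dots> = ln ?c"
        using N\<psi>[of x] by (subst N_combination) (auto simp: N_const \<psi>)
      finally show ?thesis .
    qed
    have "mean (\<lambda>x. ln (\<psi> x)) = mean (N (\<lambda>x. ln (\<psi> x)))" by (rule mean_N[OF c(2), symmetric])
    also have "\<dots> \<le> mean (\<lambda>x. ln (N \<psi> x))" by (rule mean.mono[OF N_continuous[OF c(2)] c(1) jensen])
    finally show "ereal (ln lam - expect nu A) \<le>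
        ereal (expect nu (\<lambda>\<sigma>. ln (transfer_op m \<phi> \<sigma> / apply_bcontfun \<phi> \<sigma>)))"
      by (simp add: entropy_integrand[OF \<psi> nu_prob \<phi>] nu_apply_Bcontfun c)
  qed
qed

text \<open>
  A maximizer is a fixed point of the dual of \<open>N\<close>: differentiate
  \<open>t \<mapsto> \<mu> (ln (N (exp (t f)))) - t \<mu> f\<close> at \<open>t = 0\<close>.
\<close>

theorem equilibrium_unique:
  assumes \<mu>: "\<mu> \<in> prob_measures" and max: "ereal (ln lam - expect \<mu> A) \<le> entropy m \<mu>"
  shows "\<mu> = nu"
proof (rule fixed_point_unique[OF \<mu>])
  interpret \<mu>: positive_functional "expect \<mu>"
    by (rule positive_functional_prob_measures[OF \<mu>])
  have ineq: "expect \<mu> (\<lambda>x. ln (\<psi> x)) \<le> expect \<mu> (\<lambda>x. ln (N \<psi> x))"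
    if \<psi>: "continuous_on UNIV \<psi>" "\<And>x. 0 < \<psi> x" for \<psi>
    using order_trans[OF max entropy_le[OF \<mu> \<psi>]] by simp
  have half: "expect \<mu> h \<le> expect \<mu> (N h)"
    if h: "continuous_on UNIV h" and h01: "\<And>x. 0 \<le> h x" "\<And>x. h x \<le> 1" for h
  proof (rule field_le_epsilon)
    fix e :: real assume e: "0 < e"
    define t where "t = min e 1"
    have t: "0 < t" "t \<le> 1" "t \<le> e" using e by (auto simp: t_def)
    define \<psi> where "\<psi> x = exp (t * h x)" for x
    have \<psi>: "continuous_on UNIV \<psi>" "\<And>x. 0 < \<psi> x"
      unfolding \<psi>_def by (intro continuous_intros h, simp)
    have N\<psi>: "0 < N \<psi> x" for x by (rule N_pos[OF \<psi>])
    have c: "continuous_on UNIV (\<lambda>x. ln (N \<psi> x))"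
      using N\<psi> \<psi> by (auto intro!: continuous_on_ln N_continuous simp: less_imp_neq[symmetric])
    \<comment> \<open>\<open>exp s \<le> 1 + s + s^2\<close> on \<open>[0, 1]\<close> and
      \<open>ln s \<le> s - 1\<close> leave an error of order \<open>t^2\<close>, which is harmless
      after division by \<open>t\<close>.\<close>
    have "ln (N \<psi> x) \<le> t * N h x + t\<^sup>2" for x
    proof -
      have "N \<psi> x \<le> N (\<lambda>y. t * h y + (1 + t\<^sup>2) * 1) x"
      proof (rule N_mono[OF \<psi>(1)])
        show "continuous_on UNIV (\<lambda>y. t * h y + (1 + t\<^sup>2) * 1)" by (intro continuous_intros h)
        fix y
        have th: "0 \<le> t * h y" "t * h y \<le> t" using t h01[of y] by (auto simp: mult_left_le)
        have "t * h y \<le> 1" using th t by linarith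
        with th(1) have "\<psi> y \<le> 1 + t * h y + (t * h y)\<^sup>2" unfolding \<psi>_def by (intro exp_bound)
        also have "(t * h y)\<^sup>2 \<le> t\<^sup>2" using th by (intro power_mono)
        finally show "\<psi> y \<le> t * h y + (1 + t\<^sup>2) * 1" by simp
      qed
      also have "\<dots> = t * N h x + (1 + t\<^sup>2)" by (subst N_combination) (auto simp: N_const h)
      finally show ?thesis using ln_le_minus_one[OF N\<psi>[of x]] by linarith
    qed
    then have "expect \<mu> (\<lambda>x. ln (N \<psi> x)) \<le> expect \<mu> (\<lambda>x. t * N h x + t\<^sup>2)"
      by (intro \<mu>.mono c continuous_intros N_continuous h)
    also have "\<dots> = t * expect \<mu> (N h) + t\<^sup>2"
      by (subst \<mu>.add \<mu>.scale, (intro continuous_intros N_continuous h)+)+ (simp add: \<mu>.const)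
    finally have "expect \<mu> (\<lambda>x. ln (\<psi> x)) \<le> t * expect \<mu> (N h) + t\<^sup>2"
      using ineq[OF \<psi>] by linarith
    then have "t * expect \<mu> h \<le> t * (expect \<mu> (N h) + t)"
      using \<mu>.scale[OF h, of t] by (simp add: \<psi>_def power2_eq_square distrib_left)
    then have "expect \<mu> h \<le> expect \<mu> (N h) + t"
      using t(1) by (rule mult_left_le_imp_le)
    then show "expect \<mu> h \<le> expect \<mu> (N h) + e" using t(3) by linarith
  qed
  fix f :: "(nat \<Rightarrow> 'a) \<Rightarrow> real" assume f: "continuous_on UNIV f"
  obtain B where B: "0 < B" "\<And>x. \<bar>f x\<bar> \<le> B" using continuous_bounded[OF f] by blast
  have le: "expect \<mu> g \<le> expect \<mu> (N g)"
    if g: "continuous_on UNIV g" "\<And>x. \<bar>g x\<bar> \<le> B" for g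
  proof -
    \<comment> \<open>Affine rescaling into \<open>[0, 1]\<close>, where the estimate was proved.
      \<open>N\<close> and \<mu> both respect it because they preserve constants.\<close>
    define h where "h x = (1 / (2 * B)) * g x + (1 / 2) * 1" for x
    have h: "continuous_on UNIV h" unfolding h_def by (intro continuous_intros g)
    have "0 \<le> h x" "h x \<le> 1" for x
      using g(2)[of x] B(1) by (auto simp: h_def field_simps abs_le_iff)
    then have "expect \<mu> h \<le> expect \<mu> (N h)" by (rule half[OF h])
    moreover have "N h = (\<lambda>x. (1 / (2 * B)) * N g x + (1 / 2) * 1)"
      unfolding h_def by (subst N_combination) (auto simp: N_const g)
    moreover have "expect \<mu> (\<lambda>x. (1 / (2 * B)) * k x + (1 / 2) * 1)
        = (1 / (2 * B)) * expect \<mu> k + 1 / 2" if "continuous_on UNIV k" for k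
      by (subst \<mu>.add \<mu>.scale, (intro continuous_intros that)+)+ (simp add: \<mu>.const)
    ultimately have "(1 / (2 * B)) * expect \<mu> g \<le> (1 / (2 * B)) * expect \<mu> (N g)"
      using g N_continuous by (simp add: h_def[abs_def])
    then show ?thesis by (rule mult_left_le_imp_le) (use B in simp)
  qed
  have neg: "expect \<mu> (\<lambda>x. - 1 * g x) = - expect \<mu> g"
    if "continuous_on UNIV g" for g
    using \<mu>.scale[OF that, of "- 1"] by simp
  have "N (\<lambda>x. - 1 * f x) = (\<lambda>x. - 1 * N f x)" using N_combination[OF f f, of "- 1" 0] by simp
  then show "expect \<mu> (N f) = expect \<mu> f"
    using le[OF f B(2)] le[of "\<lambda>x. - 1 * f x"] neg[OF f] neg[OF N_continuous[OF f]] f B(2)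
    by (simp add: continuous_intros)
qed

end

section \<open>Equilibrium measures of Hoelder potentials\<close>

context
  fixes \<eta> :: real
  assumes eta: "0 < \<eta>" "\<eta> < 1" and diam: "\<And>\<omega> \<omega>' :: 'a::compact_metric_space. dist \<omega> \<omega>' \<le> 1"
begin

lemma summable_d_eta: "summable (\<lambda>n. \<eta> ^ n * dist (x n :: 'a) (y n))"
proof (rule summable_comparison_test[OF _ summable_geometric[of \<eta>]])
  show "\<exists>N. \<forall>n\<ge>N. norm (\<eta> ^ n * dist (x n) (y n)) \<le> \<eta> ^ n"
    using eta diam by (auto intro!: exI[of _ 0] mult_left_le)
qed (use eta in auto)

lemma d_eta_nonneg: "0 \<le> d_eta \<eta> x (y :: nat \<Rightarrow> 'a)"
  unfolding d_eta_def using eta summable_d_eta[of x y]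
  by (intro mult_nonneg_nonneg suminf_nonneg) auto

lemma d_eta_le_one: "d_eta \<eta> x (y :: nat \<Rightarrow> 'a) \<le> 1"
proof -
  have "(\<Sum>n. \<eta> ^ n * dist (x n) (y n)) \<le> (\<Sum>n. \<eta> ^ n)"
    using eta diam summable_d_eta[of x y] by (intro suminf_le summable_geometric) (auto intro: mult_left_le)
  then show ?thesis using eta by (simp add: d_eta_def suminf_geometric field_simps)
qed

lemma d_eta_cons: "d_eta \<eta> (case_nat \<omega> x) (case_nat \<omega> (y :: nat \<Rightarrow> 'a)) = \<eta> * d_eta \<eta> x y"
proof -
  have "(\<Sum>n. \<eta> ^ n * dist (case_nat \<omega> x n) (case_nat \<omega> y n))
      = (\<Sum>n. \<eta> ^ Suc n * dist (case_nat \<omega> x (Suc n)) (case_nat \<omega> y (Suc n)))"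
    using suminf_split_head[OF summable_d_eta[of "case_nat \<omega> x" "case_nat \<omega> y"]] by simp
  also have "\<dots> = \<eta> * (\<Sum>n. \<eta> ^ n * dist (x n) (y n))"
    using suminf_mult[OF summable_d_eta[of x y], of \<eta>] by (simp add: mult.assoc)
  finally show ?thesis by (simp add: d_eta_def)
qed

lemma d_eta_coordinate: "dist (x n) (y n) \<le> 1 / ((1 - \<eta>) * \<eta> ^ n) * d_eta \<eta> x (y :: nat \<Rightarrow> 'a)"
proof -
  have "\<eta> ^ n * dist (x n) (y n) \<le> (\<Sum>n. \<eta> ^ n * dist (x n) (y n))"
    using sum_le_suminf[OF summable_d_eta[of x y], of "{n}"] eta by simp
  then have "(1 - \<eta>) * (\<eta> ^ n * dist (x n) (y n)) \<le> d_eta \<eta> x y"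
    unfolding d_eta_def using eta by (intro mult_left_mono) auto
  then show ?thesis using eta by (simp add: field_simps)
qed

theorem holder_equilibrium:
  fixes m :: "'a measure"
  assumes m: "prob_space m" "sets m = sets borel"
    and \<alpha>: "0 < \<alpha>" "\<alpha> \<le> 1" and \<phi>: "\<phi> \<in> holder_functions \<eta> \<alpha>"
  shows "\<exists>\<nu>\<in>erg_measures. \<exists>p :: real. entropy m \<nu> = ereal (p - blinfun_apply \<nu> \<phi>) \<and>
    (\<forall>\<mu>\<in>prob_measures. entropy m \<mu> \<le> ereal (p - blinfun_apply \<mu> \<phi>)) \<and>
    (\<forall>\<mu>\<in>prob_measures. ereal (p - blinfun_apply \<mu> \<phi>) \<le> entropy m \<mu> \<longrightarrow> \<mu> = \<nu>)"
proof -
  obtain C where C: "\<And>\<sigma> \<sigma>'. \<bar>apply_bcontfun \<phi> \<sigma> - apply_bcontfun \<phi> \<sigma>'\<bar> \<le> C * d_eta \<eta> \<sigma> \<sigma>' powr \<alpha>"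
    using \<phi> by (auto simp: holder_functions_def)
  have lt1: "\<eta> powr \<alpha> < 1" using powr_less_mono2[of \<alpha> \<eta> 1] eta \<alpha> by simp
  \<comment> \<open>Prefixing a letter multiplies \<open>d_eta\<close> by \<eta>, hence its power by
    \<open>\<eta> powr \<alpha>\<close>. The constant in \<open>holder_functions\<close> carries no
    sign, which is why \<open>max 0 C\<close> appears.\<close>
  interpret transfer_operator m "\<lambda>x y. d_eta \<eta> x y powr \<alpha>" "\<eta> powr \<alpha>" "max 0 C" "apply_bcontfun \<phi>"
  proof (rule transfer_operator.intro)
    fix x y :: "nat \<Rightarrow> 'a" and \<omega> n
    show "d_eta \<eta> x y powr \<alpha> \<le> 1"
      using powr_mono2[of \<alpha> "d_eta \<eta> x y" 1] d_eta_nonneg[of x y] d_eta_le_one[of x y] \<alpha> by simp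
    show "d_eta \<eta> x y powr \<alpha> = d_eta \<eta> y x powr \<alpha>"
      by (simp add: d_eta_def dist_commute)
    show "d_eta \<eta> (case_nat \<omega> x) (case_nat \<omega> y) powr \<alpha> = \<eta> powr \<alpha> * d_eta \<eta> x y powr \<alpha>"
      using eta d_eta_nonneg[of x y] by (simp add: d_eta_cons powr_mult)
    show "\<exists>B. \<forall>x y. dist (x n) (y n) \<le> B * d_eta \<eta> x (y :: nat \<Rightarrow> 'a) powr \<alpha>"
    proof (intro exI allI)
      fix x y :: "nat \<Rightarrow> 'a"
      \<comment> \<open>Distances are at most 1 and \<open>\<alpha> \<le> 1\<close>, so raising to
        the power \<alpha> can only enlarge them.\<close>
      have "d_eta \<eta> x y powr 1 \<le> d_eta \<eta> x y powr \<alpha>"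
        using \<alpha> d_eta_nonneg[of x y] d_eta_le_one[of x y] by (intro powr_mono') auto
      then have "1 / ((1 - \<eta>) * \<eta> ^ n) * d_eta \<eta> x y \<le> 1 / ((1 - \<eta>) * \<eta> ^ n) * d_eta \<eta> x y powr \<alpha>"
        using eta d_eta_nonneg[of x y] by (intro mult_left_mono) auto
      with d_eta_coordinate[of x n y]
      show "dist (x n) (y n) \<le> 1 / ((1 - \<eta>) * \<eta> ^ n) * d_eta \<eta> x y powr \<alpha>" by linarith
    qed
    have "C * d_eta \<eta> x y powr \<alpha> \<le> max 0 C * d_eta \<eta> x y powr \<alpha>" by (intro mult_right_mono) auto
    with C[of x y] show "apply_bcontfun \<phi> x - apply_bcontfun \<phi> y \<le> max 0 C * d_eta \<eta> x y powr \<alpha>" by linarith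
  qed (use m eta lt1 in auto)
  obtain lam u where "0 < lam" "u \<in> cone K" "\<And>x. 0 < u x" "L u = (\<lambda>x. lam * u x)"
    using eigenfunction by blast
  then interpret normalized_operator m "\<lambda>x y. d_eta \<eta> x y powr \<alpha>" "\<eta> powr \<alpha>" "max 0 C" "apply_bcontfun \<phi>" u lam
    by unfold_locales
  show ?thesis
    using nu_erg entropy_nu entropy_upper_bound equilibrium_unique
    by (intro bexI[of _ nu] exI[of _ "ln lam"]) (auto simp: apply_bcontfun_inverse)
qed

end

section \<open>Hahn-Banach and affine minorants\<close>

text \<open>Homogeneity is demanded as an inequality for \<open>c > 0\<close>, which is convenient
  to verify for infima; equality is recovered in \<open>sublinear_scale\<close>.\<close>

definition sublinear :: "('x::real_vector \<Rightarrow> real) \<Rightarrow> bool" where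
  "sublinear p \<longleftrightarrow> (\<forall>x y. p (x + y) \<le> p x + p y) \<and> (\<forall>c x. 0 < c \<longrightarrow> p (c *\<^sub>R x) \<le> c * p x)"

lemma sublinear_add: "sublinear p \<Longrightarrow> p (x + y) \<le> p x + p y"
  by (simp add: sublinear_def)

lemma sublinear_zero:
  assumes "sublinear p"
  shows "p 0 = 0"
proof -
  have "p 0 \<le> 2 * p 0" "p 0 \<le> (1/2) * p 0"
    using assms[unfolded sublinear_def, THEN conjunct2, rule_format, of 2 0]
      assms[unfolded sublinear_def, THEN conjunct2, rule_format, of "1/2" 0] by simp_all
  then show ?thesis by linarith
qed

lemma sublinear_scale:
  assumes "sublinear p" "0 \<le> c"
  shows "p (c *\<^sub>R x) = c * p x"
proof (cases "c = 0")
  case False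
  then have c: "0 < c" using assms by simp
  have le: "p (c *\<^sub>R x) \<le> c * p x" if "0 < c" for c x using assms(1) that by (simp add: sublinear_def)
  have "p x \<le> (1 / c) * p (c *\<^sub>R x)" using le[of "1 / c" "c *\<^sub>R x"] c by simp
  then have "c * p x \<le> p (c *\<^sub>R x)" using c by (simp add: field_simps)
  with le[OF c, of x] show ?thesis by simp
qed (simp add: sublinear_zero assms)

lemma sublinear_neg: "sublinear p \<Longrightarrow> - p (- x) \<le> p x"
  using sublinear_add[of p x "- x"] sublinear_zero[of p] by simp

text \<open>The infimum is finite because \<open>q x \<ge> - q (- x) \<ge> - p (- x)\<close>. The
  chain property supplies one functional below two given ones, which gives subadditivity.\<close>

lemma sublinear_Inf_chain:
  assumes ne: "Q \<noteq> {}" and Q: "\<And>q. q \<in> Q \<Longrightarrow> sublinear q \<and> q \<le> p"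
    and ch: "\<And>q r. q \<in> Q \<Longrightarrow> r \<in> Q \<Longrightarrow> q \<le> r \<or> r \<le> q"
  shows "sublinear (\<lambda>x. INF q\<in>Q. q x)" "\<And>q. q \<in> Q \<Longrightarrow> (\<lambda>x. INF q\<in>Q. q x) \<le> q"
proof -
  have bdd: "bdd_below ((\<lambda>q. q x) ` Q)" for x
  proof (rule bdd_belowI2)
    fix q assume "q \<in> Q"
    then have "- q (- x) \<le> q x" "q (- x) \<le> p (- x)" using Q sublinear_neg by (auto simp: le_fun_def)
    then show "- p (- x) \<le> q x" by linarith
  qed
  show "(\<lambda>x. INF q\<in>Q. q x) \<le> q" if "q \<in> Q" for q
    by (intro le_funI cINF_lower bdd that)
  have "(INF q\<in>Q. q (x + y)) \<le> (INF q\<in>Q. q x) + (INF q\<in>Q. q y)" for x y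
  proof -
    have 1: "(INF q\<in>Q. q (x + y)) \<le> q x + r y" if qr: "q \<in> Q" "r \<in> Q" for q r
    proof -
      obtain s where s: "s \<in> Q" "s \<le> q" "s \<le> r" using ch[OF qr] qr by auto
      have "(INF q\<in>Q. q (x + y)) \<le> s (x + y)" by (intro cINF_lower bdd s)
      also have "\<dots> \<le> s x + s y" using Q s by (intro sublinear_add) auto
      also have "\<dots> \<le> q x + r y" using s by (intro add_mono) (auto simp: le_fun_def)
      finally show ?thesis .
    qed
    have "(INF q\<in>Q. q (x + y)) - r y \<le> (INF q\<in>Q. q x)" if "r \<in> Q" for r
      using 1[OF _ that] by (intro cINF_greatest ne) (simp add: algebra_simps)
    then have "(INF q\<in>Q. q (x + y)) - (INF q\<in>Q. q x) \<le> (INF q\<in>Q. q y)"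
      by (intro cINF_greatest ne) (simp add: algebra_simps)
    then show ?thesis by simp
  qed
  moreover have "(INF q\<in>Q. q (c *\<^sub>R x)) \<le> c * (INF q\<in>Q. q x)" if c: "0 < c" for c x
  proof -
    have "(1 / c) * (INF q\<in>Q. q (c *\<^sub>R x)) \<le> q x" if "q \<in> Q" for q
    proof -
      have "(INF q\<in>Q. q (c *\<^sub>R x)) \<le> q (c *\<^sub>R x)" by (intro cINF_lower bdd that)
      also have "\<dots> = c * q x" using Q that c by (intro sublinear_scale) auto
      finally show ?thesis using c by (simp add: field_simps)
    qed
    then have "(1 / c) * (INF q\<in>Q. q (c *\<^sub>R x)) \<le> (INF q\<in>Q. q x)" by (intro cINF_greatest ne)
    then show ?thesis using c by (simp add: field_simps)
  qed
  ultimately show "sublinear (\<lambda>x. INF q\<in>Q. q x)" by (simp add: sublinear_def)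
qed

text \<open>A minimal sublinear functional is linear.\<close>

theorem Hahn_Banach_sublinear:
  fixes p :: "'x::real_vector \<Rightarrow> real"
  assumes p: "sublinear p"
  shows "\<exists>f. linear f \<and> (\<forall>x. f x \<le> p x)"
proof -
  define S where "S = {q. sublinear q \<and> q \<le> p}"
  have "\<exists>q\<in>S. \<forall>r\<in>S. r \<le> q \<longrightarrow> r = q"
  \<comment> \<open>With the order reversed, the maximal element is a minimal sublinear
    functional.\<close>
  proof (rule predicate_Zorn[where P = "\<lambda>q r. r \<le> q"])
    show "partial_order_on S (relation_of (\<lambda>q r. r \<le> q) S)"
      by (rule partial_order_on_relation_ofI) auto
    fix Q assume Q: "Q \<in> Chains (relation_of (\<lambda>q r. r \<le> q) S)"
    then have QS: "q \<in> S" if "q \<in> Q" for q using that by (auto simp: Chains_def relation_of_def)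
    have ch: "q \<le> r \<or> r \<le> q" if "q \<in> Q" "r \<in> Q" for q r
      using Q that by (auto simp: Chains_def relation_of_def)
    show "\<exists>u\<in>S. \<forall>a\<in>Q. u \<le> a"
    proof (cases "Q = {}")
      case True
      then show ?thesis using p by (auto simp: S_def)
    next
      case False
      note inf = sublinear_Inf_chain[OF False, of p, OF _ ch]
      have "(\<lambda>x. INF q\<in>Q. q x) \<in> S"
        using inf False QS order_trans unfolding S_def by blast
      then show ?thesis using inf(2) QS unfolding S_def by blast
    qed
  qed
  then obtain q where q: "sublinear q" "q \<le> p" and min: "\<And>r. sublinear r \<Longrightarrow> r \<le> q \<Longrightarrow> r = q"
    unfolding S_def by (auto intro: order_trans)
  have super: "q x + q v \<le> q (x + v)" for x v
  proof -
    \<comment> \<open>\<open>r\<close> may move the argument along \<open>v\<close> and is credited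
      \<open>q v\<close> per unit of length. It is sublinear and below \<open>q\<close>, so
      minimality gives \<open>r = q\<close>, and \<open>t = 1\<close> then shows
      superadditivity.\<close>
    define r where "r x = (INF t\<in>{0..}. q (x + t *\<^sub>R v) - t * q v)" for x
    have bdd: "bdd_below ((\<lambda>t. q (x + t *\<^sub>R v) - t * q v) ` {0..})" for x
    proof (rule bdd_belowI2)
      fix t :: real assume "t \<in> {0..}"
      then have "t * q v = q (t *\<^sub>R v)" using sublinear_scale[OF q(1)] by simp
      also have "\<dots> \<le> q (x + t *\<^sub>R v) + q (- x)" using sublinear_add[OF q(1), of "x + t *\<^sub>R v" "- x"] by simp
      finally show "- q (- x) \<le> q (x + t *\<^sub>R v) - t * q v" by linarith
    qed
    have lower: "r x \<le> q (x + t *\<^sub>R v) - t * q v" if "0 \<le> t" for x t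
      unfolding r_def using that by (intro cINF_lower bdd) auto
    have "r (x + y) \<le> r x + r y" for x y
    proof -
      have 1: "r (x + y) \<le> (q (x + s *\<^sub>R v) - s * q v) + (q (y + t *\<^sub>R v) - t * q v)" if "0 \<le> s" "0 \<le> t" for s t
        using lower[of "s + t" "x + y"] that sublinear_add[OF q(1), of "x + s *\<^sub>R v" "y + t *\<^sub>R v"]
        by (simp add: algebra_simps)
      have "r (x + y) - (q (y + t *\<^sub>R v) - t * q v) \<le> r x" if "0 \<le> t" for t
        unfolding r_def[of x] using 1[OF _ that] by (intro cINF_greatest) (auto simp: algebra_simps)
      then have "r (x + y) - r x \<le> r y"
        unfolding r_def[of y] by (intro cINF_greatest) (auto simp: algebra_simps)
      then show ?thesis by simp
    qed
    moreover have "r (c *\<^sub>R x) \<le> c * r x" if c: "0 < c" for c x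
    proof -
      have "(1 / c) * r (c *\<^sub>R x) \<le> r x"
        unfolding r_def[of x]
      proof (intro cINF_greatest)
        fix t :: real assume t: "t \<in> {0..}"
        have "r (c *\<^sub>R x) \<le> q (c *\<^sub>R (x + t *\<^sub>R v)) - c * t * q v"
          using lower[of "c * t" "c *\<^sub>R x"] c t by (simp add: scaleR_add_right)
        also have "q (c *\<^sub>R (x + t *\<^sub>R v)) = c * q (x + t *\<^sub>R v)" using c by (intro sublinear_scale q) simp
        finally show "(1 / c) * r (c *\<^sub>R x) \<le> q (x + t *\<^sub>R v) - t * q v"
          using c by (simp add: field_simps)
      qed simp
      then show ?thesis using c by (simp add: field_simps)
    qed
    ultimately have "sublinear r" by (simp add: sublinear_def)
    moreover have "r \<le> q" using lower[of 0] by (auto intro: le_funI)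
    ultimately have "r = q" by (rule min)
    with lower[of 1 x] show ?thesis by simp
  qed
  have add: "q (x + y) = q x + q y" for x y
    using super[of x y] sublinear_add[OF q(1), of x y] by simp
  have "q (c *\<^sub>R x) = c * q x" for c x
  proof (cases "0 \<le> c")
    case False
    have "q (c *\<^sub>R x) + q ((- c) *\<^sub>R x) = 0" using add[of "c *\<^sub>R x" "(- c) *\<^sub>R x"] sublinear_zero[OF q(1)] by simp
    then show ?thesis using sublinear_scale[OF q(1), of "- c" x] False by simp
  qed (simp add: sublinear_scale q)
  then have "linear q" using add by (intro linearI) auto
  then show ?thesis using q(2) by (auto simp: le_fun_def)
qed

text \<open>The sublinear functional below is the positively homogeneous hull at \<open>x0\<close> of the
  infimal convolution of \<open>g - a\<close> and \<open>M * norm\<close>.\<close>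

theorem convex_affine_minorant:
  fixes g :: "'x::real_normed_vector \<Rightarrow> real"
  assumes g: "convex_on UNIV g" and M: "0 \<le> M" and a: "\<And>x. a \<le> g x + M * norm (x - x0)"
  shows "\<exists>y :: 'x \<Rightarrow>\<^sub>L real. \<forall>x. a + blinfun_apply y (x - x0) \<le> g x"
proof -
  define F where "F v t x = (g x - a + M * norm (x0 + t *\<^sub>R v - x)) / t" for v t x
  define p where "p v = (INF z\<in>{0<..} \<times> UNIV. F v (fst z) (snd z))" for v
  have F_lower: "- M * norm v \<le> F v t x" if "0 < t" for v t x
  proof -
    have "norm (x - x0) \<le> norm (x0 + t *\<^sub>R v - x) + t * norm v"
      using norm_triangle_ineq4[of "t *\<^sub>R v" "x0 + t *\<^sub>R v - x"] that by (simp add: algebra_simps)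
    then have "M * norm (x - x0) \<le> M * (norm (x0 + t *\<^sub>R v - x) + t * norm v)"
      using M by (rule mult_left_mono)
    then have "0 \<le> g x - a + M * norm (x0 + t *\<^sub>R v - x) + M * (t * norm v)"
      using a[of x] by (simp add: distrib_left)
    then show ?thesis using that by (simp add: F_def field_simps)
  qed
  have bdd: "bdd_below ((\<lambda>z. F v (fst z) (snd z)) ` ({0<..} \<times> UNIV))" for v
    using F_lower by (intro bdd_belowI2[where m = "- M * norm v"]) auto
  have lower: "p v \<le> F v t x" if "0 < t" for v t x
    unfolding p_def using cINF_lower[OF bdd, of "(t, x)" v] that by simp
  have greatest: "c \<le> p v" if "\<And>t x. 0 < t \<Longrightarrow> c \<le> F v t x" for c v
    unfolding p_def using that by (intro cINF_greatest) auto
  have "p (v + w) \<le> p v + p w" for v w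
  proof -
    have 1: "p (v + w) \<le> F v t x + F w s z" if ts: "0 < t" "0 < s" for t s x z
    proof -
      \<comment> \<open>Weights with \<open>b * t = c * s = r\<close>, so that the combination of
        \<open>x0 + t v\<close> and \<open>x0 + s w\<close> is
        \<open>x0 + r (v + w)\<close>.\<close>
      define b c where "b = s / (s + t)" and "c = t / (s + t)"
      have bc: "0 \<le> b" "0 \<le> c" "b + c = 1" using ts by (auto simp: b_def c_def add_divide_distrib[symmetric])
      define r where "r = s * t / (s + t)"
      have st: "s + t \<noteq> 0" using ts by simp
      have r: "0 < r" "b * t = r" "c * s = r" using ts by (simp_all add: r_def b_def c_def)
      have br: "b / r = 1 / t" "c / r = 1 / s"
        using ts st by (simp_all add: r_def b_def c_def divide_divide_eq_right divide_divide_eq_left)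
      let ?z = "b *\<^sub>R x + c *\<^sub>R z"
      have gz: "g ?z \<le> b * g x + c * g z"
        using g bc unfolding convex_on_def by auto
      have "x0 + r *\<^sub>R (v + w) - ?z = b *\<^sub>R (x0 + t *\<^sub>R v - x) + c *\<^sub>R (x0 + s *\<^sub>R w - z)"
      proof -
        have "b *\<^sub>R x0 + c *\<^sub>R x0 = x0" using bc by (simp add: scaleR_left_distrib[symmetric])
        then show ?thesis
          by (simp add: r(2,3) algebra_simps) 
      qed
      then have "norm (x0 + r *\<^sub>R (v + w) - ?z) \<le> b * norm (x0 + t *\<^sub>R v - x) + c * norm (x0 + s *\<^sub>R w - z)"
        using norm_triangle_ineq[of "b *\<^sub>R (x0 + t *\<^sub>R v - x)" "c *\<^sub>R (x0 + s *\<^sub>R w - z)"] bc by simp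
      then have "M * norm (x0 + r *\<^sub>R (v + w) - ?z) \<le> M * (b * norm (x0 + t *\<^sub>R v - x) + c * norm (x0 + s *\<^sub>R w - z))"
        using M by (rule mult_left_mono)
      moreover have "a = b * a + c * a" using bc by (simp add: distrib_right[symmetric])
      ultimately have "g ?z - a + M * norm (x0 + r *\<^sub>R (v + w) - ?z)
          \<le> b * (g x - a + M * norm (x0 + t *\<^sub>R v - x)) + c * (g z - a + M * norm (x0 + s *\<^sub>R w - z))"
        using gz by (simp add: algebra_simps)
      then have "F (v + w) r ?z
          \<le> (b * (g x - a + M * norm (x0 + t *\<^sub>R v - x)) + c * (g z - a + M * norm (x0 + s *\<^sub>R w - z))) / r"
        unfolding F_def using r(1) by (intro divide_right_mono) auto
      also have "\<dots> = b / r * (g x - a + M * norm (x0 + t *\<^sub>R v - x)) + c / r * (g z - a + M * norm (x0 + s *\<^sub>R w - z))"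
        by (simp add: add_divide_distrib)
      also have "\<dots> = F v t x + F w s z" by (simp add: br F_def)
      finally show ?thesis using lower[OF r(1), of "v + w" ?z] by linarith
    qed
    have "p (v + w) - F w s z \<le> p v" if "0 < s" for s z
      using 1[OF _ that] by (intro greatest) (simp add: algebra_simps)
    then have "p (v + w) - p v \<le> p w" by (intro greatest) (simp add: algebra_simps)
    then show ?thesis by simp
  qed
  moreover have "p (c *\<^sub>R v) \<le> c * p v" if c: "0 < c" for c v
  proof -
    have "p (c *\<^sub>R v) / c \<le> F v t x" if "0 < t" for t x
    proof -
      have "p (c *\<^sub>R v) \<le> F (c *\<^sub>R v) (t / c) x" using that c by (intro lower) simp
      also have "\<dots> = c * F v t x" using that c by (simp add: F_def)
      finally show ?thesis using c by (simp add: field_simps)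
    qed
    then have "p (c *\<^sub>R v) / c \<le> p v" by (rule greatest)
    then show ?thesis using c by (simp add: field_simps)
  qed
  ultimately have "sublinear p" by (simp add: sublinear_def)
  then obtain f where f: "linear f" "\<And>x. f x \<le> p x" using Hahn_Banach_sublinear by blast
  have p_le: "p v \<le> M * norm v" for v
  proof (rule field_le_epsilon)
    fix e :: real assume e: "0 < e"
    define t where "t = (\<bar>g x0 - a\<bar> + 1) / e"
    have t: "0 < t" using e by (simp add: t_def)
    have "p v \<le> F v t x0" by (rule lower[OF t])
    also have "\<dots> = (g x0 - a) / t + M * norm v" using t by (simp add: F_def field_simps)
    also have "(g x0 - a) / t \<le> (\<bar>g x0 - a\<bar> + 1) / t" using t by (intro divide_right_mono) auto
    also have "(\<bar>g x0 - a\<bar> + 1) / t = e" using e by (simp add: t_def)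
    finally show "p v \<le> M * norm v + e" by simp
  qed
  have "bounded_linear f"
  proof (rule bounded_linear_intro[where K = M])
    fix x
    show "norm (f x) \<le> norm x * M"
      using order_trans[OF f(2) p_le, of x] order_trans[OF f(2) p_le, of "- x"] linear_neg[OF f(1), of x]
      by (simp add: abs_le_iff mult.commute)
  qed (use f(1) in \<open>auto simp: linear_add linear_scale\<close>)
  then have app: "blinfun_apply (Blinfun f) = f" by (rule bounded_linear_Blinfun_apply)
  have "a + f (x - x0) \<le> g x" for x
    using order_trans[OF f(2) lower[of 1 "x - x0" x]] by (simp add: F_def)
  then show ?thesis by (intro exI[of _ "Blinfun f"]) (simp add: app)
qed

section \<open>Supporting affine functions of convex functions\<close>

lemma convex_secant_le:
  fixes g :: "'x::real_normed_vector \<Rightarrow> real"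
  assumes "convex_on UNIV g" "0 \<le> t" "t \<le> 1"
  shows "g ((1 - t) *\<^sub>R x + t *\<^sub>R y) \<le> (1 - t) * g x + t * g y"
  using assms unfolding convex_on_def by auto

text \<open>Lower semicontinuity gives \<open>g > a\<close> within distance \<open>d\<close> of
  \<open>x0\<close>. For a point farther away, the point of the segment at distance
  \<open>d / 2\<close> from \<open>x0\<close> still has value above \<open>a\<close>, and convexity
  turns this into a linear lower bound of slope \<open>M\<close>.\<close>

lemma lower_semicontinuous_minorant:
  fixes g :: "'x::real_normed_vector \<Rightarrow> real"
  assumes lsc: "lower_semicontinuous g" and g: "convex_on UNIV g" and a: "a < g x0"
  shows "\<exists>y :: 'x \<Rightarrow>\<^sub>L real. \<forall>x. a + blinfun_apply y (x - x0) \<le> g x"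
proof -
  have "open {x. a < g x}" using lsc by (simp add: lower_semicontinuous_def)
  then obtain d where d: "0 < d" "\<And>x. dist x0 x < d \<Longrightarrow> a < g x"
    using a unfolding open_contains_ball by (force simp: ball_def)
  define M where "M = 2 * (g x0 - a) / d"
  have M: "0 \<le> M" unfolding M_def using a d(1) by (intro divide_nonneg_pos) auto
  have "a \<le> g x + M * norm (x - x0)" for x
  proof (cases "dist x0 x < d")
    case True
    then show ?thesis using d(2)[OF True] M by (simp add: add_increasing2)
  next
    case False
    define n where "n = norm (x - x0)"
    have n: "d \<le> n" using False by (simp add: n_def dist_norm norm_minus_commute)
    define t where "t = d / (2 * n)"
    have t: "0 < t" "t \<le> 1" using d n by (auto simp: t_def divide_le_eq)
    let ?z = "(1 - t) *\<^sub>R x0 + t *\<^sub>R x"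
    have "x0 - ?z = (- t) *\<^sub>R (x - x0)" by (simp add: algebra_simps)
    then have "dist x0 ?z = t * n" using t by (simp add: dist_norm n_def)
    also have "\<dots> < d" using d n by (simp add: t_def)
    finally have "a < g ?z" by (rule d(2))
    also have "g ?z \<le> (1 - t) * g x0 + t * g x" using t by (intro convex_secant_le g) auto
    finally have "a - g x0 \<le> t * (g x - g x0)" by (simp add: algebra_simps)
    then have "(a - g x0) / t \<le> g x - g x0" using t by (simp add: field_simps)
    moreover have "(a - g x0) / t = - (M * n)" using d n by (simp add: t_def M_def field_simps)
    ultimately show ?thesis using a by (simp add: n_def)
  qed
  then show ?thesis using convex_affine_minorant[OF g M] by blast
qed

text \<open>Let \<open>z\<close> be the point at distance 1 from \<open>x0\<close> opposite to
  \<open>x\<close>. Then \<open>x0\<close> is a convex combination of \<open>x\<close> and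
  \<open>z\<close>, and the bound on the unit ball around \<open>x0\<close> gives the slope
  \<open>2 * B\<close> with no loss in the value at \<open>x0\<close>.\<close>

lemma bounded_convex_subgradient:
  fixes g :: "'x::real_normed_vector \<Rightarrow> real"
  assumes g: "convex_on UNIV g" and bdd: "\<And>A. bounded A \<Longrightarrow> bounded (g ` A)"
  shows "subdifferential g x0 \<noteq> {}"
proof -
  obtain B where "\<forall>y \<in> g ` cball x0 1. norm y \<le> B"
    using bdd[OF bounded_cball[of x0 1]] by (auto simp only: bounded_iff)
  then have B: "\<bar>g x\<bar> \<le> B" if "x \<in> cball x0 1" for x using that by auto
  have B0: "0 \<le> B" using B[of x0] by simp
  have "g x0 \<le> g x + (2 * B) * norm (x - x0)" for x
  proof (cases "x = x0")
    case False
    define n where "n = norm (x - x0)"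
    have n: "0 < n" using False by (simp add: n_def)
    define z where "z = x0 - (1 / n) *\<^sub>R (x - x0)"
    define t where "t = n / (1 + n)"
    have t: "0 \<le> t" "t \<le> 1" using n by (auto simp: t_def)
    have 1: "1 - t = 1 / (1 + n)" using n by (simp add: t_def field_simps)
    have "(1 - t) *\<^sub>R x + t *\<^sub>R z = x0"
    proof -
      have "t * (1 / n) = 1 - t" using n unfolding 1 by (simp add: t_def)
      then have "t *\<^sub>R z = t *\<^sub>R x0 - (1 - t) *\<^sub>R (x - x0)" by (simp add: z_def scaleR_diff_right)
      then show ?thesis by (simp add: algebra_simps)
    qed
    then have "g x0 \<le> (1 - t) * g x + t * g z" using convex_secant_le[OF g t, of x z] by simp
    then have "(1 + n) * g x0 \<le> (1 + n) * ((1 - t) * g x + t * g z)" using n by (intro mult_left_mono) auto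
    also have "\<dots> = g x + n * g z"
    proof -
      have "(1 + n) * (1 - t) = 1" "(1 + n) * t = n" using n by (auto simp: 1) (simp add: t_def)
      then show ?thesis by (simp only: distrib_left mult.assoc[symmetric] mult_1)
    qed
    finally have "g x0 \<le> g x + n * (g z - g x0)" by (simp add: algebra_simps)
    also have "\<dots> \<le> g x + n * (2 * B)"
    proof -
      have "z \<in> cball x0 1" using n by (simp add: z_def dist_norm n_def)
      then have "g z - g x0 \<le> 2 * B" using B[of z] B[of x0] by (simp add: abs_le_iff)
      then show ?thesis using n by (intro add_left_mono mult_left_mono) auto
    qed
    finally show ?thesis by (simp add: n_def mult.commute)
  qed simp
  then obtain y :: "'x \<Rightarrow>\<^sub>L real" where "\<forall>x. g x0 + blinfun_apply y (x - x0) \<le> g x"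
    using convex_affine_minorant[OF g, of "2 * B" "g x0" x0] B0 by auto
  then have "y \<in> subdifferential g x0" by (auto simp: subdifferential_def algebra_simps)
  then show ?thesis by blast
qed

section \<open>Continuity of linear \<open>\<sigma>\<close>-normal maps on measures\<close>

lemma apply_restrict_S: "\<phi> \<in> unit_ball_C \<Longrightarrow> apply_bmeas (restrict_S \<mu>) \<phi> = blinfun_apply \<mu> \<phi>"
  by (simp add: restrict_S.rep_eq)

lemma norm_bmeas_le:
  fixes f :: "'a::compact_metric_space bmeas"
  assumes "\<And>\<phi>. \<phi> \<in> unit_ball_C \<Longrightarrow> \<bar>apply_bmeas f \<phi>\<bar> \<le> c"
  shows "norm f \<le> c"
  unfolding norm_bmeas_def using assms by (intro cSUP_least) auto

lemma abs_apply_bmeas_le: "\<phi> \<in> unit_ball_C \<Longrightarrow> \<bar>apply_bmeas f \<phi>\<bar> \<le> norm f"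
  unfolding norm_bmeas_def by (rule cSUP_upper[OF _ bdd_above_bmeas])

lemma norm_restrict_S_le:
  assumes "\<mu> \<in> prob_measures"
  shows "norm (restrict_S \<mu>) \<le> 1"
  using prob_measures_abs_le[OF assms]
  by (intro norm_bmeas_le) (auto simp: apply_restrict_S simp del: mem_cball, auto intro: order_trans)

lemma linear_restrict_S: "linear restrict_S"
  by (intro linearI; transfer; auto simp: fun_eq_iff blinfun.add_left blinfun.scaleR_left)

lemma linear_tau: "linear \<theta> \<Longrightarrow> linear (tau \<theta>)"
  using linear_compose[OF linear_restrict_S] by (simp add: tau_def[abs_def] o_def)

text \<open>This makes \<open>onorm \<theta>\<close> meaningful. If \<theta> were unbounded,
  suitable multiples \<open>G n\<close> would have norm \<open>1 / (n + 1)\<close> and thus tend to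
  0 pointwise, while their images would have norm above \<open>n + 1\<close>.\<close>

lemma sigma_normal_bounded_linear:
  fixes \<theta> :: "'a::compact_metric_space bmeas \<Rightarrow> 'x::real_normed_vector"
  assumes lin: "linear \<theta>" and norm: "sigma_normal \<theta>"
  shows "bounded_linear \<theta>"
proof -
  have "\<exists>B. \<forall>f. norm (\<theta> f) \<le> norm f * B"
  proof (rule ccontr)
    assume "\<not> ?thesis"
    then have "\<forall>n::nat. \<exists>f. norm f * (real (Suc n))\<^sup>2 < norm (\<theta> f)" by (simp add: not_le)
    then obtain F where F: "\<And>n::nat. norm (F n) * (real (Suc n))\<^sup>2 < norm (\<theta> (F n))" by metis
    have F0: "norm (F n) > 0" for n
      using F[of n] linear_0[OF lin] by (cases "F n = 0") auto
    define G where "G n = (1 / (real (Suc n) * norm (F n))) *\<^sub>R F n" for n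
    have nG: "norm (G n) = 1 / real (Suc n)" for n using F0[of n] by (simp add: G_def)
    have "(\<lambda>n. \<theta> (G n)) \<longlonglongrightarrow> \<theta> 0"
    proof (rule norm[unfolded sigma_normal_def, rule_format], intro conjI ballI)
      show "bounded (range G)" by (auto simp: bounded_iff nG intro!: exI[of _ 1])
      fix \<phi> :: "'a cfun" assume \<phi>: "\<phi> \<in> unit_ball_C"
      have "(\<lambda>n. apply_bmeas (G n) \<phi>) \<longlonglongrightarrow> 0"
        by (rule Lim_null_comparison[OF _ lim_inverse_n'[THEN LIMSEQ_Suc]])
          (use abs_apply_bmeas_le[OF \<phi>, of "G _"] in \<open>simp add: nG\<close>)
      then show "(\<lambda>n. apply_bmeas (G n) \<phi>) \<longlonglongrightarrow> apply_bmeas 0 \<phi>" by (simp add: zero_bmeas.rep_eq)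
    qed
    then have "(\<lambda>n. norm (\<theta> (G n))) \<longlonglongrightarrow> 0" using linear_0[OF lin] by (auto intro: tendsto_norm_zero)
    then have "\<forall>\<^sub>F n in sequentially. norm (\<theta> (G n)) < 1" by (rule order_tendstoD) simp
    then obtain n where n: "norm (\<theta> (G n)) < 1" by (auto simp: eventually_sequentially)
    have "norm (\<theta> (G n)) = norm (\<theta> (F n)) / (real (Suc n) * norm (F n))"
      by (simp add: G_def linear_scale[OF lin] del: of_nat_Suc)
    also have "\<dots> > norm (F n) * (real (Suc n))\<^sup>2 / (real (Suc n) * norm (F n))"
      using F[of n] F0[of n] by (intro divide_strict_right_mono) auto
    also have "norm (F n) * (real (Suc n))\<^sup>2 / (real (Suc n) * norm (F n)) = real (Suc n)"
      using F0[of n] by (simp add: power2_eq_square del: of_nat_Suc)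
    finally show False using n by simp
  qed
  then obtain B where "\<And>f. norm (\<theta> f) \<le> norm f * B" by blast
  then show ?thesis using lin by (intro bounded_linear_intro) (auto simp: linear_add linear_scale)
qed

lemma norm_tau_le:
  assumes "linear \<theta>" "sigma_normal \<theta>" "\<mu> \<in> prob_measures"
  shows "norm (tau \<theta> \<mu>) \<le> onorm \<theta>"
proof -
  have bl: "bounded_linear \<theta>" by (rule sigma_normal_bounded_linear[OF assms(1,2)])
  have "norm (tau \<theta> \<mu>) \<le> onorm \<theta> * norm (restrict_S \<mu>)" unfolding tau_def by (rule onorm[OF bl])
  also have "\<dots> \<le> onorm \<theta> * 1" using norm_restrict_S_le[OF assms(3)] onorm_pos_le[OF bl] by (rule mult_left_mono)
  finally show ?thesis by simp
qed

text \<open>Weak-star convergence of measures is pointwise convergence of the restrictions to the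
  unit ball, a bounded sequence, so \<sigma>-normality yields convergence in norm.\<close>

lemma tau_tendsto:
  assumes "sigma_normal \<theta>" "\<And>n. \<mu>s n \<in> prob_measures"
    and lim: "\<And>\<phi>. (\<lambda>n. blinfun_apply (\<mu>s n) \<phi>) \<longlonglongrightarrow> blinfun_apply \<mu> \<phi>"
  shows "(\<lambda>n. tau \<theta> (\<mu>s n)) \<longlonglongrightarrow> tau \<theta> \<mu>"
  unfolding tau_def
proof (rule assms(1)[unfolded sigma_normal_def, rule_format], intro conjI ballI)
  show "bounded (range (\<lambda>n. restrict_S (\<mu>s n)))"
    using norm_restrict_S_le assms(2) by (auto simp: bounded_iff intro!: exI[of _ 1])
qed (use lim in \<open>simp add: apply_restrict_S del: mem_cball\<close>)

lemma tau_continuous_map: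
  "sigma_normal \<theta> \<Longrightarrow> continuous_map (subtopology weak_star prob_measures) euclidean (tau \<theta>)"
  by (intro continuous_map_prob_measures tau_tendsto)

section \<open>Dirac measures\<close>

definition dirac :: "(nat \<Rightarrow> 'a::compact_metric_space) \<Rightarrow> 'a cfun \<Rightarrow>\<^sub>L real" where
  "dirac \<sigma> = Blinfun (\<lambda>\<phi>. apply_bcontfun \<phi> \<sigma>)"

lemma dirac_apply [simp]: "blinfun_apply (dirac \<sigma>) \<phi> = apply_bcontfun \<phi> \<sigma>"
proof -
  have "bounded_linear (\<lambda>\<phi> :: 'a cfun. apply_bcontfun \<phi> \<sigma>)"
  proof (rule bounded_linear_intro[where K = 1])
    show "norm (apply_bcontfun \<phi> \<sigma>) \<le> norm \<phi> * 1" for \<phi> :: "'a cfun"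
      using norm_bounded[of \<phi> \<sigma>] by simp
  qed auto
  then show ?thesis by (simp add: dirac_def bounded_linear_Blinfun_apply)
qed

lemma dirac_prob: "dirac \<sigma> \<in> prob_measures"
  by (simp add: prob_measures_eq)

definition dirac_combination ::
    "nat \<Rightarrow> (nat \<Rightarrow> real) \<Rightarrow> (nat \<Rightarrow> nat \<Rightarrow> 'a::compact_metric_space) \<Rightarrow> 'a cfun \<Rightarrow>\<^sub>L real" where
  "dirac_combination n w x = (\<Sum>i<n. w i *\<^sub>R dirac (x i))"

lemma dirac_combination_apply:
  "blinfun_apply (dirac_combination n w x) \<phi> = (\<Sum>i<n. w i * apply_bcontfun \<phi> (x i))"
  by (simp add: dirac_combination_def blinfun.sum_left blinfun.scaleR_left)

lemma dirac_combination_prob: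
  assumes "\<And>i. 0 \<le> w i" "(\<Sum>i<n. w i) = 1"
  shows "dirac_combination n w x \<in> prob_measures"
  using assms by (simp add: prob_measures_eq dirac_combination_apply sum_nonneg)

text \<open>Weights and points are fixed before the test function: they come from a measurable
  partition into pieces of balls of radius \<open>d\<close>, and the test function enters through
  its oscillation at scale \<open>d\<close>.\<close>

lemma dirac_approximation:
  assumes M: "represents M (\<mu> :: 'a::compact_metric_space cfun \<Rightarrow>\<^sub>L real)" and d: "0 < d"
  shows "\<exists>n w x. (\<forall>i. 0 \<le> w i) \<and> (\<Sum>i<n. w i) = 1 \<and>
    (\<forall>\<phi> e. (\<forall>\<sigma> \<sigma>'. dist \<sigma> \<sigma>' < d \<longrightarrow> \<bar>apply_bcontfun \<phi> \<sigma> - apply_bcontfun \<phi> \<sigma>'\<bar> \<le> e) \<longrightarrow>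
       \<bar>blinfun_apply (dirac_combination n w x) \<phi> - blinfun_apply \<mu> \<phi>\<bar> \<le> e)"
proof -
  interpret prob_space M using M by (simp add: represents_def)
  have sM: "sets M = sets borel" using M by (simp add: represents_def)
  then have spM: "space M = UNIV" using sets_eq_imp_space_eq by fastforce
  obtain k where k: "finite k" "(UNIV :: (nat \<Rightarrow> 'a) set) \<subseteq> (\<Union>x\<in>k. ball x d)"
    using compact_UNIV[where 'a="nat \<Rightarrow> 'a"] d unfolding compact_eq_totally_bounded by blast
  obtain n and x :: "nat \<Rightarrow> nat \<Rightarrow> 'a" where kn: "k = x ` {i. i < n}"
    using finite_imp_nat_seg_image_inj_on[OF k(1)] by blast
  define A where "A = disjointed (\<lambda>i. ball (x i) d)"
  have A_sets: "A i \<in> sets M" for i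
    unfolding A_def sM by (rule sets.range_disjointed_sets'[THEN subsetD, OF _ rangeI]) auto
  have A_ball: "A i \<subseteq> ball (x i) d" for i unfolding A_def by (rule disjointed_subset)
  have A_disj: "disjoint_family A" unfolding A_def by (rule disjoint_family_disjointed)
  have A_UN: "(\<Union>i<n. A i) = UNIV"
  proof -
    have "(\<Union>i<n. A i) = (\<Union>i<n. ball (x i) d)"
      unfolding A_def using finite_UN_disjointed_eq[of "\<lambda>i. ball (x i) d" n] by (simp add: atLeast0LessThan)
    then show ?thesis using k(2) kn by auto
  qed
  define w where "w i = measure M (A i)" for i
  have w1: "(\<Sum>i<n. w i) = 1"
  proof -
    have "(\<Sum>i<n. w i) = measure M (\<Union>i<n. A i)"
      unfolding w_def using A_sets A_disj
      by (intro finite_measure_finite_Union[symmetric]) (auto simp: disjoint_family_on_def)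
    then show ?thesis using A_UN prob_space spM by simp
  qed
  show ?thesis
  proof (intro exI[of _ n] exI[of _ w] exI[of _ x] conjI allI impI)
    show "0 \<le> w i" for i by (simp add: w_def)
    fix \<phi> :: "'a cfun" and e
    assume osc: "\<forall>\<sigma> \<sigma>'. dist \<sigma> \<sigma>' < d \<longrightarrow> \<bar>apply_bcontfun \<phi> \<sigma> - apply_bcontfun \<phi> \<sigma>'\<bar> \<le> e"
    define s where "s \<sigma> = (\<Sum>i<n. apply_bcontfun \<phi> (x i) * indicator (A i) \<sigma>)" for \<sigma>
    have int_ind: "integrable M (\<lambda>\<sigma>. apply_bcontfun \<phi> (x i) * indicator (A i) \<sigma>)" for i
      using A_sets[of i] by (intro integrable_mult_right) (simp add: emeasure_eq_measure)
    have int_s: "integrable M s" unfolding s_def by (intro Bochner_Integration.integrable_sum int_ind)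
    have ip: "integrable M (apply_bcontfun \<phi>)"
      by (intro continuous_integrable finite_measure_axioms sM) simp
    have "(LINT \<sigma>|M. s \<sigma>) = (\<Sum>i<n. w i * apply_bcontfun \<phi> (x i))"
      unfolding s_def using A_sets spM
      by (subst Bochner_Integration.integral_sum[OF int_ind]) (simp add: w_def mult.commute)
    then have eq: "blinfun_apply (dirac_combination n w x) \<phi> - blinfun_apply \<mu> \<phi> = (LINT \<sigma>|M. s \<sigma> - apply_bcontfun \<phi> \<sigma>)"
      using M int_s ip by (simp add: dirac_combination_apply represents_def)
    have close: "\<bar>s \<sigma> - apply_bcontfun \<phi> \<sigma>\<bar> \<le> e" for \<sigma>
    proof -
      have "\<sigma> \<in> (\<Union>i<n. A i)" by (simp add: A_UN)
      then obtain i where i: "i < n" "\<sigma> \<in> A i" by blast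
      have "s \<sigma> = (\<Sum>j\<in>{i}. apply_bcontfun \<phi> (x j) * indicator (A j) \<sigma>)"
        unfolding s_def
      proof (rule sum.mono_neutral_right)
        show "\<forall>j\<in>{..<n} - {i}. apply_bcontfun \<phi> (x j) * indicator (A j) \<sigma> = 0"
          using A_disj i(2) by (auto simp: disjoint_family_on_def indicator_def)
      qed (use i in auto)
      then have "s \<sigma> = apply_bcontfun \<phi> (x i)" using i by simp
      then show ?thesis using osc[rule_format, of "x i" \<sigma>] A_ball[of i] i(2) by auto
    qed
    have "\<bar>LINT \<sigma>|M. s \<sigma> - apply_bcontfun \<phi> \<sigma>\<bar> \<le> (LINT \<sigma>|M. \<bar>s \<sigma> - apply_bcontfun \<phi> \<sigma>\<bar>)"
      by (rule integral_abs_bound)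
    also have "\<dots> \<le> (LINT \<sigma>|M. e)"
      using int_s ip close by (intro integral_mono) auto
    finally show "\<bar>blinfun_apply (dirac_combination n w x) \<phi> - blinfun_apply \<mu> \<phi>\<bar> \<le> e"
      unfolding eq by (simp add: prob_space)
  qed (rule w1)
qed

lemma dirac_dense:
  assumes "\<mu> \<in> prob_measures"
  shows "\<exists>n w x. (\<forall>k i. 0 \<le> w k i) \<and> (\<forall>k. (\<Sum>i<n k. w k i) = 1) \<and>
    (\<forall>\<phi>. (\<lambda>k. blinfun_apply (dirac_combination (n k) (w k) (x k)) \<phi>) \<longlonglongrightarrow> blinfun_apply \<mu> \<phi>)"
proof -
  obtain M where M: "represents M \<mu>" using assms by (auto simp: prob_measures_def)
  define good where "good k n w x \<longleftrightarrow> (\<forall>i. 0 \<le> w i) \<and> (\<Sum>i<n. w i) = 1 \<and>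
    (\<forall>\<phi> e. (\<forall>\<sigma> \<sigma>'. dist \<sigma> \<sigma>' < 1 / real (Suc k) \<longrightarrow> \<bar>apply_bcontfun \<phi> \<sigma> - apply_bcontfun \<phi> \<sigma>'\<bar> \<le> e) \<longrightarrow>
       \<bar>blinfun_apply (dirac_combination n w x) \<phi> - blinfun_apply \<mu> \<phi>\<bar> \<le> e)"
    for k n and w :: "nat \<Rightarrow> real" and x :: "nat \<Rightarrow> nat \<Rightarrow> 'a"
  have "\<exists>n w x. good k n w x" for k
  proof -
    have "0 < 1 / real (Suc k)" by simp
    from dirac_approximation[OF M this] show ?thesis unfolding good_def .
  qed
  then obtain n w x where g: "\<And>k. good k (n k) (w k) (x k)" by metis
  show ?thesis
  proof (intro exI[of _ n] exI[of _ w] exI[of _ x] conjI allI)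
    fix \<phi> :: "'a cfun"
    have uc: "uniformly_continuous_on UNIV (apply_bcontfun \<phi>)"
      by (rule compact_uniformly_continuous[OF continuous_on_apply_bcontfun compact_UNIV])
    show "(\<lambda>k. blinfun_apply (dirac_combination (n k) (w k) (x k)) \<phi>) \<longlonglongrightarrow> blinfun_apply \<mu> \<phi>"
    proof (rule LIMSEQ_I)
      fix e :: real assume e: "0 < e"
      obtain d where "0 < d" and
        d': "\<forall>\<sigma>\<in>UNIV. \<forall>\<sigma>'\<in>UNIV. dist \<sigma>' \<sigma> < d \<longrightarrow> dist (apply_bcontfun \<phi> \<sigma>') (apply_bcontfun \<phi> \<sigma>) < e / 2"
        using uc[unfolded uniformly_continuous_on_def, rule_format, OF half_gt_zero[OF e]] by blast
      note d = this(1) d'[rule_format, OF UNIV_I UNIV_I]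
      obtain k0 where k0: "1 / real (Suc k0) < d" by (rule nat_approx_posE[OF d(1)])
      have "\<bar>blinfun_apply (dirac_combination (n k) (w k) (x k)) \<phi> - blinfun_apply \<mu> \<phi>\<bar> \<le> e / 2" if k: "k0 \<le> k" for k
      proof -
        have "1 / real (Suc k) \<le> 1 / real (Suc k0)" using k by (intro divide_left_mono) auto
        then have "\<bar>apply_bcontfun \<phi> \<sigma> - apply_bcontfun \<phi> \<sigma>'\<bar> \<le> e / 2" if "dist \<sigma> \<sigma>' < 1 / real (Suc k)" for \<sigma> \<sigma>'
          using d(2)[of \<sigma> \<sigma>'] that k0 by (simp add: dist_real_def dist_commute abs_minus_commute)
        moreover have "(\<forall>\<sigma> \<sigma>'. dist \<sigma> \<sigma>' < 1 / real (Suc k) \<longrightarrow> \<bar>apply_bcontfun \<phi> \<sigma> - apply_bcontfun \<phi> \<sigma>'\<bar> \<le> e / 2) \<longrightarrow>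
            \<bar>blinfun_apply (dirac_combination (n k) (w k) (x k)) \<phi> - blinfun_apply \<mu> \<phi>\<bar> \<le> e / 2"
          using g[of k] unfolding good_def by (elim conjE allE)
        ultimately show ?thesis by blast
      qed
      then show "\<exists>k0. \<forall>k\<ge>k0. norm (blinfun_apply (dirac_combination (n k) (w k) (x k)) \<phi> - blinfun_apply \<mu> \<phi>) < e"
        using e unfolding real_norm_def
        by (intro exI[of _ k0] allI impI) (rule le_less_trans[of _ "e / 2"], simp_all)
    qed
  qed (use g in \<open>auto simp: good_def\<close>)
qed

text \<open>The potential is found by evaluation at Dirac measures. Linearity gives the identity for
  finite combinations, and density of these together with \<open>tau_tendsto\<close> extends
  it.\<close>

lemma tau_representation:
  fixes \<theta> :: "'a::compact_metric_space bmeas \<Rightarrow> 'x::real_normed_vector" and y :: "'x \<Rightarrow>\<^sub>L real"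
  assumes lin: "linear \<theta>" and nrm: "sigma_normal \<theta>"
  shows "\<exists>\<Phi> :: 'a cfun. \<forall>\<mu>\<in>prob_measures. blinfun_apply y (tau \<theta> \<mu>) = blinfun_apply \<mu> \<Phi>"
proof -
  define F where "F \<sigma> = blinfun_apply y (tau \<theta> (dirac \<sigma>))" for \<sigma>
  have "continuous_on UNIV F"
  proof (rule continuous_on_sequentiallyI)
    fix s :: "nat \<Rightarrow> nat \<Rightarrow> 'a" and l assume s: "s \<longlonglongrightarrow> l"
    have "(\<lambda>n. tau \<theta> (dirac (s n))) \<longlonglongrightarrow> tau \<theta> (dirac l)"
    proof (rule tau_tendsto[OF nrm dirac_prob])
      show "(\<lambda>n. blinfun_apply (dirac (s n)) \<phi>) \<longlonglongrightarrow> blinfun_apply (dirac l) \<phi>" for \<phi>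
        using continuous_on_tendsto_compose[OF continuous_on_apply_bcontfun[of UNIV \<phi>] s] by simp
    qed
    then show "(\<lambda>n. F (s n)) \<longlonglongrightarrow> F l" unfolding F_def by (intro tendsto_intros)
  qed
  then have F: "apply_bcontfun (Bcontfun F) = F" by (rule apply_Bcontfun)
  have "blinfun_apply y (tau \<theta> \<mu>) = blinfun_apply \<mu> (Bcontfun F)" if \<mu>: "\<mu> \<in> prob_measures" for \<mu>
  proof -
    obtain n w x where "(\<forall>k i. 0 \<le> w k i) \<and> (\<forall>k. (\<Sum>i<n k. w k i) = 1) \<and>
      (\<forall>\<phi>. (\<lambda>k. blinfun_apply (dirac_combination (n k) (w k) (x k)) \<phi>) \<longlonglongrightarrow> blinfun_apply \<mu> \<phi>)"
      using dirac_dense[OF \<mu>] by blast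
    then have *: "\<And>k i. 0 \<le> w k i" "\<And>k. (\<Sum>i<n k. w k i) = 1"
      "\<And>\<phi>. (\<lambda>k. blinfun_apply (dirac_combination (n k) (w k) (x k)) \<phi>) \<longlonglongrightarrow> blinfun_apply \<mu> \<phi>"
      by simp_all
    have "blinfun_apply y (tau \<theta> (dirac_combination n w x)) = blinfun_apply (dirac_combination n w x) (Bcontfun F)"
      for n w and x :: "nat \<Rightarrow> nat \<Rightarrow> 'a"
      using linear_tau[OF lin]
      by (simp add: F F_def dirac_combination_def linear_sum linear_scale
          blinfun.sum_right blinfun.scaleR_right blinfun.sum_left blinfun.scaleR_left)
    moreover have "(\<lambda>k. blinfun_apply y (tau \<theta> (dirac_combination (n k) (w k) (x k)))) \<longlonglongrightarrow> blinfun_apply y (tau \<theta> \<mu>)"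
      by (intro tendsto_intros tau_tendsto[OF nrm dirac_combination_prob] *)
    ultimately show ?thesis using LIMSEQ_unique[OF _ *(3)[of "Bcontfun F"]] by simp
  qed
  then show ?thesis by blast
qed

text \<open>Dirac measures show uniqueness, so the definite description in \<open>Theta\<close>
  denotes.\<close>

lemma Theta_apply:
  assumes lin: "linear \<theta>m" "linear \<theta>p" and nrm: "sigma_normal \<theta>m" "sigma_normal \<theta>p"
    and \<mu>: "\<mu> \<in> prob_measures"
  shows "blinfun_apply \<mu> (Theta \<theta>m \<theta>p ym yp) = blinfun_apply yp (tau \<theta>p \<mu>) - blinfun_apply ym (tau \<theta>m \<mu>)"
proof -
  obtain \<Phi>m where m: "\<forall>\<mu>\<in>prob_measures. blinfun_apply ym (tau \<theta>m \<mu>) = blinfun_apply \<mu> \<Phi>m"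
    using tau_representation[OF lin(1) nrm(1)] by blast
  obtain \<Phi>p where p: "\<forall>\<mu>\<in>prob_measures. blinfun_apply yp (tau \<theta>p \<mu>) = blinfun_apply \<mu> \<Phi>p"
    using tau_representation[OF lin(2) nrm(2)] by blast
  have "\<forall>\<mu>\<in>prob_measures. blinfun_apply yp (\<theta>p (restrict_S \<mu>)) - blinfun_apply ym (\<theta>m (restrict_S \<mu>))
      = blinfun_apply \<mu> (Theta \<theta>m \<theta>p ym yp)"
    unfolding Theta_def
  proof (rule theI[where a = "\<Phi>p - \<Phi>m"])
    show "\<forall>\<mu>\<in>prob_measures. blinfun_apply yp (\<theta>p (restrict_S \<mu>)) - blinfun_apply ym (\<theta>m (restrict_S \<mu>))
        = blinfun_apply \<mu> (\<Phi>p - \<Phi>m)"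
      using m p by (simp add: tau_def blinfun.diff_right)
    fix \<Phi>
    assume \<Phi>: "\<forall>\<mu>\<in>prob_measures. blinfun_apply yp (\<theta>p (restrict_S \<mu>)) - blinfun_apply ym (\<theta>m (restrict_S \<mu>))
        = blinfun_apply \<mu> \<Phi>"
    show "\<Phi> = \<Phi>p - \<Phi>m"
    proof (rule bcontfun_eqI)
      fix \<sigma>
      have "blinfun_apply (dirac \<sigma>) \<Phi> = blinfun_apply (dirac \<sigma>) (\<Phi>p - \<Phi>m)"
        using \<Phi>[rule_format, OF dirac_prob[of \<sigma>]] m[rule_format, OF dirac_prob[of \<sigma>]]
          p[rule_format, OF dirac_prob[of \<sigma>]] by (simp add: tau_def blinfun.diff_right)
      then show "apply_bcontfun \<Phi> \<sigma> = apply_bcontfun (\<Phi>p - \<Phi>m) \<sigma>" by simp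
    qed
  qed
  with \<mu> show ?thesis by (simp add: tau_def)
qed

section \<open>Topological and convex preliminaries\<close>

text \<open>Joint continuity for the weak-star topology in the functional and the norm topology in
  the vector. The norm bound \<open>R\<close> controls the change of the vector uniformly over the
  functionals.\<close>

lemma evaluation_continuous:
  "continuous_map (prod_topology (subtopology weak_star (cball (0 :: 'x::real_normed_vector \<Rightarrow>\<^sub>L real) R)) euclidean)
     euclidean (\<lambda>z. blinfun_apply (fst z) (snd z))"
  (is "continuous_map ?Z _ _")
  unfolding continuous_map_atin
proof
  fix z :: "('x \<Rightarrow>\<^sub>L real) \<times> 'x"
  assume z: "z \<in> topspace ?Z"
  have fst_cont: "continuous_map ?Z euclidean (\<lambda>u. blinfun_apply (fst u) (snd z))"
    by (intro continuous_map_compose[OF continuous_map_fst, unfolded o_def]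
        continuous_map_from_subtopology weak_star_apply_continuous)
  have snd_cont: "continuous_map ?Z euclidean (\<lambda>u. R * norm (snd u - snd z))"
    using continuous_map_compose[OF continuous_map_snd, of euclidean euclidean "\<lambda>x. R * norm (x - snd z)"
        "subtopology weak_star (cball 0 R)"]
    by (simp add: o_def continuous_intros)
  have 1: "((\<lambda>u. blinfun_apply (fst u) (snd z)) \<longlongrightarrow> blinfun_apply (fst z) (snd z)) (atin ?Z z)"
    using fst_cont[unfolded continuous_map_atin, rule_format, OF z] by simp
  have 2: "((\<lambda>u. R * norm (snd u - snd z)) \<longlongrightarrow> 0) (atin ?Z z)"
    using snd_cont[unfolded continuous_map_atin, rule_format, OF z] by simp
  have "\<forall>\<^sub>F u in atin ?Z z. norm (blinfun_apply (fst u) (snd u - snd z)) \<le> R * norm (snd u - snd z)"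
    unfolding eventually_atin
  proof (intro disjI2 exI conjI ballI)
    show "openin ?Z (topspace ?Z)" by (rule openin_topspace)
    fix u assume "u \<in> topspace ?Z - {z}"
    then have "norm (fst u) \<le> R" by (cases u) auto
    then show "norm (blinfun_apply (fst u) (snd u - snd z)) \<le> R * norm (snd u - snd z)"
      using norm_blinfun[of "fst u" "snd u - snd z"] mult_right_mono[of "norm (fst u)" R "norm (snd u - snd z)"]
      by simp
  qed (use z in auto)
  from Lim_null_comparison[OF this 2]
  have "((\<lambda>u. blinfun_apply (fst u) (snd z) + blinfun_apply (fst u) (snd u - snd z)) \<longlongrightarrow> blinfun_apply (fst z) (snd z) + 0) (atin ?Z z)"
    by (intro tendsto_add 1)
  then show "limitin euclidean (\<lambda>u. blinfun_apply (fst u) (snd u)) (blinfun_apply (fst z) (snd z)) (atin ?Z z)"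
    by (simp add: blinfun.diff_right)
qed

text \<open>The sublevel sets at attained values have the finite intersection property, and a common
  point is a minimizer.\<close>

lemma compactin_attains_inf:
  fixes f :: "'z \<Rightarrow> real"
  assumes S: "compactin X S" "S \<noteq> {}" and cl: "\<And>c. closedin X {x \<in> S. f x \<le> c}"
  shows "\<exists>x\<in>S. \<forall>y\<in>S. f x \<le> f y"
proof -
  have "S \<inter> \<Inter> ((\<lambda>y. {x \<in> S. f x \<le> f y}) ` S) \<noteq> {}"
  proof (rule compactin_fip[THEN iffD1, OF S(1), THEN conjunct2, rule_format], intro conjI ballI allI impI)
    fix \<F> assume F: "finite \<F> \<and> \<F> \<subseteq> (\<lambda>y. {x \<in> S. f x \<le> f y}) ` S"
    then obtain Y where Y: "finite Y" "Y \<subseteq> S" "\<F> = (\<lambda>y. {x \<in> S. f x \<le> f y}) ` Y"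
      by (meson finite_subset_image)
    show "S \<inter> \<Inter>\<F> \<noteq> {}"
    proof (cases "Y = {}")
      case False
      define y where "y = arg_min_on f Y"
      have "y \<in> Y" "\<And>x. x \<in> Y \<Longrightarrow> f y \<le> f x"
        unfolding y_def using arg_min_if_finite(1)[OF Y(1) False] arg_min_least[OF Y(1) False] by auto
      then show ?thesis using Y by auto
    qed (use S Y in auto)
  qed (use cl in auto)
  then show ?thesis by blast
qed

lemma minimal_linear_growthD:
  assumes "minimal_linear_growth f c"
  shows "\<exists>R. \<forall>y. f y \<le> ereal (c * norm y + b) \<longrightarrow> norm y \<le> R"
proof -
  have "\<forall>\<^sub>F R in at_top. (SUP y\<in>- cball 0 R. ereal (c * norm y) - f y) < ereal (- b)"
    using assms unfolding minimal_linear_growth_def by (rule order_tendstoD) simp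
  then obtain R where R: "(SUP y\<in>- cball 0 R. ereal (c * norm y) - f y) < ereal (- b)"
    using eventually_happens'[OF trivial_limit_at_top_linorder] by blast
  have "norm y \<le> R" if "f y \<le> ereal (c * norm y + b)" for y
  proof (rule ccontr)
    assume "\<not> norm y \<le> R"
    then have "y \<in> - cball 0 R" by simp
    then have "ereal (c * norm y) - f y \<le> (SUP y\<in>- cball 0 R. ereal (c * norm y) - f y)"
      by (rule SUP_upper)
    with R have "ereal (c * norm y) - f y < ereal (- b)" by (rule le_less_trans[rotated])
    moreover have "ereal (- b) \<le> ereal (c * norm y) - f y"
      using that by (cases "f y") auto
    ultimately show False by (simp add: not_le[symmetric])
  qed
  then show ?thesis by blast
qed

lemma conjugate_ge: "ereal (blinfun_apply y x - g x) \<le> conjugate g y"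
  unfolding conjugate_def by (rule SUP_upper) simp

lemma conjugate_le: "(\<And>x. blinfun_apply y x - g x \<le> c) \<Longrightarrow> conjugate g y \<le> ereal c"
  unfolding conjugate_def by (rule SUP_least) simp

lemma gateaux_subdifferential_unique:
  assumes "gateaux_differentiable g" "y \<in> subdifferential g x" "z \<in> subdifferential g x"
  shows "y = z"
proof -
  obtain D :: "'a \<Rightarrow>\<^sub>L real" where D: "\<And>v. ((\<lambda>t. (g (x + t *\<^sub>R v) - g x) / t) \<longlongrightarrow> blinfun_apply D v) (at 0)"
    using assms(1)[unfolded gateaux_differentiable_def, rule_format, of x] by blast
  have "y = D" if y: "y \<in> subdifferential g x" for y
  proof -
    have le: "blinfun_apply y v \<le> blinfun_apply D v" for v
    proof (rule tendsto_lowerbound)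
      show "((\<lambda>t. (g (x + t *\<^sub>R v) - g x) / t) \<longlongrightarrow> blinfun_apply D v) (at_right 0)"
        by (rule filterlim_mono[OF D order_refl at_le]) simp
      have "blinfun_apply y v \<le> (g (x + t *\<^sub>R v) - g x) / t" if "0 < t" for t
      proof -
        have "blinfun_apply y (x + t *\<^sub>R v - x) \<le> g (x + t *\<^sub>R v) - g x"
          using y by (simp only: subdifferential_def mem_Collect_eq)
        then show ?thesis using that by (simp add: blinfun.scaleR_right field_simps)
      qed
      then show "\<forall>\<^sub>F t in at_right 0. blinfun_apply y v \<le> (g (x + t *\<^sub>R v) - g x) / t"
        by (auto simp: eventually_at_filter)
    qed simp
    show ?thesis
    proof (rule blinfun_eqI)
      fix v
      show "blinfun_apply y v = blinfun_apply D v"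
        using le[of v] le[of "- v"] by (simp add: blinfun.minus_right)
    qed
  qed
  then show ?thesis using assms(2,3) by blast
qed

section \<open>The variational problem\<close>

text \<open>The assumption \<open>equilibrium\<close> is what \<open>holder_equilibrium\<close>
  delivers for the potential \<open>Theta\<close>; the convex analysis that follows needs no
  regularity beyond it.\<close>

locale variational =
  fixes m :: "'a::compact_metric_space measure"
    and \<theta>m :: "'a bmeas \<Rightarrow> 'x::real_normed_vector"
    and \<theta>p :: "'a bmeas \<Rightarrow> 'y::real_normed_vector"
    and gm :: "'x \<Rightarrow> real"
    and gp :: "'y \<Rightarrow> real"
  assumes lin: "linear \<theta>m" "linear \<theta>p"
    and normal: "sigma_normal \<theta>m" "sigma_normal \<theta>p"
    and equilibrium: "\<And>ym yp. \<exists>\<nu>\<in>erg_measures. \<exists>p :: real.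
      entropy m \<nu> = ereal (p - blinfun_apply \<nu> (Theta \<theta>m \<theta>p ym yp)) \<and>
      (\<forall>\<mu>\<in>prob_measures. entropy m \<mu> \<le> ereal (p - blinfun_apply \<mu> (Theta \<theta>m \<theta>p ym yp))) \<and>
      (\<forall>\<mu>\<in>prob_measures. ereal (p - blinfun_apply \<mu> (Theta \<theta>m \<theta>p ym yp)) \<le> entropy m \<mu> \<longrightarrow> \<mu> = \<nu>)"
    and gm: "lower_semicontinuous gm" "convex_on UNIV gm"
    and gm_growth: "minimal_linear_growth (conjugate gm) (onorm \<theta>m)"
    and gp: "convex_on UNIV gp"
    and gp_bdd: "\<And>A. bounded A \<Longrightarrow> bounded (gp ` A)"
    and gp_conj: "\<And>y. \<bar>conjugate gp y\<bar> \<noteq> \<infinity>"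
    and gp_growth: "minimal_linear_growth (conjugate gp) (onorm \<theta>p)"
begin

abbreviation \<tau>m :: "('a cfun \<Rightarrow>\<^sub>L real) \<Rightarrow> 'x" where "\<tau>m \<equiv> tau \<theta>m"
abbreviation \<tau>p :: "('a cfun \<Rightarrow>\<^sub>L real) \<Rightarrow> 'y" where "\<tau>p \<equiv> tau \<theta>p"
abbreviation "pressure \<equiv> pressure_functional m \<theta>m \<theta>p gm gp"
abbreviation "Mflat \<equiv> M_flat m \<theta>m \<theta>p gm gp"
abbreviation "MP \<equiv> M_P m \<theta>m \<theta>p gm gp"
abbreviation "EP \<equiv> E_P m \<theta>m \<theta>p gm gp"

section \<open>The linear problem for a pair of functionals\<close>

definition lin_part :: "('y \<Rightarrow>\<^sub>L real) \<Rightarrow> ('x \<Rightarrow>\<^sub>L real) \<Rightarrow> ('a cfun \<Rightarrow>\<^sub>L real) \<Rightarrow> real" where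
  "lin_part yp ym \<mu> = blinfun_apply yp (\<tau>p \<mu>) - blinfun_apply ym (\<tau>m \<mu>)"

definition is_equilibrium :: "('y \<Rightarrow>\<^sub>L real) \<Rightarrow> ('x \<Rightarrow>\<^sub>L real) \<Rightarrow> ('a cfun \<Rightarrow>\<^sub>L real) \<Rightarrow> real \<Rightarrow> bool" where
  "is_equilibrium yp ym \<nu> p \<longleftrightarrow> \<nu> \<in> erg_measures \<and> entropy m \<nu> = ereal (p - lin_part yp ym \<nu>) \<and>
    (\<forall>\<mu>\<in>prob_measures. entropy m \<mu> \<le> ereal (p - lin_part yp ym \<mu>)) \<and>
    (\<forall>\<mu>\<in>prob_measures. ereal (p - lin_part yp ym \<mu>) \<le> entropy m \<mu> \<longrightarrow> \<mu> = \<nu>)"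

lemma erg_inv: "\<mu> \<in> erg_measures \<Longrightarrow> \<mu> \<in> inv_measures"
  by (simp add: erg_measures_def extreme_point_of_def)

lemma inv_prob: "\<mu> \<in> inv_measures \<Longrightarrow> \<mu> \<in> prob_measures"
  using inv_measures_subset by auto

lemma ex_equilibrium: "\<exists>z. is_equilibrium yp ym (fst z) (snd z)"
proof -
  have Theta: "\<mu> \<in> prob_measures \<Longrightarrow> blinfun_apply \<mu> (Theta \<theta>m \<theta>p ym yp) = lin_part yp ym \<mu>" for \<mu>
    unfolding lin_part_def by (rule Theta_apply[OF lin normal])
  obtain \<nu> p where "\<nu> \<in> erg_measures"
    "entropy m \<nu> = ereal (p - blinfun_apply \<nu> (Theta \<theta>m \<theta>p ym yp))"
    "\<forall>\<mu>\<in>prob_measures. entropy m \<mu> \<le> ereal (p - blinfun_apply \<mu> (Theta \<theta>m \<theta>p ym yp))"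
    "\<forall>\<mu>\<in>prob_measures. ereal (p - blinfun_apply \<mu> (Theta \<theta>m \<theta>p ym yp)) \<le> entropy m \<mu> \<longrightarrow> \<mu> = \<nu>"
    using equilibrium[of ym yp] by blast
  then have "is_equilibrium yp ym \<nu> p"
    using Theta Theta[OF inv_prob[OF erg_inv], of \<nu>] by (simp add: is_equilibrium_def)
  then show ?thesis by (intro exI[of _ "(\<nu>, p)"]) simp
qed

definition eqm :: "('y \<Rightarrow>\<^sub>L real) \<Rightarrow> ('x \<Rightarrow>\<^sub>L real) \<Rightarrow> 'a cfun \<Rightarrow>\<^sub>L real" where
  "eqm yp ym = fst (SOME z. is_equilibrium yp ym (fst z) (snd z))"

definition pr :: "('y \<Rightarrow>\<^sub>L real) \<Rightarrow> ('x \<Rightarrow>\<^sub>L real) \<Rightarrow> real" where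
  "pr yp ym = snd (SOME z. is_equilibrium yp ym (fst z) (snd z))"

lemma eqm: "is_equilibrium yp ym (eqm yp ym) (pr yp ym)"
  unfolding eqm_def pr_def using someI_ex[OF ex_equilibrium] .

lemma eqm_erg: "eqm yp ym \<in> erg_measures"
  and entropy_eqm: "entropy m (eqm yp ym) = ereal (pr yp ym - lin_part yp ym (eqm yp ym))"
  and entropy_le_pr: "\<mu> \<in> prob_measures \<Longrightarrow> entropy m \<mu> \<le> ereal (pr yp ym - lin_part yp ym \<mu>)"
  and eqm_unique: "\<mu> \<in> prob_measures \<Longrightarrow> ereal (pr yp ym - lin_part yp ym \<mu>) \<le> entropy m \<mu> \<Longrightarrow> \<mu> = eqm yp ym"
  using eqm[of yp ym] unfolding is_equilibrium_def by blast+

lemma eqm_inv: "eqm yp ym \<in> inv_measures"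
  by (rule erg_inv[OF eqm_erg])

lemma eqm_prob: "eqm yp ym \<in> prob_measures"
  by (rule inv_prob[OF eqm_inv])

lemma lin_functional_eq: "lin_functional m \<theta>m \<theta>p yp ym \<mu> = entropy m \<mu> + ereal (lin_part yp ym \<mu>)"
  by (cases "entropy m \<mu>") (simp_all add: lin_functional_def lin_part_def tau_def)

lemma P_L_eq: "P_L m \<theta>m \<theta>p yp ym = ereal (pr yp ym)"
  unfolding P_L_def
proof (rule antisym)
  show "Sup (lin_functional m \<theta>m \<theta>p yp ym ` inv_measures) \<le> ereal (pr yp ym)"
  proof (rule SUP_least)
    fix \<mu> :: "'a cfun \<Rightarrow>\<^sub>L real" assume "\<mu> \<in> inv_measures"
    then show "lin_functional m \<theta>m \<theta>p yp ym \<mu> \<le> ereal (pr yp ym)"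
      using entropy_le_pr[OF inv_prob, of \<mu> yp ym]
      by (cases "entropy m \<mu>") (simp_all add: lin_functional_eq)
  qed
  have "lin_functional m \<theta>m \<theta>p yp ym (eqm yp ym) = ereal (pr yp ym)"
    by (simp add: lin_functional_eq entropy_eqm)
  then show "ereal (pr yp ym) \<le> Sup (lin_functional m \<theta>m \<theta>p yp ym ` inv_measures)"
    using SUP_upper[OF eqm_inv, of "lin_functional m \<theta>m \<theta>p yp ym" yp ym] by simp
qed

lemma E_L_eq: "E_L m \<theta>m \<theta>p yp ym = {eqm yp ym}"
proof -
  have "\<mu> = eqm yp ym" if "\<mu> \<in> inv_measures" "entropy m \<mu> + ereal (lin_part yp ym \<mu>) = ereal (pr yp ym)" for \<mu>
    using that by (intro eqm_unique inv_prob) (cases "entropy m \<mu>"; auto)+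
  then show ?thesis
    by (auto simp: E_L_def P_L_eq lin_functional_eq entropy_eqm eqm_inv)
qed

lemma abs_\<tau>m_le: "\<mu> \<in> prob_measures \<Longrightarrow> \<bar>blinfun_apply z (\<tau>m \<mu>)\<bar> \<le> onorm \<theta>m * norm z"
  using order_trans[OF norm_blinfun[of z "\<tau>m \<mu>"] mult_left_mono[OF norm_tau_le[OF lin(1) normal(1)]]]
  by (simp add: mult.commute)

lemma abs_\<tau>p_le: "\<mu> \<in> prob_measures \<Longrightarrow> \<bar>blinfun_apply z (\<tau>p \<mu>)\<bar> \<le> onorm \<theta>p * norm z"
  using order_trans[OF norm_blinfun[of z "\<tau>p \<mu>"] mult_left_mono[OF norm_tau_le[OF lin(2) normal(2)]]]
  by (simp add: mult.commute)

section \<open>Conjugates and minimization over the minus variable\<close>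

definition fin :: "('x \<Rightarrow>\<^sub>L real) \<Rightarrow> bool" where
  "fin z \<longleftrightarrow> conjugate gm z < \<infinity>"

definition gms :: "('x \<Rightarrow>\<^sub>L real) \<Rightarrow> real" where
  "gms z = real_of_ereal (conjugate gm z)"

definition gps :: "('y \<Rightarrow>\<^sub>L real) \<Rightarrow> real" where
  "gps y = real_of_ereal (conjugate gp y)"

lemma conjugate_gm: "fin z \<Longrightarrow> conjugate gm z = ereal (gms z)"
  using conjugate_ge[of z 0 gm] unfolding fin_def gms_def by (cases "conjugate gm z") auto

lemma conjugate_gp: "conjugate gp y = ereal (gps y)"
  using gp_conj[of y] unfolding gps_def by (cases "conjugate gp y") auto

lemma young_m: "fin z \<Longrightarrow> blinfun_apply z x - gm x \<le> gms z"
  using conjugate_ge[of z x gm] by (simp add: conjugate_gm)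

lemma young_p: "blinfun_apply y x - gp x \<le> gps y"
  using conjugate_ge[of y x gp] by (simp add: conjugate_gp)

lemma gms_le:
  assumes "\<And>x. blinfun_apply z x - gm x \<le> c"
  shows "fin z" "gms z \<le> c"
proof -
  have le: "conjugate gm z \<le> ereal c" by (rule conjugate_le[OF assms])
  then show fin: "fin z" unfolding fin_def by (rule le_less_trans) simp
  show "gms z \<le> c" using le by (simp add: conjugate_gm[OF fin])
qed

lemma gps_le: "(\<And>x. blinfun_apply y x - gp x \<le> c) \<Longrightarrow> gps y \<le> c"
  using conjugate_le[of y gp c] by (simp add: conjugate_gp)

text \<open>The Fenchel-Moreau theorem at a point in approximate form: values
  \<open>z x0 - gms z\<close> come arbitrarily close to \<open>gm x0\<close>.\<close>

lemma minorant_m: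
  assumes "a < gm x0"
  obtains z where "fin z" "gms z \<le> blinfun_apply z x0 - a"
proof -
  obtain z :: "'x \<Rightarrow>\<^sub>L real" where "\<forall>x. a + blinfun_apply z (x - x0) \<le> gm x"
    using lower_semicontinuous_minorant[OF gm assms] by blast
  then have *: "blinfun_apply z x - gm x \<le> blinfun_apply z x0 - a" for x
    by (simp add: blinfun.diff_right algebra_simps)
  show ?thesis using that[OF gms_le[OF *]] .
qed

lemma ex_fin: "\<exists>z. fin z"
  using minorant_m[of "gm 0 - 1" 0] by auto

lemma subgradient_p:
  obtains y where "y \<in> subdifferential gp x" "gps y = blinfun_apply y x - gp x"
proof -
  obtain y where y: "y \<in> subdifferential gp x" using bounded_convex_subgradient[OF gp gp_bdd] by blast
  have "gps y \<le> blinfun_apply y x - gp x"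
    using y by (intro gps_le) (simp add: subdifferential_def blinfun.diff_right algebra_simps)
  with y young_p[of y x] that show ?thesis by force
qed

lemma subdifferential_p:
  assumes "gps y \<le> blinfun_apply y x - gp x"
  shows "y \<in> subdifferential gp x"
proof -
  have "blinfun_apply y (z - x) \<le> gp z - gp x" for z
    using young_p[of y z] assms by (simp add: blinfun.diff_right)
  then show ?thesis by (simp add: subdifferential_def)
qed

text \<open>The function \<open>pr yp z + gms z\<close> is a supremum of weak-star continuous affine
  functions of \<open>z\<close>, indexed by an invariant measure of finite entropy and a point of
  the normed space. Each sublevel set is thus an intersection of half-spaces; the supremum over
  measures is attained at \<open>eqm yp z\<close>.\<close>

lemma closedin_sublevel: "closedin weak_star {z. fin z \<and> pr yp z + gms z \<le> c}"
proof -
  define I :: "(('a cfun \<Rightarrow>\<^sub>L real) \<times> real \<times> 'x) set"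
    where "I = {(\<mu>, h, x). \<mu> \<in> inv_measures \<and> entropy m \<mu> = ereal h}"
  have "{z. fin z \<and> pr yp z + gms z \<le> c} = (\<Inter>(\<mu>, h, x)\<in>I.
    {z. blinfun_apply z (x - \<tau>m \<mu>) \<le> c - h - blinfun_apply yp (\<tau>p \<mu>) + gm x})" (is "?A = ?B")
  proof (intro antisym subsetI)
    fix z assume z: "z \<in> ?A"
    have "blinfun_apply z (x - \<tau>m \<mu>) \<le> c - h - blinfun_apply yp (\<tau>p \<mu>) + gm x"
      if "\<mu> \<in> inv_measures" "entropy m \<mu> = ereal h" for \<mu> h x
      using entropy_le_pr[OF inv_prob[OF that(1)], of yp z] young_m[of z x] z that(2)
      by (simp add: lin_part_def blinfun.diff_right)
    then show "z \<in> ?B" by (auto simp: I_def)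
  next
    fix z assume z: "z \<in> ?B"
    have "(eqm yp z, pr yp z - lin_part yp z (eqm yp z), x) \<in> I" for x
      by (simp add: I_def eqm_inv entropy_eqm)
    then have "blinfun_apply z (x - \<tau>m (eqm yp z))
        \<le> c - (pr yp z - lin_part yp z (eqm yp z)) - blinfun_apply yp (\<tau>p (eqm yp z)) + gm x" for x
      using z by fast
    then have "blinfun_apply z x - gm x \<le> c - pr yp z" for x
      by (simp add: lin_part_def blinfun.diff_right algebra_simps)
    from gms_le[OF this] show "z \<in> ?A" by simp
  qed
  moreover have "I \<noteq> {}" using eqm_inv[of yp 0] entropy_eqm[of yp 0] by (auto simp: I_def)
  ultimately show ?thesis by (auto intro!: closedin_INT closedin_weak_star_le)
qed

definition is_min :: "('y \<Rightarrow>\<^sub>L real) \<Rightarrow> ('x \<Rightarrow>\<^sub>L real) \<Rightarrow> bool" where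
  "is_min yp xm \<longleftrightarrow> fin xm \<and> (\<forall>z. fin z \<longrightarrow> pr yp xm + gms xm \<le> pr yp z + gms z)"

text \<open>Testing the pressure with one fixed measure \<nu> bounds it below by an affine function
  of \<open>norm z\<close> with slope \<open>- onorm \<theta>m\<close>. On a sublevel set this
  bounds \<open>gms z\<close> above by slope \<open>onorm \<theta>m\<close>, and the growth
  condition confines \<open>z\<close> to a ball.\<close>

lemma ex_min: "\<exists>xm. is_min yp xm"
proof -
  let ?J = "\<lambda>z. pr yp z + gms z"
  obtain z0 where z0: "fin z0" using ex_fin by blast
  define \<nu> where "\<nu> = eqm yp z0"
  define h where "h = pr yp z0 - lin_part yp z0 \<nu>"
  have \<nu>: "\<nu> \<in> prob_measures" "entropy m \<nu> = ereal h" by (auto simp: \<nu>_def h_def eqm_prob entropy_eqm)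
  define b where "b = ?J z0 - h - blinfun_apply yp (\<tau>p \<nu>)"
  obtain R where R: "\<And>y. conjugate gm y \<le> ereal (onorm \<theta>m * norm y + b) \<Longrightarrow> norm y \<le> R"
    using minimal_linear_growthD[OF gm_growth, of b] by blast
  define S where "S = {z. fin z \<and> ?J z \<le> ?J z0}"
  have "norm z \<le> R" if z: "z \<in> S" for z
  proof (rule R)
    have "h \<le> pr yp z - lin_part yp z \<nu>" using entropy_le_pr[OF \<nu>(1), of yp z] \<nu>(2) by simp
    moreover have "- (onorm \<theta>m * norm z) \<le> - blinfun_apply z (\<tau>m \<nu>)" using abs_\<tau>m_le[OF \<nu>(1), of z] by linarith
    ultimately have "gms z \<le> onorm \<theta>m * norm z + b"
      using z by (simp add: S_def b_def lin_part_def)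
    then show "conjugate gm z \<le> ereal (onorm \<theta>m * norm z + b)" using z by (simp add: S_def conjugate_gm)
  qed
  then have "S \<subseteq> cball 0 R" by auto
  then have comp: "compactin weak_star S"
    unfolding S_def by (rule closed_compactin[OF compactin_weak_star_cball _ closedin_sublevel])
  have S0: "z0 \<in> S" by (simp add: S_def z0)
  have "closedin weak_star {x \<in> S. ?J x \<le> c}" for c
  proof -
    have "{x \<in> S. ?J x \<le> c} = {z. fin z \<and> ?J z \<le> min (?J z0) c}" by (auto simp: S_def)
    then show ?thesis using closedin_sublevel[of yp "min (?J z0) c"] by simp
  qed
  then obtain xm where xm: "xm \<in> S" "\<And>y. y \<in> S \<Longrightarrow> ?J xm \<le> ?J y"
    using compactin_attains_inf[OF comp, of ?J] S0 by blast
  have "?J xm \<le> ?J z" if "fin z" for z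
    using xm(2)[of z] xm(2)[OF S0] that by (cases "z \<in> S") (auto simp: S_def)
  then show ?thesis using xm(1) by (auto simp: is_min_def S_def)
qed

lemma entropy_le_integrand:
  "(\<And>\<sigma>. 0 < apply_bcontfun \<phi> \<sigma>) \<Longrightarrow>
    entropy m \<mu> \<le> ereal (blinfun_apply \<mu> (Bcontfun (\<lambda>\<sigma>. ln (transfer_op m \<phi> \<sigma> / apply_bcontfun \<phi> \<sigma>))))"
  unfolding entropy_def by (rule INF_lower) simp

text \<open>Entropy is an infimum of evaluations, each weak-star continuous.\<close>

lemma entropy_usc:
  assumes lim: "\<And>\<phi>. (\<lambda>n. blinfun_apply (\<mu>s n) \<phi>) \<longlonglongrightarrow> blinfun_apply \<mu> \<phi>"
    and c: "c \<longlonglongrightarrow> c'" and le: "\<And>n. ereal (c n) \<le> entropy m (\<mu>s n)"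
  shows "ereal c' \<le> entropy m \<mu>"
  unfolding entropy_def
proof (rule INF_greatest)
  fix \<phi> :: "'a cfun" assume "\<phi> \<in> {\<phi>. \<forall>\<sigma>. 0 < apply_bcontfun \<phi> \<sigma>}"
  then have pos: "0 < apply_bcontfun \<phi> \<sigma>" for \<sigma> by simp
  let ?c = "Bcontfun (\<lambda>\<sigma>. ln (transfer_op m \<phi> \<sigma> / apply_bcontfun \<phi> \<sigma>))"
  have "c n \<le> blinfun_apply (\<mu>s n) ?c" for n
    using order_trans[OF le entropy_le_integrand[OF pos]] by simp
  then have "c' \<le> blinfun_apply \<mu> ?c" by (intro LIMSEQ_le[OF c lim]) auto
  then show "ereal c' \<le> ereal (blinfun_apply \<mu> ?c)" by simp
qed

text \<open>First-order condition at a minimizer: perturb \<open>xm\<close> towards \<open>z\<close>. By compactness and uniqueness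
  the equilibrium measures of the perturbed potentials converge to the one of \<open>xm\<close>.\<close>

lemma min_first_order:
  assumes xm: "is_min yp xm" and z: "fin z"
  shows "gms xm + blinfun_apply (z - xm) (\<tau>m (eqm yp xm)) \<le> gms z"
proof -
  let ?\<nu> = "eqm yp xm"
  \<comment> \<open>The double \<open>Suc\<close> keeps all weights strictly between 0 and 1, even
    at \<open>n = 0\<close>.\<close>
  define t where "t n = 1 / real (Suc (Suc n))" for n
  have t: "0 < t n" "t n < 1" for n by (auto simp: t_def)
  have t0: "t \<longlonglongrightarrow> 0" unfolding t_def by (intro LIMSEQ_Suc lim_1_over_n)
  define w where "w n = (1 - t n) *\<^sub>R xm + t n *\<^sub>R z" for n
  have finx: "fin xm" using xm by (simp add: is_min_def)
  have w_apply: "blinfun_apply (w n) x = (1 - t n) * blinfun_apply xm x + t n * blinfun_apply z x" for n x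
    by (simp add: w_def blinfun.add_left blinfun.scaleR_left)
  have "blinfun_apply (w n) x - gm x \<le> (1 - t n) * gms xm + t n * gms z" for n x
  proof -
    have "(1 - t n) * (blinfun_apply xm x - gm x) + t n * (blinfun_apply z x - gm x) \<le> (1 - t n) * gms xm + t n * gms z"
      using t[of n] by (intro add_mono mult_left_mono young_m finx z) auto
    then show ?thesis by (simp add: w_apply algebra_simps)
  qed
  note gw = gms_le[OF this]
  define \<nu>s where "\<nu>s n = eqm yp (w n)" for n
  have lin_w: "lin_part yp (w n) \<mu> = lin_part yp xm \<mu> - t n * blinfun_apply (z - xm) (\<tau>m \<mu>)" for n \<mu>
    by (simp add: lin_part_def w_apply blinfun.diff_left algebra_simps)
  have pr_ge: "pr yp xm - t n * blinfun_apply (z - xm) (\<tau>m ?\<nu>) \<le> pr yp (w n)" for n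
    using entropy_le_pr[OF eqm_prob[of yp xm], of yp "w n"] by (simp add: entropy_eqm lin_w)
  have pr_le: "pr yp (w n) \<le> pr yp xm - t n * blinfun_apply (z - xm) (\<tau>m (\<nu>s n))" for n
    using entropy_le_pr[OF eqm_prob[of yp "w n"], of yp xm] by (simp add: \<nu>s_def entropy_eqm lin_w)
  \<comment> \<open>Minimality against \<open>w n\<close>, the upper bound on
    \<open>pr yp (w n)\<close> and convexity of \<open>gms\<close> leave an inequality with the
    common factor \<open>t n\<close>.\<close>
  have step: "gms xm + blinfun_apply (z - xm) (\<tau>m (\<nu>s n)) \<le> gms z" for n
  proof -
    have "pr yp xm + gms xm \<le> pr yp (w n) + gms (w n)" using xm gw(1) by (simp add: is_min_def)
    then have "t n * (gms xm + blinfun_apply (z - xm) (\<tau>m (\<nu>s n))) \<le> t n * gms z"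
      using pr_le[of n] gw(2)[of n] by (simp add: algebra_simps)
    then show ?thesis using t(1)[of n] by (rule mult_left_le_imp_le)
  qed
  obtain \<mu> r where \<mu>: "\<mu> \<in> inv_measures" "strict_mono (r :: nat \<Rightarrow> nat)"
    "\<And>\<phi>. (\<lambda>n. blinfun_apply (\<nu>s (r n)) \<phi>) \<longlonglongrightarrow> blinfun_apply \<mu> \<phi>"
    using inv_measures_seq_compact[of \<nu>s] eqm_inv unfolding \<nu>s_def by metis
  have \<nu>s_prob: "\<nu>s n \<in> prob_measures" for n by (simp add: \<nu>s_def eqm_prob)
  have lim_m: "(\<lambda>n. \<tau>m (\<nu>s (r n))) \<longlonglongrightarrow> \<tau>m \<mu>" by (rule tau_tendsto[OF normal(1) \<nu>s_prob \<mu>(3)])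
  have lim_p: "(\<lambda>n. \<tau>p (\<nu>s (r n))) \<longlonglongrightarrow> \<tau>p \<mu>" by (rule tau_tendsto[OF normal(2) \<nu>s_prob \<mu>(3)])
  have lim_t: "(\<lambda>n. t (r n)) \<longlonglongrightarrow> 0" using LIMSEQ_subseq_LIMSEQ[OF t0 \<mu>(2)] by (simp add: o_def)
  \<comment> \<open>Lower bounds for the entropies along the subsequence. Their limit shows that the
    limit measure is an equilibrium measure for the unperturbed \<open>xm\<close>.\<close>
  define c where "c n = pr yp xm - t (r n) * blinfun_apply (z - xm) (\<tau>m ?\<nu>) -
    (lin_part yp xm (\<nu>s (r n)) - t (r n) * blinfun_apply (z - xm) (\<tau>m (\<nu>s (r n))))" for n
  have "ereal (pr yp xm - lin_part yp xm \<mu>) \<le> entropy m \<mu>"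
  proof (rule entropy_usc[OF \<mu>(3)])
    have "c \<longlonglongrightarrow> pr yp xm - 0 * blinfun_apply (z - xm) (\<tau>m ?\<nu>) -
      (lin_part yp xm \<mu> - 0 * blinfun_apply (z - xm) (\<tau>m \<mu>))"
      unfolding c_def[abs_def] lin_part_def by (intro tendsto_intros lim_t lim_m lim_p)
    then show "c \<longlonglongrightarrow> pr yp xm - lin_part yp xm \<mu>" by simp
    show "ereal (c n) \<le> entropy m (\<nu>s (r n))" for n
      using pr_ge[of "r n"] by (simp add: \<nu>s_def entropy_eqm c_def lin_w)
  qed
  then have "\<mu> = ?\<nu>" by (rule eqm_unique[OF inv_prob[OF \<mu>(1)]])
  with lim_m have "(\<lambda>n. gms xm + blinfun_apply (z - xm) (\<tau>m (\<nu>s (r n)))) \<longlonglongrightarrow> gms xm + blinfun_apply (z - xm) (\<tau>m ?\<nu>)"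
    by (intro tendsto_intros) simp
  then show ?thesis by (rule LIMSEQ_le_const2) (use step in auto)
qed

text \<open>Equality in Young's inequality. A gap would leave room for an affine minorant of
  \<open>gm\<close> whose slope \<open>z\<close> violates the first-order condition at
  \<open>xm\<close>.\<close>

lemma min_gms_eq:
  assumes xm: "is_min yp xm"
  shows "gms xm = blinfun_apply xm (\<tau>m (eqm yp xm)) - gm (\<tau>m (eqm yp xm))"
proof (rule antisym)
  let ?x = "\<tau>m (eqm yp xm)"
  have fin: "fin xm" using xm by (simp add: is_min_def)
  show "blinfun_apply xm ?x - gm ?x \<le> gms xm" by (rule young_m[OF fin])
  show "gms xm \<le> blinfun_apply xm ?x - gm ?x"
  proof (rule ccontr)
    define a where "a = (gm ?x + (blinfun_apply xm ?x - gms xm)) / 2"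
    assume "\<not> ?thesis"
    then have a: "a < gm ?x" "blinfun_apply xm ?x - gms xm < a" by (auto simp: a_def)
    obtain z where z: "fin z" "gms z \<le> blinfun_apply z ?x - a" by (rule minorant_m[OF a(1)])
    show False using min_first_order[OF xm z(1)] z(2) a(2) by (simp add: blinfun.diff_left)
  qed
qed

lemma min_subdifferential:
  assumes xm: "is_min yp xm"
  shows "xm \<in> subdifferential gm (\<tau>m (eqm yp xm))"
proof -
  have fin: "fin xm" using xm by (simp add: is_min_def)
  have "blinfun_apply xm (x - \<tau>m (eqm yp xm)) \<le> gm x - gm (\<tau>m (eqm yp xm))" for x
    using young_m[OF fin, of x] min_gms_eq[OF xm] by (simp add: blinfun.diff_right)
  then show ?thesis by (simp add: subdifferential_def)
qed

section \<open>The nonlinear problem\<close>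

definition xmin :: "('y \<Rightarrow>\<^sub>L real) \<Rightarrow> 'x \<Rightarrow>\<^sub>L real" where
  "xmin yp = (SOME xm. is_min yp xm)"

definition val :: "('y \<Rightarrow>\<^sub>L real) \<Rightarrow> real" where
  "val yp = pr yp (xmin yp) + gms (xmin yp)"

definition sol :: "('y \<Rightarrow>\<^sub>L real) \<Rightarrow> 'a cfun \<Rightarrow>\<^sub>L real" where
  "sol yp = eqm yp (xmin yp)"

lemma xmin: "is_min yp (xmin yp)"
  unfolding xmin_def by (rule someI_ex[OF ex_min])

lemma is_min_val: "is_min yp xm \<Longrightarrow> pr yp xm + gms xm = val yp"
  using xmin[of yp] unfolding val_def is_min_def by (intro antisym) auto

lemma entropy_le_val:
  assumes "\<mu> \<in> prob_measures"
  shows "entropy m \<mu> \<le> ereal (val yp - blinfun_apply yp (\<tau>p \<mu>) + gm (\<tau>m \<mu>))"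
proof -
  have "fin (xmin yp)" using xmin[of yp] by (simp add: is_min_def)
  from young_m[OF this, of "\<tau>m \<mu>"]
  have "pr yp (xmin yp) - lin_part yp (xmin yp) \<mu> \<le> val yp - blinfun_apply yp (\<tau>p \<mu>) + gm (\<tau>m \<mu>)"
    by (simp add: val_def lin_part_def)
  with entropy_le_pr[OF assms, of yp "xmin yp"] show ?thesis
    by (meson ereal_less_eq(3) order_trans)
qed

text \<open>Young's inequality weakens the linear bound at \<open>xm\<close> to one in terms of
  \<open>gm\<close>, so attaining the latter forces equality in the former. As \<open>xm\<close> is
  any minimizer, all minimizers share one equilibrium measure.\<close>

lemma val_unique:
  assumes \<mu>: "\<mu> \<in> prob_measures" and xm: "is_min yp xm"
    and ge: "ereal (val yp - blinfun_apply yp (\<tau>p \<mu>) + gm (\<tau>m \<mu>)) \<le> entropy m \<mu>"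
  shows "\<mu> = eqm yp xm"
proof (rule eqm_unique[OF \<mu>])
  have "fin xm" using xm by (simp add: is_min_def)
  from young_m[OF this, of "\<tau>m \<mu>"]
  have "pr yp xm - lin_part yp xm \<mu> \<le> val yp - blinfun_apply yp (\<tau>p \<mu>) + gm (\<tau>m \<mu>)"
    by (simp add: is_min_val[OF xm, symmetric] lin_part_def)
  with ge show "ereal (pr yp xm - lin_part yp xm \<mu>) \<le> entropy m \<mu>"
    by (meson ereal_less_eq(3) order_trans)
qed

lemma entropy_sol: "entropy m (sol yp) = ereal (val yp - blinfun_apply yp (\<tau>p (sol yp)) + gm (\<tau>m (sol yp)))"
  using min_gms_eq[OF xmin[of yp]] by (simp add: sol_def entropy_eqm val_def lin_part_def)

lemma sol_erg: "sol yp \<in> erg_measures" and sol_inv: "sol yp \<in> inv_measures" and sol_prob: "sol yp \<in> prob_measures"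
  by (simp_all add: sol_def eqm_erg eqm_inv eqm_prob)

lemma eqm_min_eq_sol:
  assumes "is_min yp xm"
  shows "eqm yp xm = sol yp"
  by (rule val_unique[OF sol_prob assms, symmetric]) (simp add: entropy_sol)

lemma P_NL_eq:
  "P_NL m \<theta>m \<theta>p gm gp yp z = (if fin z then ereal (pr yp z + gms z - gps yp) else \<infinity>)"
proof (cases "fin z")
  case False
  then have "conjugate gm z = \<infinity>" by (simp add: fin_def)
  then show ?thesis using False by (simp add: P_NL_def P_L_eq conjugate_gp)
qed (simp add: P_NL_def P_L_eq conjugate_gp conjugate_gm)

lemma P_flat_eq: "P_flat m \<theta>m \<theta>p gm gp yp = ereal (val yp - gps yp)"
  unfolding P_flat_def
proof (rule antisym)
  have "P_NL m \<theta>m \<theta>p gm gp yp (xmin yp) = ereal (val yp - gps yp)"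
    using xmin[of yp] by (simp add: P_NL_eq is_min_def val_def)
  then show "(INF z. P_NL m \<theta>m \<theta>p gm gp yp z) \<le> ereal (val yp - gps yp)"
    by (intro INF_lower2[of "xmin yp"]) auto
  show "ereal (val yp - gps yp) \<le> (INF z. P_NL m \<theta>m \<theta>p gm gp yp z)"
    using xmin[of yp] by (intro INF_greatest) (simp add: P_NL_eq is_min_def val_def)
qed

lemma M_flat_minus_is_min:
  assumes "xm \<in> M_flat_minus m \<theta>m \<theta>p gm gp yp"
  shows "is_min yp xm"
proof -
  have eq: "P_NL m \<theta>m \<theta>p gm gp yp xm = ereal (val yp - gps yp)"
    using assms by (simp add: M_flat_minus_def P_flat_eq)
  then have "fin xm" by (auto simp: P_NL_eq split: if_splits)
  moreover from this eq have "pr yp xm + gms xm = val yp" by (simp add: P_NL_eq)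
  ultimately show ?thesis using xmin[of yp] by (simp add: is_min_def val_def)
qed

lemma pressure_eq:
  "pressure \<mu> = entropy m \<mu> + ereal (gp (\<tau>p \<mu>) - gm (\<tau>m \<mu>))"
  by (cases "entropy m \<mu>") (simp_all add: pressure_functional_def)

definition peak :: ereal where
  "peak = Sup (pressure ` inv_measures)"

lemma pressure_le_peak: "\<mu> \<in> inv_measures \<Longrightarrow> pressure \<mu> \<le> peak"
  unfolding peak_def by (rule SUP_upper)

lemma pressure_sol:
  "pressure (sol yp) = ereal (val yp - blinfun_apply yp (\<tau>p (sol yp)) + gp (\<tau>p (sol yp)))"
  by (simp add: pressure_eq entropy_sol)

lemma val_le_pressure_sol: "ereal (val yp - gps yp) \<le> pressure (sol yp)"
  using young_p[of yp "\<tau>p (sol yp)"] by (simp add: pressure_sol)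

lemma val_le_peak: "ereal (val yp - gps yp) \<le> peak"
  using val_le_pressure_sol pressure_le_peak[OF sol_inv] order_trans by blast

lemma pressure_le_val:
  assumes "\<mu> \<in> prob_measures" "gps yp = blinfun_apply yp (\<tau>p \<mu>) - gp (\<tau>p \<mu>)"
  shows "pressure \<mu> \<le> ereal (val yp - gps yp)"
  using entropy_le_val[OF assms(1), of yp] assms(2)
  by (cases "entropy m \<mu>") (simp_all add: pressure_eq)

text \<open>Each measure has a subgradient of \<open>gp\<close> at its image, and for this
  \<open>yp\<close> Young's inequality loses nothing.\<close>

lemma P_flat_sup_eq: "P_flat_sup m \<theta>m \<theta>p gm gp = peak"
  unfolding P_flat_sup_def P_flat_eq
proof (rule antisym)
  show "(SUP yp. ereal (val yp - gps yp)) \<le> peak" by (intro SUP_least val_le_peak)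
  show "peak \<le> (SUP yp. ereal (val yp - gps yp))"
    unfolding peak_def
  proof (rule SUP_least)
    fix \<mu> :: "'a cfun \<Rightarrow>\<^sub>L real" assume \<mu>: "\<mu> \<in> inv_measures"
    obtain yp where "gps yp = blinfun_apply yp (\<tau>p \<mu>) - gp (\<tau>p \<mu>)" by (rule subgradient_p)
    from pressure_le_val[OF inv_prob[OF \<mu>] this]
    show "pressure \<mu> \<le> (SUP yp. ereal (val yp - gps yp))"
      by (rule order_trans) (rule SUP_upper, simp)
  qed
qed

lemma M_flat_iff: "yp \<in> Mflat \<longleftrightarrow> ereal (val yp - gps yp) = peak"
  by (simp add: M_flat_def P_flat_eq P_flat_sup_eq)

lemma M_P_iff: "\<mu> \<in> MP \<longleftrightarrow> \<mu> \<in> inv_measures \<and> pressure \<mu> = peak"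
  by (simp add: M_P_def peak_def)

theorem M_P_eq: "MP = sol ` Mflat"
proof (intro antisym subsetI)
  fix \<mu> assume "\<mu> \<in> MP"
  then have \<mu>: "\<mu> \<in> inv_measures" "pressure \<mu> = peak" by (auto simp: M_P_iff)
  obtain yp where yp: "gps yp = blinfun_apply yp (\<tau>p \<mu>) - gp (\<tau>p \<mu>)" by (rule subgradient_p)
  have "peak \<le> ereal (val yp - gps yp)" using pressure_le_val[OF inv_prob[OF \<mu>(1)] yp] \<mu>(2) by simp
  then have eq: "ereal (val yp - gps yp) = peak" using val_le_peak by (rule antisym[rotated])
  have "\<mu> = eqm yp (xmin yp)"
  proof (rule val_unique[OF inv_prob[OF \<mu>(1)] xmin])
    have "entropy m \<mu> + ereal (gp (\<tau>p \<mu>) - gm (\<tau>m \<mu>)) = ereal (val yp - gps yp)"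
      using \<mu>(2) eq by (simp add: pressure_eq)
    then show "ereal (val yp - blinfun_apply yp (\<tau>p \<mu>) + gm (\<tau>m \<mu>)) \<le> entropy m \<mu>"
      using yp by (cases "entropy m \<mu>") auto
  qed
  then have "\<mu> = sol yp" by (simp add: sol_def)
  with eq show "\<mu> \<in> sol ` Mflat" by (auto simp: M_flat_iff)
next
  fix \<mu> assume "\<mu> \<in> sol ` Mflat"
  then obtain yp where yp: "\<mu> = sol yp" "ereal (val yp - gps yp) = peak" by (auto simp: M_flat_iff)
  then show "\<mu> \<in> MP"
    using val_le_pressure_sol[of yp] pressure_le_peak[OF sol_inv[of yp]] sol_inv[of yp]
    by (auto simp: M_P_iff)
qed

end

context variational begin

section \<open>Compactness of the solution set\<close>

lemma entropy_upper: "\<mu> \<in> prob_measures \<Longrightarrow> entropy m \<mu> \<le> ereal (pr 0 0)"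
  using entropy_le_pr[of \<mu> 0 0] by (simp add: lin_part_def)

lemma gm_lower: "\<exists>c. \<forall>\<mu>\<in>prob_measures. c \<le> gm (\<tau>m \<mu>)"
proof -
  obtain z where z: "fin z" using ex_fin by blast
  have "- (onorm \<theta>m * norm z) - gms z \<le> gm (\<tau>m \<mu>)" if "\<mu> \<in> prob_measures" for \<mu>
    using young_m[OF z, of "\<tau>m \<mu>"] abs_\<tau>m_le[OF that, of z] by linarith
  then show ?thesis by blast
qed

lemma gp_upper: "\<exists>c. \<forall>\<mu>\<in>prob_measures. gp (\<tau>p \<mu>) \<le> c"
proof -
  obtain B where B: "\<forall>y\<in>gp ` cball 0 (onorm \<theta>p). norm y \<le> B"
    using gp_bdd[OF bounded_cball[of 0 "onorm \<theta>p"]] unfolding bounded_iff by blast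
  have "gp (\<tau>p \<mu>) \<le> B" if "\<mu> \<in> prob_measures" for \<mu>
  proof -
    have "\<tau>p \<mu> \<in> cball 0 (onorm \<theta>p)" using norm_tau_le[OF lin(2) normal(2) that] by simp
    then have "norm (gp (\<tau>p \<mu>)) \<le> B" using B by blast
    then show ?thesis by simp
  qed
  then show ?thesis by blast
qed

definition best :: real where "best = real_of_ereal peak"

lemma peak_eq: "peak = ereal best"
proof -
  obtain c where c: "\<And>\<mu>. \<mu> \<in> prob_measures \<Longrightarrow> c \<le> gm (\<tau>m \<mu>)" using gm_lower by blast
  obtain d where d: "\<And>\<mu>. \<mu> \<in> prob_measures \<Longrightarrow> gp (\<tau>p \<mu>) \<le> d" using gp_upper by blast
  have "peak \<le> ereal (pr 0 0 + (d - c))"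
    unfolding peak_def
  proof (rule SUP_least)
    fix \<mu> :: "'a cfun \<Rightarrow>\<^sub>L real" assume "\<mu> \<in> inv_measures"
    then have \<mu>: "\<mu> \<in> prob_measures" by (rule inv_prob)
    show "pressure \<mu> \<le> ereal (pr 0 0 + (d - c))"
      using entropy_upper[OF \<mu>] c[OF \<mu>] d[OF \<mu>] by (cases "entropy m \<mu>") (simp_all add: pressure_eq)
  qed
  moreover have "ereal (val 0 - gps 0) \<le> peak" by (rule val_le_peak)
  ultimately show ?thesis unfolding best_def by (cases peak) auto
qed

abbreviation integrand :: "'a cfun \<Rightarrow> 'a cfun" where
  "integrand \<phi> \<equiv> Bcontfun (\<lambda>\<sigma>. ln (transfer_op m \<phi> \<sigma> / apply_bcontfun \<phi> \<sigma>))"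

text \<open>This trades \<open>- gm\<close>, only upper semicontinuous, for the continuous functions
  \<open>gms z - z\<close>: for each test function a violated bound would leave room for a minorant
  as in \<open>minorant_m\<close>.\<close>

lemma entropy_geI:
  assumes "\<And>\<phi> z. (\<And>\<sigma>. 0 < apply_bcontfun \<phi> \<sigma>) \<Longrightarrow> fin z \<Longrightarrow>
    c \<le> blinfun_apply \<mu> (integrand \<phi>) + (gms z - blinfun_apply z (\<tau>m \<mu>))"
  shows "ereal (c + gm (\<tau>m \<mu>)) \<le> entropy m \<mu>"
  unfolding entropy_def
proof (rule INF_greatest)
  fix \<phi> :: "'a cfun" assume "\<phi> \<in> {\<phi>. \<forall>\<sigma>. 0 < apply_bcontfun \<phi> \<sigma>}"
  then have pos: "0 < apply_bcontfun \<phi> \<sigma>" for \<sigma> by simp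
  have "c + gm (\<tau>m \<mu>) \<le> blinfun_apply \<mu> (integrand \<phi>)"
  proof (rule ccontr)
    define a where "a = (gm (\<tau>m \<mu>) + (blinfun_apply \<mu> (integrand \<phi>) - c)) / 2"
    assume "\<not> ?thesis"
    then have a: "a < gm (\<tau>m \<mu>)" "blinfun_apply \<mu> (integrand \<phi>) - c < a" by (auto simp: a_def)
    obtain z where z: "fin z" "gms z \<le> blinfun_apply z (\<tau>m \<mu>) - a" by (rule minorant_m[OF a(1)])
    show False using assms[OF pos z(1)] z(2) a(2) by simp
  qed
  then show "ereal (c + gm (\<tau>m \<mu>)) \<le> ereal (blinfun_apply \<mu> (integrand \<phi>))" by simp
qed

lemma gp_isCont: "isCont gp x"
proof -
  obtain B where B: "\<forall>y\<in>gp ` ball x 1. norm y \<le> B"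
    using gp_bdd[OF bounded_ball[of x 1]] unfolding bounded_iff by blast
  have "continuous_on (ball x 1) gp"
    by (rule convex_on_bounded_continuous[where b = B]) (use B convex_on_subset[OF gp] in auto)
  then show ?thesis by (simp add: continuous_on_eq_continuous_at)
qed

lemma pressure_usc:
  assumes \<mu>s: "\<And>n. \<mu>s n \<in> inv_measures" and \<mu>: "\<mu> \<in> inv_measures"
    and lim: "\<And>\<phi>. (\<lambda>n. blinfun_apply (\<mu>s n) \<phi>) \<longlonglongrightarrow> blinfun_apply \<mu> \<phi>"
    and peak: "(\<lambda>n. pressure (\<mu>s n)) \<longlonglongrightarrow> peak"
  shows "pressure \<mu> = peak"
proof (rule antisym[OF pressure_le_peak[OF \<mu>]])
  have lim_m: "(\<lambda>n. \<tau>m (\<mu>s n)) \<longlonglongrightarrow> \<tau>m \<mu>" by (rule tau_tendsto[OF normal(1) inv_prob[OF \<mu>s] lim])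
  have lim_p: "(\<lambda>n. \<tau>p (\<mu>s n)) \<longlonglongrightarrow> \<tau>p \<mu>" by (rule tau_tendsto[OF normal(2) inv_prob[OF \<mu>s] lim])
  have "ereal ((best - gp (\<tau>p \<mu>)) + gm (\<tau>m \<mu>)) \<le> entropy m \<mu>"
  proof (rule entropy_geI)
    fix \<phi> :: "'a cfun" and z assume pos: "\<And>\<sigma>. 0 < apply_bcontfun \<phi> \<sigma>" and z: "fin z"
    let ?F = "\<lambda>\<mu>. blinfun_apply \<mu> (integrand \<phi>) + (gms z - blinfun_apply z (\<tau>m \<mu>)) + gp (\<tau>p \<mu>)"
    have "pressure (\<mu>s n) \<le> ereal (?F (\<mu>s n))" for n
      using entropy_le_integrand[OF pos, of "\<mu>s n"] young_m[OF z, of "\<tau>m (\<mu>s n)"]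
      by (cases "entropy m (\<mu>s n)") (simp_all add: pressure_eq)
    moreover have "(\<lambda>n. ereal (?F (\<mu>s n))) \<longlonglongrightarrow> ereal (?F \<mu>)"
      by (intro tendsto_ereal tendsto_intros lim lim_m isCont_tendsto_compose[OF gp_isCont lim_p])
    ultimately have "peak \<le> ereal (?F \<mu>)" using LIMSEQ_le[OF peak] by blast
    then show "best - gp (\<tau>p \<mu>) \<le> blinfun_apply \<mu> (integrand \<phi>) + (gms z - blinfun_apply z (\<tau>m \<mu>))"
      by (simp add: peak_eq)
  qed
  then show "peak \<le> pressure \<mu>"
    by (cases "entropy m \<mu>") (simp_all add: pressure_eq peak_eq)
qed

theorem E_P_eq: "EP = MP"
proof (intro antisym subsetI)
  fix \<mu> assume "\<mu> \<in> EP"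
  then obtain \<mu>s where "\<mu> \<in> inv_measures" "\<And>n. \<mu>s n \<in> inv_measures" "limitin weak_star \<mu>s \<mu> sequentially"
    "(\<lambda>n. pressure (\<mu>s n)) \<longlonglongrightarrow> peak"
    unfolding E_P_def peak_def by blast
  then show "\<mu> \<in> MP"
    unfolding M_P_iff limitin_weak_star using pressure_usc by blast
next
  fix \<mu> assume "\<mu> \<in> MP"
  then show "\<mu> \<in> EP"
    unfolding E_P_def peak_def[symmetric] M_P_iff
    by (intro CollectI conjI exI[of _ "\<lambda>_. \<mu>"]) (auto simp: limitin_weak_star)
qed

lemma M_P_nonempty: "MP \<noteq> {}"
proof -
  have "\<exists>\<mu>\<in>inv_measures. ereal (best - 1 / real (Suc n)) < pressure \<mu>" for n
  proof -
    have "ereal (best - 1 / real (Suc n)) < peak" by (simp add: peak_eq)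
    then show ?thesis unfolding peak_def less_SUP_iff .
  qed
  then obtain \<mu>s where \<mu>s: "\<And>n. \<mu>s n \<in> inv_measures"
    "\<And>n. ereal (best - 1 / real (Suc n)) < pressure (\<mu>s n)" by metis
  obtain \<mu> r where \<mu>: "\<mu> \<in> inv_measures" "strict_mono (r :: nat \<Rightarrow> nat)"
    "\<And>\<phi>. (\<lambda>n. blinfun_apply (\<mu>s (r n)) \<phi>) \<longlonglongrightarrow> blinfun_apply \<mu> \<phi>"
    by (rule inv_measures_seq_compact[of \<mu>s]) (use \<mu>s in blast)+
  have "(\<lambda>n. best - 1 / real (Suc n)) \<longlonglongrightarrow> best - 0"
    by (intro tendsto_diff tendsto_const LIMSEQ_Suc lim_1_over_n)
  then have low: "(\<lambda>n. ereal (best - 1 / real (Suc n))) \<longlonglongrightarrow> peak" by (simp add: peak_eq)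
  have "(\<lambda>n. pressure (\<mu>s n)) \<longlonglongrightarrow> peak"
    by (rule tendsto_sandwich[OF _ _ low tendsto_const])
      (rule always_eventually, rule allI, rule less_imp_le[OF \<mu>s(2)],
        rule always_eventually, rule allI, rule pressure_le_peak[OF \<mu>s(1)])
  from LIMSEQ_subseq_LIMSEQ[OF this \<mu>(2)]
  have "(\<lambda>n. pressure (\<mu>s (r n))) \<longlonglongrightarrow> peak" by (simp add: o_def)
  from pressure_usc[OF \<mu>s(1) \<mu>(1,3) this] \<mu>(1) show ?thesis by (auto simp: M_P_iff)
qed

text \<open>On probability measures \<open>pr 0 0\<close> bounds the entropy above and
  \<open>gm\<close> is bounded below. At \<open>sol yp\<close> these bounds turn
  \<open>val yp - gps yp = best\<close> into an upper bound for \<open>gps yp\<close> of slope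
  \<open>onorm \<theta>p\<close>, to which the growth condition applies.\<close>

lemma M_flat_bounded: "\<exists>R. \<forall>yp\<in>Mflat. norm yp \<le> R"
proof -
  obtain c where c: "\<And>\<mu>. \<mu> \<in> prob_measures \<Longrightarrow> c \<le> gm (\<tau>m \<mu>)" using gm_lower by blast
  obtain R where R: "\<And>y. conjugate gp y \<le> ereal (onorm \<theta>p * norm y + (pr 0 0 - c - best)) \<Longrightarrow> norm y \<le> R"
    using minimal_linear_growthD[OF gp_growth, of "pr 0 0 - c - best"] by blast
  have "norm yp \<le> R" if "yp \<in> Mflat" for yp
  proof (rule R)
    have "val yp - gps yp = best" using that by (simp add: M_flat_iff peak_eq)
    moreover have "val yp - blinfun_apply yp (\<tau>p (sol yp)) + gm (\<tau>m (sol yp)) \<le> pr 0 0"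
      using entropy_upper[OF sol_prob[of yp]] by (simp add: entropy_sol)
    ultimately have "gps yp \<le> onorm \<theta>p * norm yp + (pr 0 0 - c - best)"
      using c[OF sol_prob[of yp]] abs_\<tau>p_le[OF sol_prob[of yp], of yp] by linarith
    then show "conjugate gp yp \<le> ereal (onorm \<theta>p * norm yp + (pr 0 0 - c - best))"
      by (simp add: conjugate_gp)
  qed
  then show ?thesis by blast
qed

definition sol_graph :: "(('y \<Rightarrow>\<^sub>L real) \<times> ('a cfun \<Rightarrow>\<^sub>L real)) set" where
  "sol_graph = (\<lambda>yp. (yp, sol yp)) ` Mflat"

text \<open>Unfolding the infima in \<open>h\<close>, \<open>- gm\<close> and \<open>- gp\<^sup>*\<close> exhibits the graph as an intersection of
  superlevel sets of continuous functions.\<close>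

lemma sol_graph_iff:
  assumes "\<mu> \<in> inv_measures"
  shows "(x, \<mu>) \<in> sol_graph \<longleftrightarrow> (\<forall>\<phi> z w. (\<forall>\<sigma>. 0 < apply_bcontfun \<phi> \<sigma>) \<longrightarrow> fin z \<longrightarrow>
    best \<le> blinfun_apply \<mu> (integrand \<phi>) + blinfun_apply x (\<tau>p \<mu>) + (gms z - blinfun_apply z (\<tau>m \<mu>))
      + (gp w - blinfun_apply x w))" (is "_ \<longleftrightarrow> ?R")
proof
  assume "(x, \<mu>) \<in> sol_graph"
  then have x: "\<mu> = sol x" "val x - gps x = best" by (auto simp: sol_graph_def M_flat_iff peak_eq)
  show ?R
  proof (intro allI impI)
    fix \<phi> :: "'a cfun" and z w assume "\<forall>\<sigma>. 0 < apply_bcontfun \<phi> \<sigma>" and z: "fin z"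
    then have "entropy m \<mu> \<le> ereal (blinfun_apply \<mu> (integrand \<phi>))" by (intro entropy_le_integrand) simp
    then have "val x - blinfun_apply x (\<tau>p \<mu>) + gm (\<tau>m \<mu>) \<le> blinfun_apply \<mu> (integrand \<phi>)"
      using entropy_sol[of x] x(1) by simp
    with young_m[OF z, of "\<tau>m \<mu>"] young_p[of x w] x(2)
    show "best \<le> blinfun_apply \<mu> (integrand \<phi>) + blinfun_apply x (\<tau>p \<mu>) + (gms z - blinfun_apply z (\<tau>m \<mu>))
      + (gp w - blinfun_apply x w)" by linarith
  qed
next
  assume R: ?R
  have "ereal ((best + gps x - blinfun_apply x (\<tau>p \<mu>)) + gm (\<tau>m \<mu>)) \<le> entropy m \<mu>"
  proof (rule entropy_geI)
    fix \<phi> :: "'a cfun" and z assume \<phi>: "\<And>\<sigma>. 0 < apply_bcontfun \<phi> \<sigma>" and z: "fin z"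
    have "blinfun_apply x w - gp w \<le> blinfun_apply \<mu> (integrand \<phi>) + blinfun_apply x (\<tau>p \<mu>)
        + (gms z - blinfun_apply z (\<tau>m \<mu>)) - best" for w
      using R[rule_format, of \<phi> z w] \<phi> z by simp
    from gps_le[OF this]
    show "best + gps x - blinfun_apply x (\<tau>p \<mu>) \<le> blinfun_apply \<mu> (integrand \<phi>) + (gms z - blinfun_apply z (\<tau>m \<mu>))"
      by simp
  qed
  note ge = this
  have \<mu>: "\<mu> \<in> prob_measures" by (rule inv_prob[OF assms])
  have "best \<le> val x - gps x" using order_trans[OF ge entropy_le_val[OF \<mu>, of x]] by simp
  then have eq: "val x - gps x = best" using val_le_peak[of x] by (simp add: peak_eq)
  have "\<mu> = sol x"
    unfolding sol_def by (rule val_unique[OF \<mu> xmin]) (use ge eq in \<open>simp add: algebra_simps\<close>)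
  with eq show "(x, \<mu>) \<in> sol_graph" by (auto simp: sol_graph_def M_flat_iff peak_eq)
qed

text \<open>The ball containing \<open>Mflat\<close> serves twice: it gives a compact ambient
  product, and it makes the pairing of \<open>x\<close> with the image of \<mu> continuous although
  both vary.\<close>

lemma compactin_sol_graph: "compactin (prod_topology weak_star weak_star) sol_graph"
proof -
  obtain R where R: "\<And>yp. yp \<in> Mflat \<Longrightarrow> norm yp \<le> R" using M_flat_bounded by blast
  define Z where "Z = prod_topology (subtopology weak_star (cball (0 :: 'y \<Rightarrow>\<^sub>L real) R))
    (subtopology weak_star (inv_measures :: ('a cfun \<Rightarrow>\<^sub>L real) set))"
  have topZ: "topspace Z = cball 0 R \<times> inv_measures" by (simp add: Z_def)
  have compZ: "compact_space Z"
    unfolding Z_def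
    by (auto simp: compact_space_prod_topology
        intro: compact_space_subtopology compactin_weak_star_cball compactin_inv_measures)
  have tau: "continuous_map Z euclidean (\<lambda>v. tau \<theta> (snd v))" if "sigma_normal \<theta>" for \<theta> :: "'a bmeas \<Rightarrow> 'z::real_normed_vector"
    using continuous_map_compose[OF continuous_map_snd
        continuous_map_from_subtopology_mono[OF tau_continuous_map[OF that] inv_measures_subset]]
    by (simp add: Z_def o_def)
  have snd_apply: "continuous_map Z euclidean (\<lambda>v. blinfun_apply (snd v) \<phi>)" for \<phi>
    using continuous_map_compose[OF continuous_map_snd
        continuous_map_from_subtopology[OF weak_star_apply_continuous, of inv_measures \<phi>]]
    by (simp add: Z_def o_def)
  have fst_apply: "continuous_map Z euclidean (\<lambda>v. blinfun_apply (fst v) w)" for w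
    using continuous_map_compose[OF continuous_map_fst
        continuous_map_from_subtopology[OF weak_star_apply_continuous, of "cball 0 R" w]]
    by (simp add: Z_def o_def)
  have "continuous_map Z (prod_topology (subtopology weak_star (cball 0 R)) euclidean) (\<lambda>v. (fst v, \<tau>p (snd v)))"
    by (intro continuous_map_pairedI tau[OF normal(2)]) (simp add: Z_def continuous_map_fst)
  from continuous_map_compose[OF this evaluation_continuous]
  have pairing: "continuous_map Z euclidean (\<lambda>v. blinfun_apply (fst v) (\<tau>p (snd v)))" by (simp add: o_def)
  have tau_m: "continuous_map Z euclidean (\<lambda>v. blinfun_apply z (\<tau>m (snd v)))" for z
    using continuous_map_compose[OF tau[OF normal(1)], of euclidean "blinfun_apply z"]
    by (simp add: o_def blinfun.continuous_on continuous_on_id)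
  define F where "F \<phi> z w v = blinfun_apply (snd v) (integrand \<phi>) + blinfun_apply (fst v) (\<tau>p (snd v))
    + (gms z - blinfun_apply z (\<tau>m (snd v))) + (gp w - blinfun_apply (fst v) w)" for \<phi> z w v
  have F: "continuous_map Z euclidean (F \<phi> z w)" for \<phi> z w
    unfolding F_def[abs_def]
    by (intro continuous_map_add continuous_map_diff snd_apply fst_apply pairing tau_m continuous_map_const[THEN iffD2]) auto
  define I where "I = {(\<phi> :: 'a cfun, z, w :: 'y). (\<forall>\<sigma>. 0 < apply_bcontfun \<phi> \<sigma>) \<and> fin z}"
  have "(const_bcontfun 1, SOME z. fin z, 0) \<in> I" using someI_ex[OF ex_fin] by (simp add: I_def)
  then have I: "I \<noteq> {}" by blast
  have "sol_graph = (\<Inter>(\<phi>, z, w)\<in>I. {v \<in> topspace Z. F \<phi> z w v \<in> {best..}})" (is "_ = ?B")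
  proof (intro antisym subsetI)
    fix v assume v: "v \<in> sol_graph"
    then have "fst v \<in> cball 0 R" "snd v \<in> inv_measures" using R by (auto simp: sol_graph_def sol_inv)
    then show "v \<in> ?B"
      using v sol_graph_iff[of "snd v" "fst v"] by (auto simp: topZ I_def F_def mem_Times_iff)
  next
    fix v assume v: "v \<in> ?B"
    then have "snd v \<in> inv_measures" using I by (auto simp: topZ)
    then have "(fst v, snd v) \<in> sol_graph"
      using v by (subst sol_graph_iff) (auto simp: I_def F_def)
    then show "v \<in> sol_graph" by simp
  qed
  moreover have "closedin Z {v \<in> topspace Z. F \<phi> z w v \<in> {best..}}" for \<phi> z w
    by (rule closedin_continuous_map_preimage[OF F]) simp
  ultimately have "closedin Z sol_graph" using I by (auto intro!: closedin_INT)
  then have "compactin Z sol_graph" by (rule closedin_compact_space[OF compZ])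
  then show ?thesis by (simp add: Z_def subtopology_Times[symmetric] compactin_subtopology)
qed

section \<open>The two projections of the graph\<close>

lemma fst_sol_graph: "fst ` sol_graph = Mflat"
  by (simp add: sol_graph_def image_image)

lemma snd_sol_graph: "snd ` sol_graph = MP"
  by (simp add: sol_graph_def image_image M_P_eq)

lemma compactin_M_flat: "compactin weak_star (Mflat)"
  using image_compactin[OF compactin_sol_graph continuous_map_fst] by (simp add: fst_sol_graph)

lemma compactin_M_P: "compactin weak_star (MP)"
  using image_compactin[OF compactin_sol_graph continuous_map_snd] by (simp add: snd_sol_graph)

lemma M_flat_subgradient:
  assumes "yp \<in> Mflat"
  shows "yp \<in> subdifferential gp (\<tau>p (sol yp))"
proof (rule subdifferential_p)
  have "val yp - gps yp = best" using assms by (simp add: M_flat_iff peak_eq)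
  moreover have "pressure (sol yp) \<le> peak" by (rule pressure_le_peak[OF sol_inv])
  ultimately show "gps yp \<le> blinfun_apply yp (\<tau>p (sol yp)) - gp (\<tau>p (sol yp))"
    by (simp add: pressure_sol peak_eq)
qed

text \<open>Each \<open>yp\<close> in \<open>Mflat\<close> is a subgradient of \<open>gp\<close> at
  the image of its solution, and Gateaux differentiability permits only one.\<close>

lemma sol_inj:
  assumes "gateaux_differentiable gp"
  shows "inj_on sol (Mflat)"
  using gateaux_subdifferential_unique[OF assms] M_flat_subgradient by (metis inj_onI)

text \<open>Both projections of the compact graph are continuous bijections onto Hausdorff spaces.\<close>

theorem sol_homeomorphic:
  assumes "gateaux_differentiable gp"
  shows "homeomorphic_map (subtopology weak_star (Mflat))
    (subtopology weak_star (MP)) sol"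
proof -
  let ?G = "subtopology (prod_topology weak_star weak_star) sol_graph"
  let ?X = "subtopology weak_star (Mflat)"
  let ?Y = "subtopology weak_star (MP)"
  have comp: "compact_space ?G" by (rule compact_space_subtopology[OF compactin_sol_graph])
  have topG: "topspace ?G = sol_graph" by simp
  have "homeomorphic_map ?G ?X fst"
  proof (rule continuous_imp_homeomorphic_map[OF _ comp])
    show "continuous_map ?G ?X fst"
      unfolding continuous_map_in_subtopology topG
      by (auto simp: fst_sol_graph[symmetric] intro: continuous_map_from_subtopology continuous_map_fst)
    show "inj_on fst (topspace ?G)" unfolding topG by (auto simp: sol_graph_def inj_on_def)
    show "fst ` topspace ?G = topspace ?X" unfolding topG by (simp add: fst_sol_graph)
  qed (rule Hausdorff_space_subtopology[OF Hausdorff_weak_star])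
  then obtain k where k: "homeomorphic_maps ?G ?X fst k" unfolding homeomorphic_map_maps by blast
  have hk: "homeomorphic_map ?X ?G k"
    using k unfolding homeomorphic_maps_map by blast
  have hs: "homeomorphic_map ?G ?Y snd"
  proof (rule continuous_imp_homeomorphic_map[OF _ comp])
    show "continuous_map ?G ?Y snd"
      unfolding continuous_map_in_subtopology topG
      by (auto simp: snd_sol_graph[symmetric] intro: continuous_map_from_subtopology continuous_map_snd)
    show "inj_on snd (topspace ?G)"
      unfolding topG using sol_inj[OF assms] by (auto simp: sol_graph_def inj_on_def)
    show "snd ` topspace ?G = topspace ?Y" unfolding topG by (simp add: snd_sol_graph)
  qed (rule Hausdorff_space_subtopology[OF Hausdorff_weak_star])
  show ?thesis
  proof (rule homeomorphic_map_eq[OF homeomorphic_map_compose[OF hk hs]])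
    fix x assume x: "x \<in> topspace ?X"
    then have "k x \<in> sol_graph" "fst (k x) = x"
      using k hk homeomorphic_imp_surjective_map[OF hk] topG by (auto simp: homeomorphic_maps_def)
    then show "(snd \<circ> k) x = sol x" by (auto simp: sol_graph_def)
  qed
qed

lemma E_L_sc_eq: "is_min yp xm \<Longrightarrow> E_L_sc m \<theta>m \<theta>p gm yp xm = {sol yp}"
  using min_subdifferential[of yp xm] by (auto simp: E_L_sc_def E_L_eq eqm_min_eq_sol)

text \<open>The given \<open>xm\<close> makes the definite description unique: over an empty index
  set every \<open>E\<close> would qualify.\<close>

lemma E_L_sc_common_eq:
  assumes "xm \<in> M_flat_minus m \<theta>m \<theta>p gm gp yp"
  shows "E_L_sc_common m \<theta>m \<theta>p gm gp yp = {sol yp}"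
  unfolding E_L_sc_common_def
proof (rule the_equality)
  show "\<forall>xm\<in>M_flat_minus m \<theta>m \<theta>p gm gp yp. {sol yp} = E_L_sc m \<theta>m \<theta>p gm yp xm"
    using E_L_sc_eq[OF M_flat_minus_is_min] by simp
  show "E = {sol yp}" if "\<forall>xm\<in>M_flat_minus m \<theta>m \<theta>p gm gp yp. E = E_L_sc m \<theta>m \<theta>p gm yp xm" for E
    using that assms E_L_sc_eq[OF M_flat_minus_is_min[OF assms]] by simp
qed

end

theorem corollary2p18:
  fixes m :: "'a::compact_metric_space measure"
    and \<eta> :: real
    and \<theta>m :: "'a bmeas \<Rightarrow> 'x::real_normed_vector"
    and \<theta>p :: "'a bmeas \<Rightarrow> 'y::real_normed_vector"
    and gm :: "'x \<Rightarrow> real"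
    and gp :: "'y \<Rightarrow> real"
  assumes diam: "\<exists>\<omega> \<omega>' :: 'a. dist \<omega> \<omega>' = 1" "\<forall>\<omega> \<omega>' :: 'a. dist \<omega> \<omega>' \<le> 1"
    and m_prob: "prob_space m" "sets m = sets borel"
    and m_supp: "\<forall>U. open U \<and> U \<noteq> {} \<longrightarrow> 0 < emeasure m U"
    and eta: "0 < \<eta>" "\<eta> < 1"
    and theta_lin: "linear \<theta>m" "linear \<theta>p"
    and theta_normal: "sigma_normal \<theta>m" "sigma_normal \<theta>p"
    and holder: "holder_type \<eta> \<theta>m \<theta>p"
    and gm: "lower_semicontinuous gm" "convex_on UNIV gm"
    and gm_dom: "\<exists>R0>0. \<forall>R\<ge>R0.
        {x. norm x \<le> R \<and> conjugate gm x < \<infinity>} \<noteq> {} \<and>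
        closedin weak_star {x. norm x \<le> R \<and> conjugate gm x < \<infinity>}"
    and gm_growth: "minimal_linear_growth (conjugate gm) (onorm \<theta>m)"
    and gp: "lower_semicontinuous gp" "convex_on UNIV gp"
    and gp_bdd: "\<forall>A. bounded A \<longrightarrow> bounded (gp ` A)"
    and gp_conj: "\<forall>x. \<bar>conjugate gp x\<bar> \<noteq> \<infinity>"
    and gp_growth: "minimal_linear_growth (conjugate gp) (onorm \<theta>p)"
  shows "\<exists>\<mu> :: ('y \<Rightarrow>\<^sub>L real) \<Rightarrow> ('a cfun \<Rightarrow>\<^sub>L real).
      (\<forall>xp\<in>M_flat m \<theta>m \<theta>p gm gp. \<mu> xp \<in> erg_measures \<and>
         (\<forall>xm\<in>M_flat_minus m \<theta>m \<theta>p gm gp xp.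
            E_L_sc_common m \<theta>m \<theta>p gm gp xp = E_L_sc m \<theta>m \<theta>p gm xp xm \<and>
            E_L_sc m \<theta>m \<theta>p gm xp xm = E_L m \<theta>m \<theta>p xp xm \<and>
            E_L m \<theta>m \<theta>p xp xm = {\<mu> xp})) \<and>
      E_P m \<theta>m \<theta>p gm gp = M_P m \<theta>m \<theta>p gm gp \<and>
      M_P m \<theta>m \<theta>p gm gp = \<mu> ` M_flat m \<theta>m \<theta>p gm gp \<and>
      E_P m \<theta>m \<theta>p gm gp \<subseteq> erg_measures \<and>
      E_P m \<theta>m \<theta>p gm gp \<noteq> {} \<and>
      compactin weak_star (E_P m \<theta>m \<theta>p gm gp) \<and>
      (gateaux_differentiable gp \<longrightarrow>
         compactin weak_star (M_flat m \<theta>m \<theta>p gm gp) \<and>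
         homeomorphic_map
           (subtopology weak_star (M_flat m \<theta>m \<theta>p gm gp))
           (subtopology weak_star (E_P m \<theta>m \<theta>p gm gp)) \<mu>)"
proof -
  interpret variational m \<theta>m \<theta>p gm gp
  proof (rule variational.intro)
    show "\<exists>\<nu>\<in>erg_measures. \<exists>p :: real.
      entropy m \<nu> = ereal (p - blinfun_apply \<nu> (Theta \<theta>m \<theta>p ym yp)) \<and>
      (\<forall>\<mu>\<in>prob_measures. entropy m \<mu> \<le> ereal (p - blinfun_apply \<mu> (Theta \<theta>m \<theta>p ym yp))) \<and>
      (\<forall>\<mu>\<in>prob_measures. ereal (p - blinfun_apply \<mu> (Theta \<theta>m \<theta>p ym yp)) \<le> entropy m \<mu> \<longrightarrow> \<mu> = \<nu>)" for ym yp
    proof -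
      obtain \<alpha> where "0 < \<alpha>" "\<alpha> \<le> 1" "Theta \<theta>m \<theta>p ym yp \<in> holder_functions \<eta> \<alpha>"
        using holder unfolding holder_type_def by blast
      then show ?thesis using holder_equilibrium[OF eta _ m_prob] diam(2) by blast
    qed
  qed (use theta_lin theta_normal gm gm_growth gp gp_bdd gp_conj gp_growth in auto)
  show ?thesis
    unfolding E_P_eq
  proof (intro exI[of _ sol] conjI ballI impI)
    fix xp xm assume xm: "xm \<in> M_flat_minus m \<theta>m \<theta>p gm gp xp"
    note min = M_flat_minus_is_min[OF xm]
    show "E_L_sc_common m \<theta>m \<theta>p gm gp xp = E_L_sc m \<theta>m \<theta>p gm xp xm"
      by (simp add: E_L_sc_common_eq[OF xm] E_L_sc_eq[OF min])
    show "E_L_sc m \<theta>m \<theta>p gm xp xm = E_L m \<theta>m \<theta>p xp xm"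
      by (simp add: E_L_sc_eq[OF min] E_L_eq eqm_min_eq_sol[OF min])
    show "E_L m \<theta>m \<theta>p xp xm = {sol xp}" by (simp add: E_L_eq eqm_min_eq_sol[OF min])
  qed (use sol_erg M_P_nonempty compactin_M_P compactin_M_flat sol_homeomorphic in \<open>auto simp: M_P_eq\<close>)
qed

end
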